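(* (Two dimensions.) There is a constant $C>0$, independent of the number of levels $J$ and of the mesh sizes $h_k$, such that for every $v\in\mathcal K$ there exist $v_{k,i}\in\mathcal K_{k,i}$, $k=1,\dots,J$, $i=1,\dots,N_k$, with $$v=\sum_{k=1}^J\sum_{i=1}^{N_k}v_{k,i}\qquad\text{and}\qquad\sum_{k=1}^J\sum_{i=1}^{N_k}\|v_{k,i}\|^2\le C\|v\|^2 .$$
   Context: $\Omega\subset\mathbb R^2$ is a polygon. $\mathcal T_1$ is a shape regular triangulation of $\Omega$; $\mathcal T_{k+1}$ is obtained from $\mathcal T_k$ by dividing each triangle into four congruent triangles, $k=1,\dots,J-1$; $h_k$ is the mesh size of $\mathcal T_k$, so $h_k/h_{k+1}=2$. The meshes are quasi-uniform. $\|\cdot\|$ is the $L^2(\Omega)$ norm (scalar or vector). On $\mathcal T_k$: $\mathcal S_k\subset H_0^1(\Omega)$ is the space of continuous piecewise linear functions; $\mathcal V_k\subset H_0(\operatorname{div};\Omega)=\{v\in (L^2(\Omega))^2:\operatorname{div}v\in L^2(\Omega),\ v\cdot n|_{\partial\Omega}=0\}$ is the lowest order Raviart–Thomas space; $\mathcal P_k\subset L_0^2(\Omega)$ (mean-zero $L^2$ functions) is the space of piecewise constants. Write $\mathcal S=\mathcal S_J$, $\mathcal V=\mathcal V_J$, $\mathcal P=\mathcal P_J$. It is assumed that the sequence $\mathcal S\xrightarrow{\operatorname{curl}}\mathcal V\xrightarrow{\operatorname{div}}\mathcal P\to0$ is exact (here $\operatorname{curl}$ of a scalar is the rotated gradient),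 and similarly on each level. $\mathcal K=\mathcal V\cap\ker(\operatorname{div})=\operatorname{curl}\mathcal S$. $N_k=\dim\mathcal S_k$; $\Phi_{k,i}$ is the one-dimensional space spanned by the $i$-th nodal basis function of $\mathcal S_k$, and $\mathcal K_{k,i}=\operatorname{curl}\Phi_{k,i}$. Constants may depend on $\Omega$ and on the initial triangulation $\mathcal T_1$. *)

theory Defs
  imports "HOL-Analysis.Analysis"
begin

section \<open>Sobolev spaces on a planar domain\<close>

text \<open>
  Elements of $L^2(\Omega)$ are represented by functions on the whole plane; only the restriction
  to $\Omega$ matters, and the spaces below (except the continuous piecewise linear functions, which
  are handled pointwise on the closure of $\Omega$) are closed under equality almost everywhere
  in $\Omega$.
\<close>

definition L2 :: "(real^2) set \<Rightarrow> (real^2 \<Rightarrow> 'b::euclidean_space) set" where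
  "L2 \<Omega> = {f \<in> borel_measurable (lebesgue_on \<Omega>).
              integrable (lebesgue_on \<Omega>) (\<lambda>x. (norm (f x))\<^sup>2)}"

definition L2norm :: "(real^2) set \<Rightarrow> (real^2 \<Rightarrow> 'b::euclidean_space) \<Rightarrow> real" where
  "L2norm \<Omega> f = sqrt (LINT x|lebesgue_on \<Omega>. (norm (f x))\<^sup>2)"

definition ae_eq :: "(real^2) set \<Rightarrow> (real^2 \<Rightarrow> 'b) \<Rightarrow> (real^2 \<Rightarrow> 'b) \<Rightarrow> bool" where
  "ae_eq \<Omega> f g \<longleftrightarrow> (AE x in lebesgue_on \<Omega>. f x = g x)"

text \<open>Classical derivatives; for a piecewise linear function they are meaningful off the mesh
  edges, hence almost everywhere, and there they agree with the weak derivatives if the function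
  is continuous.\<close>

definition grad :: "(real^2 \<Rightarrow> real) \<Rightarrow> real^2 \<Rightarrow> real^2" where
  "grad f x = (\<chi> i. frechet_derivative f (at x) (axis i 1))"

definition curl :: "(real^2 \<Rightarrow> real) \<Rightarrow> real^2 \<Rightarrow> real^2" where
  "curl f x = vector [grad f x $ 2, - (grad f x $ 1)]"

primrec Ck :: "nat \<Rightarrow> (real^2 \<Rightarrow> real) \<Rightarrow> bool" where
  "Ck 0 f \<longleftrightarrow> continuous_on UNIV f"
| "Ck (Suc n) f \<longleftrightarrow> (\<forall>x. f differentiable (at x)) \<and> (\<forall>i. Ck n (\<lambda>x. grad f x $ i))"

definition test_functions :: "(real^2) set \<Rightarrow> (real^2 \<Rightarrow> real) set" where
  "test_functions U =
     {f. (\<forall>n. Ck n f) \<and> (\<exists>K. compact K \<and> K \<subseteq> U \<and> (\<forall>x. x \<notin> K \<longrightarrow> f x = 0))}"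

text \<open>$H^1_0(\Omega)$: the closure of $C_c^\infty(\Omega)$ in the $H^1$ norm. The limit \<open>g\<close> of the
  gradients is the weak gradient of \<open>u\<close>.\<close>

definition H10 :: "(real^2) set \<Rightarrow> (real^2 \<Rightarrow> real) set" where
  "H10 \<Omega> = {u \<in> L2 \<Omega>. \<exists>g \<in> L2 \<Omega>. \<exists>f :: nat \<Rightarrow> real^2 \<Rightarrow> real.
      (\<forall>n. f n \<in> test_functions \<Omega>) \<and>
      (\<lambda>n. L2norm \<Omega> (\<lambda>x. f n x - u x)) \<longlonglongrightarrow> 0 \<and>
      (\<lambda>n. L2norm \<Omega> (\<lambda>x. grad (f n) x - g x)) \<longlonglongrightarrow> 0}"

definition has_weak_div :: "(real^2) set \<Rightarrow> (real^2 \<Rightarrow> real^2) \<Rightarrow> (real^2 \<Rightarrow> real) \<Rightarrow> bool" where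
  "has_weak_div \<Omega> v g \<longleftrightarrow> g \<in> L2 \<Omega> \<and>
     (\<forall>\<psi> \<in> test_functions \<Omega>.
        (LINT x|lebesgue_on \<Omega>. v x \<bullet> grad \<psi> x) = - (LINT x|lebesgue_on \<Omega>. g x * \<psi> x))"

text \<open>The normal trace of \<open>v\<close> with weak divergence \<open>g\<close> is the functional
  $\psi \mapsto \int_\Omega v\cdot\nabla\psi + g\,\psi$ given by Green's formula;
  here \<open>\<psi>\<close> need not vanish on the boundary.\<close>

definition zero_normal_trace ::
    "(real^2) set \<Rightarrow> (real^2 \<Rightarrow> real^2) \<Rightarrow> (real^2 \<Rightarrow> real) \<Rightarrow> bool" where
  "zero_normal_trace \<Omega> v g \<longleftrightarrow>
     (\<forall>\<psi> \<in> test_functions UNIV. (LINT x|lebesgue_on \<Omega>. v x \<bullet> grad \<psi> x + g x * \<psi> x) = 0)"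

definition H0div :: "(real^2) set \<Rightarrow> (real^2 \<Rightarrow> real^2) set" where
  "H0div \<Omega> = {v \<in> L2 \<Omega>. \<exists>g. has_weak_div \<Omega> v g \<and> zero_normal_trace \<Omega> v g}"

definition L20 :: "(real^2) set \<Rightarrow> (real^2 \<Rightarrow> real) set" where
  "L20 \<Omega> = {p \<in> L2 \<Omega>. (LINT x|lebesgue_on \<Omega>. p x) = 0}"

section \<open>Polygons and triangulations\<close>

text \<open>A polygon is a bounded polygonal domain; the condition that it is the interior of its
  closure excludes slits. Simple connectedness is not required.\<close>

definition polygon :: "(real^2) set \<Rightarrow> bool" where
  "polygon \<Omega> \<longleftrightarrow> \<Omega> \<noteq> {} \<and> open \<Omega> \<and> connected \<Omega> \<and> bounded \<Omega> \<and> interior (closure \<Omega>) = \<Omega> \<and>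
     (\<exists>E :: ((real^2) \<times> (real^2)) set. finite E \<and> frontier \<Omega> = (\<Union>(a, b)\<in>E. closed_segment a b))"

text \<open>A triangle is given by the set of its three vertices; the closed triangle is their convex
  hull.\<close>

definition triangle :: "(real^2) set \<Rightarrow> bool" where
  "triangle t \<longleftrightarrow> card t = 3 \<and> \<not> affine_dependent t"

definition triangulation_of :: "(real^2) set \<Rightarrow> (real^2) set set \<Rightarrow> bool" where
  "triangulation_of \<Omega> T \<longleftrightarrow> finite T \<and> (\<forall>t\<in>T. triangle t) \<and>
     (\<Union>t\<in>T. convex hull t) = closure \<Omega> \<and>
     (\<forall>t\<in>T. \<forall>t'\<in>T. convex hull t \<inter> convex hull t' = convex hull (t \<inter> t'))"

definition inball_diameter :: "(real^2) set \<Rightarrow> real" where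
  "inball_diameter K = Sup {2 * r | x r. 0 < r \<and> ball x r \<subseteq> K}"

definition shape_regular :: "real \<Rightarrow> (real^2) set set \<Rightarrow> bool" where
  "shape_regular \<sigma> T \<longleftrightarrow>
     (\<forall>t\<in>T. diameter (convex hull t) \<le> \<sigma> * inball_diameter (convex hull t))"

definition mesh_size :: "(real^2) set set \<Rightarrow> real" where
  "mesh_size T = Max ((\<lambda>t. diameter (convex hull t)) ` T)"

definition quasi_uniform :: "real \<Rightarrow> (real^2) set set \<Rightarrow> bool" where
  "quasi_uniform \<tau> T \<longleftrightarrow> (\<forall>t\<in>T. mesh_size T \<le> \<tau> * diameter (convex hull t))"

text \<open>Division of a triangle into four congruent ones by joining the midpoints of its edges:
  one triangle at each vertex \<open>p\<close> (note \<open>midpoint p p = p\<close>) and the one spanned by the three edge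
  midpoints.\<close>

definition divide :: "(real^2) set \<Rightarrow> (real^2) set set" where
  "divide t = insert {midpoint p q | p q. p \<in> t \<and> q \<in> t \<and> p \<noteq> q} ((\<lambda>p. midpoint p ` t) ` t)"

definition refine :: "(real^2) set set \<Rightarrow> (real^2) set set" where
  "refine T = (\<Union>t\<in>T. divide t)"

text \<open>The levels are numbered from 1: \<open>mesh T1 1 = T1\<close>.\<close>

definition mesh :: "(real^2) set set \<Rightarrow> nat \<Rightarrow> (real^2) set set" where
  "mesh T1 k = (refine ^^ (k - 1)) T1"

section \<open>Finite element spaces\<close>

definition pw_linear :: "(real^2) set set \<Rightarrow> (real^2 \<Rightarrow> real) set" where
  "pw_linear T = {\<phi>. continuous_on (\<Union>t\<in>T. convex hull t) \<phi> \<and>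
     (\<forall>t\<in>T. \<exists>a c. \<forall>x \<in> convex hull t. \<phi> x = a \<bullet> x + c)}"

definition S_space :: "(real^2) set \<Rightarrow> (real^2) set set \<Rightarrow> (real^2 \<Rightarrow> real) set" where
  "S_space \<Omega> T = H10 \<Omega> \<inter> pw_linear T"

definition V_space :: "(real^2) set \<Rightarrow> (real^2) set set \<Rightarrow> (real^2 \<Rightarrow> real^2) set" where
  "V_space \<Omega> T = {v \<in> H0div \<Omega>. \<forall>t\<in>T. \<exists>a b. ae_eq (convex hull t) v (\<lambda>x. a + b *\<^sub>R x)}"

definition P_space :: "(real^2) set \<Rightarrow> (real^2) set set \<Rightarrow> (real^2 \<Rightarrow> real) set" where
  "P_space \<Omega> T = {p \<in> L20 \<Omega>. \<forall>t\<in>T. \<exists>c. ae_eq (convex hull t) p (\<lambda>x. c)}"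

definition K_space :: "(real^2) set \<Rightarrow> (real^2) set set \<Rightarrow> (real^2 \<Rightarrow> real^2) set" where
  "K_space \<Omega> T = {v \<in> V_space \<Omega> T. has_weak_div \<Omega> v (\<lambda>x. 0)}"

text \<open>Exactness of $\mathcal S \to \mathcal V \to \mathcal P \to 0$: the range of curl is the kernel
  of div in $\mathcal V$, and the range of div is $\mathcal P$.\<close>

definition exact_sequence :: "(real^2) set \<Rightarrow> (real^2) set set \<Rightarrow> bool" where
  "exact_sequence \<Omega> T \<longleftrightarrow>
     {v. \<exists>\<phi> \<in> S_space \<Omega> T. ae_eq \<Omega> v (curl \<phi>)} = K_space \<Omega> T \<and>
     {p. \<exists>v \<in> V_space \<Omega> T. has_weak_div \<Omega> v p} = P_space \<Omega> T"

text \<open>The nodal basis functions of $\mathcal S_k$ are indexed by the interior vertices of the mesh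
  rather than by $1,\dots,N_k$.\<close>

definition nodes :: "(real^2) set \<Rightarrow> (real^2) set set \<Rightarrow> (real^2) set" where
  "nodes \<Omega> T = \<Union>T \<inter> \<Omega>"

text \<open>The values outside the triangulated region are left unspecified; inside, the nodal basis
  function is determined uniquely by its values at all vertices, including those on the boundary.\<close>

definition is_nodal_basis :: "(real^2) set set \<Rightarrow> real^2 \<Rightarrow> (real^2 \<Rightarrow> real) \<Rightarrow> bool" where
  "is_nodal_basis T p \<phi> \<longleftrightarrow> \<phi> \<in> pw_linear T \<and> (\<forall>q\<in>\<Union>T. \<phi> q = (if q = p then 1 else 0))"

definition Phi_space :: "(real^2) set set \<Rightarrow> real^2 \<Rightarrow> (real^2 \<Rightarrow> real) set" where
  "Phi_space T p = {\<lambda>x. c * \<phi> x | c \<phi>. is_nodal_basis T p \<phi>}"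

definition K_node :: "(real^2) set \<Rightarrow> (real^2) set set \<Rightarrow> real^2 \<Rightarrow> (real^2 \<Rightarrow> real^2) set" where
  "K_node \<Omega> T p = {w. \<exists>\<phi> \<in> Phi_space T p. ae_eq \<Omega> w (curl \<phi>)}"

end

theory Submission
  imports Defs
begin

text \<open>
  Write \<open>v = curl \<phi>\<close> with \<open>\<phi>\<close> in the finest space. The mean of \<open>\<nabla>\<phi>\<close> over a triangle of level \<open>k\<close> only depends
  on the means of \<open>\<phi>\<close> over its edges: it is the gradient of the Crouzeix-Raviart interpolant \<open>c\<^sub>k\<close>. So the
  broken gradients of \<open>c\<^sub>k - c\<^sub>k\<^sub>-\<^sub>1\<close> are martingale differences, hence orthogonal, and a Poincare inequality
  on each coarse triangle gives \<open>\<Sum>\<^sub>k h\<^sub>k\<^sup>-\<^sup>2 \<parallel>c\<^sub>k - c\<^sub>k\<^sub>-\<^sub>1\<parallel>\<^sup>2 \<le> C \<parallel>\<nabla>\<phi>\<parallel>\<^sup>2\<close>. No elliptic regularity is needed.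

  The \<open>c\<^sub>k\<close> are nonconforming. Replacing them by conforming companions \<open>u\<^sub>k\<close> costs the jumps of \<open>\<nabla>c\<^sub>k\<close> over
  the edges of level \<open>k\<close>. Passing to the next level halves the weighted sum of the squared old jumps, because
  an edge has two children but the weight has a factor \<open>1/4\<close>, and adds the martingale differences; hence the
  jumps are summable over the levels too. The decomposition of \<open>\<phi>\<close> is given by the nodal values of
  \<open>u\<^sub>k - u\<^sub>k\<^sub>-\<^sub>1\<close>.
\<close>


section \<open>Triangles\<close>

text \<open>In the plane the curl of a hat function has a norm bounded on every level: its gradient
  is of order \<open>2 ^ k\<close> and its support has area of order one over \<open>4 ^ k\<close>.
  So a plain sum of squared coefficients has to be bounded, and all sums below run over triangles or
  vertices with at most a power of 4 as weight. The constants do not grow with the level because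
  every triangle of level \<open>k\<close> is a translate of a triangle of \<open>T1\<close>, scaled
  by plus or minus \<open>2 / 2 ^ k\<close>. Two obstacles shape the geometric part. Jumps control
  the companion at a vertex only if the triangles there are linked through shared edges; at a
  boundary vertex they may fall into several fans, and each fan must reach a boundary edge instead.
  Moreover \<open>H10\<close> is a closure in norm, so zero values on the boundary have to be
  derived, by translations between cones outside and inside the domain. On the coarsest level no
  coarser function can be subtracted; there a Poincare inequality along chains of triangles that end
  at the boundary takes over.\<close>

lemma affine_le_on_hull:
  fixes a a' :: "real^2"
  assumes "\<And>x. x \<in> t \<Longrightarrow> a \<bullet> x + c \<le> a' \<bullet> x + c'" "x \<in> convex hull t"
  shows "a \<bullet> x + c \<le> a' \<bullet> x + c'"
proof -
  have "convex hull t \<subseteq> {x. (a - a') \<bullet> x \<le> c' - c}"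
  proof (rule hull_minimal)
    show "t \<subseteq> {x. (a - a') \<bullet> x \<le> c' - c}" using assms(1) by (force simp: inner_diff_left)
  qed (rule convex_halfspace_le)
  then show ?thesis using assms(2) by (auto simp: inner_diff_left algebra_simps)
qed

lemma affine_eq_on_hull:
  fixes a a' :: "real^2"
  assumes "\<And>x. x \<in> t \<Longrightarrow> a \<bullet> x + c = a' \<bullet> x + c'" "x \<in> convex hull t"
  shows "a \<bullet> x + c = a' \<bullet> x + c'"
  by (rule antisym; rule affine_le_on_hull[OF _ assms(2)]) (use assms(1) in auto)

lemma triangle_finite: "triangle t \<Longrightarrow> finite t"
  unfolding triangle_def by (metis card.infinite numeral_eq_Suc nat.distinct(1))

lemma triangle_cases:
  assumes "triangle t"
  obtains p q r where "t = {p, q, r}" "p \<noteq> q" "p \<noteq> r" "q \<noteq> r"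
  using assms unfolding triangle_def by (metis card_3_iff)

lemma triangle_cases_at:
  assumes "triangle t" "p \<in> t"
  obtains q r where "t = {p, q, r}" "p \<noteq> q" "p \<noteq> r" "q \<noteq> r"
proof -
  obtain a b c where "t = {a, b, c}" "a \<noteq> b" "a \<noteq> c" "b \<noteq> c" using assms(1) by (rule triangle_cases)
  with assms(2) consider "p = a" | "p = b" | "p = c" by auto
  then show ?thesis
  proof cases
    case 1 with \<open>t = _\<close> \<open>a \<noteq> b\<close> \<open>a \<noteq> c\<close> \<open>b \<noteq> c\<close> show ?thesis by (intro that[of b c]) auto
  next
    case 2 with \<open>t = _\<close> \<open>a \<noteq> b\<close> \<open>a \<noteq> c\<close> \<open>b \<noteq> c\<close> show ?thesis by (intro that[of a c]) auto
  next
    case 3 with \<open>t = _\<close> \<open>a \<noteq> b\<close> \<open>a \<noteq> c\<close> \<open>b \<noteq> c\<close> show ?thesis by (intro that[of a b]) auto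
  qed
qed

lemma triangle_affine_hull: "triangle t \<Longrightarrow> affine hull t = (UNIV :: (real^2) set)"
  unfolding triangle_def by (intro affine_independent_span_eq) (auto simp: )

lemma triangle_affine_unique:
  fixes a a' :: "real^2"
  assumes "triangle t" "\<And>x. x \<in> t \<Longrightarrow> a \<bullet> x + c = a' \<bullet> x + c'"
  shows "a = a'" "c = c'"
proof -
  have "affine {x. (a - a') \<bullet> x = c' - c}" by (rule affine_hyperplane)
  moreover have "t \<subseteq> {x. (a - a') \<bullet> x = c' - c}"
    using assms(2) by (auto simp: inner_diff_left algebra_simps)
  ultimately have "affine hull t \<subseteq> {x. (a - a') \<bullet> x = c' - c}" by (intro hull_minimal)
  then have *: "(a - a') \<bullet> x = c' - c" for x using triangle_affine_hull[OF assms(1)] by auto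
  from *[of 0] have "c = c'" by simp
  with *[of "a - a'"] show "a = a'" "c = c'" by auto
qed

lemma triangle_interpolation:
  fixes t :: "(real^2) set" and f :: "real^2 \<Rightarrow> real"
  assumes "triangle t"
  obtains a c where "\<And>x. x \<in> t \<Longrightarrow> a \<bullet> x + c = f x"
proof -
  obtain p q r where t: "t = {p, q, r}" "p \<noteq> q" "p \<noteq> r" "q \<noteq> r" using assms by (rule triangle_cases)
  have "\<not> dependent ((\<lambda>x. - p + x) ` (t - {p}))"
    using affine_dependent_iff_dependent2[of p t] assms t(1) unfolding triangle_def by auto
  then obtain g where g: "linear g" "\<forall>x\<in>(\<lambda>x. - p + x) ` (t - {p}). g x = f (p + x) - f p"
    using linear_independent_extend[of _ "\<lambda>x. f (p + x) - f p"] by blast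
  define a where "a = (\<Sum>i\<in>Basis. g i *\<^sub>R (i::real^2))"
  have a: "a \<bullet> x = g x" for x
  proof -
    have "g x = g (\<Sum>i\<in>Basis. (x \<bullet> i) *\<^sub>R i)" by (simp add: euclidean_representation)
    also have "\<dots> = (\<Sum>i\<in>Basis. (x \<bullet> i) * g i)"
      using g(1) by (simp add: linear_sum linear_scale)
    also have "\<dots> = a \<bullet> x" by (simp add: a_def inner_sum_left inner_commute[of x] mult.commute)
    finally show ?thesis by simp
  qed
  show ?thesis
  proof (rule that[of a "f p - g p"])
    fix x assume x: "x \<in> t"
    show "a \<bullet> x + (f p - g p) = f x"
    proof (cases "x = p")
      case False
      then have "g (- p + x) = f x - f p" using g(2) x by auto
      moreover have "g (- p + x) = g x - g p" using g(1) by (simp add: linear_diff)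
      ultimately show ?thesis using a by simp
    qed (simp add: a)
  qed
qed

lemma triangle_interior_nonempty:
  "triangle t \<Longrightarrow> interior (convex hull t) \<noteq> {}"
  using interior_convex_hull_eq_empty[of t] unfolding triangle_def by auto

lemma triangle_hull_compact: "triangle t \<Longrightarrow> compact (convex hull t)"
  by (simp add: finite_imp_compact_convex_hull triangle_finite)

section \<open>Conforming triangulations\<close>

text \<open>The part of \<open>triangulation_of\<close> that does not mention the domain, so that it
  also applies to a single triangle.\<close>

definition conforming :: "(real^2) set set \<Rightarrow> bool" where
  "conforming T \<longleftrightarrow> finite T \<and> (\<forall>t\<in>T. triangle t) \<and>
     (\<forall>t\<in>T. \<forall>t'\<in>T. convex hull t \<inter> convex hull t' = convex hull (t \<inter> t'))"

text \<open>Continuity is not demanded: it follows since one function is affine on each of finitely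
  many closed triangles. If \<open>p\<close> is no vertex, the function vanishes on the
  mesh.\<close>

definition hat_on :: "(real^2) set set \<Rightarrow> real^2 \<Rightarrow> (real^2 \<Rightarrow> real) \<Rightarrow> bool" where
  "hat_on T p f \<longleftrightarrow> (\<forall>t\<in>T. \<exists>a c. \<forall>x\<in>convex hull t. f x = a \<bullet> x + c) \<and>
     (\<forall>q\<in>\<Union>T. f q = (if q = p then 1 else 0))"

lemma hat_onD:
  assumes "hat_on T p f" "t \<in> T"
  obtains a c where "\<And>x. x \<in> convex hull t \<Longrightarrow> f x = a \<bullet> x + c"
  using assms unfolding hat_on_def by blast

lemma hat_on_vertex: "hat_on T p f \<Longrightarrow> q \<in> t \<Longrightarrow> t \<in> T \<Longrightarrow> f q = (if q = p then 1 else 0)"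
  unfolding hat_on_def by blast

lemma conforming_finite: "conforming T \<Longrightarrow> finite T"
  and conforming_triangle: "conforming T \<Longrightarrow> t \<in> T \<Longrightarrow> triangle t"
  and conforming_Int: "conforming T \<Longrightarrow> t \<in> T \<Longrightarrow> t' \<in> T \<Longrightarrow>
    convex hull t \<inter> convex hull t' = convex hull (t \<inter> t')"
  unfolding conforming_def by auto

lemma conforming_finite_vertices: "conforming T \<Longrightarrow> finite (\<Union>T)"
  using conforming_finite conforming_triangle triangle_finite by auto

text \<open>The affine interpolants on two triangles agree on the hull of the common vertices, which
  is their whole intersection. So any choice of a triangle around a point gives the same
  value.\<close>

lemma hat_on_exists:
  assumes T: "conforming T"
  obtains f where "hat_on T p f"
proof -
  have "\<forall>t\<in>T. \<exists>a c. \<forall>x\<in>t. a \<bullet> x + c = (if x = p then 1 else 0)"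
    using triangle_interpolation[of _ "\<lambda>x. if x = p then 1 else 0"] conforming_triangle[OF T] by metis
  then obtain a c where ac: "\<And>t x. t \<in> T \<Longrightarrow> x \<in> t \<Longrightarrow> a t \<bullet> x + c t = (if x = p then 1 else 0)"
    by metis
  define \<tau> where "\<tau> x = (SOME t. t \<in> T \<and> x \<in> convex hull t)" for x
  define f where "f x = a (\<tau> x) \<bullet> x + c (\<tau> x)" for x
  have f: "f x = a t \<bullet> x + c t" if t: "t \<in> T" "x \<in> convex hull t" for t x
  proof -
    have \<tau>: "\<tau> x \<in> T" "x \<in> convex hull (\<tau> x)"
      using someI[of "\<lambda>t. t \<in> T \<and> x \<in> convex hull t" t] t unfolding \<tau>_def by auto
    then have "x \<in> convex hull (\<tau> x \<inter> t)" using conforming_Int[OF T, of "\<tau> x" t] t by auto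
    then show ?thesis unfolding f_def
      by (rule affine_eq_on_hull[rotated]) (use ac \<tau> t in auto)
  qed
  have "f q = (if q = p then 1 else 0)" if "t \<in> T" "q \<in> t" for t q
    using f[OF that(1) hull_inc[OF that(2)]] ac[OF that] by simp
  then have "hat_on T p f" unfolding hat_on_def using f by blast
  then show ?thesis by (rule that)
qed

text \<open>Converse of \<open>hat_on_exists\<close>. On \<open>t\<close> the hat function of a
  vertex \<open>p\<close> is the barycentric coordinate of \<open>p\<close>, and on a triangle
  without \<open>p\<close> it vanishes; so a point of both triangles has weight on common vertices
  only. Conformity of a refined mesh thereby reduces to writing down its hat functions.\<close>

lemma conformingI_hat:
  assumes "finite T" "\<And>t. t \<in> T \<Longrightarrow> triangle t" "\<And>p. p \<in> \<Union>T \<Longrightarrow> \<exists>f. hat_on T p f"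
  shows "conforming T"
proof -
  obtain f where f: "\<And>p. p \<in> \<Union>T \<Longrightarrow> hat_on T p (f p)" using assms(3) by metis
  have "x \<in> convex hull (t \<inter> t')"
    if t: "t \<in> T" "t' \<in> T" "x \<in> convex hull t" "x \<in> convex hull t'" for t t' x
  proof -
    have fin: "finite t" using assms(2) t triangle_finite by auto
    obtain l where l: "\<forall>y\<in>t. 0 \<le> l y" "sum l t = 1" "(\<Sum>y\<in>t. l y *\<^sub>R y) = x"
      using t(3) convex_hull_finite[OF fin] by auto
    have fl: "f p x = l p" if p: "p \<in> t" for p
    proof -
      have h: "hat_on T p (f p)" using f p t by auto
      then obtain a c where ac: "\<And>x. x \<in> convex hull t \<Longrightarrow> f p x = a \<bullet> x + c" using hat_onD t by metis
      have "f p x = a \<bullet> (\<Sum>y\<in>t. l y *\<^sub>R y) + (\<Sum>y\<in>t. l y) * c" using ac t l by auto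
      also have "\<dots> = (\<Sum>y\<in>t. l y * (a \<bullet> y + c))"
        by (simp add: inner_sum_right sum_distrib_right sum.distrib distrib_left)
      also have "\<dots> = (\<Sum>y\<in>t. l y * (if y = p then 1 else 0))"
        using ac hat_on_vertex[OF h _ t(1)] hull_inc[of _ t convex] by (intro sum.cong) auto
      also have "\<dots> = l p" using p fin by (simp add: if_distrib[of "\<lambda>z. _ * z"] cong: if_cong)
      finally show ?thesis .
    qed
    have z: "l p = 0" if p: "p \<in> t - t \<inter> t'" for p
    proof -
      have h: "hat_on T p (f p)" using f p t by auto
      then obtain a c where ac: "\<And>x. x \<in> convex hull t' \<Longrightarrow> f p x = a \<bullet> x + c" using hat_onD t by metis
      have "a \<bullet> x + c = 0 \<bullet> x + 0"
      proof (rule affine_eq_on_hull[OF _ t(4)])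
        fix y assume y: "y \<in> t'"
        then have "f p y = 0" using hat_on_vertex[OF h y t(2)] p by auto
        then show "a \<bullet> y + c = 0 \<bullet> y + 0" using ac[of y] y by (simp add: hull_inc)
      qed
      then show ?thesis using fl[of p] p ac t by auto
    qed
    have "sum l t = sum l (t \<inter> t')" "(\<Sum>y\<in>t. l y *\<^sub>R y) = (\<Sum>y\<in>t \<inter> t'. l y *\<^sub>R y)"
      using fin z by (intro sum.mono_neutral_right; auto)+
    then show ?thesis using l convex_hull_finite[of "t \<inter> t'"] fin by auto
  qed
  then have "convex hull t \<inter> convex hull t' = convex hull (t \<inter> t')" if "t \<in> T" "t' \<in> T" for t t'
    using that hull_mono[of "t \<inter> t'" t convex] hull_mono[of "t \<inter> t'" t' convex] by auto
  then show ?thesis using assms unfolding conforming_def by auto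
qed

lemma hat_on_eq_0:
  assumes "hat_on T p f" "t \<in> T" "x \<in> convex hull t" "p \<notin> t"
  shows "f x = 0"
proof -
  obtain a c where ac: "\<And>x. x \<in> convex hull t \<Longrightarrow> f x = a \<bullet> x + c"
    using hat_onD[OF assms(1,2)] by metis
  have "a \<bullet> x + c = 0 \<bullet> x + 0"
    by (rule affine_eq_on_hull[OF _ assms(3)])
      (use ac hat_on_vertex[OF assms(1) _ assms(2)] assms(4) hull_inc[of _ t convex] in force)
  then show ?thesis using ac assms(3) by simp
qed

lemma hat_on_midpoint:
  assumes "hat_on T p f" "t \<in> T" "a \<in> t" "b \<in> t"
  shows "f (midpoint a b) = (f a + f b) / 2"
proof -
  obtain g c where gc: "\<And>x. x \<in> convex hull t \<Longrightarrow> f x = g \<bullet> x + c"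
    using hat_onD[OF assms(1,2)] by metis
  have "midpoint a b \<in> convex hull t"
    using convexD[OF convex_convex_hull[of t], of a b "1/2" "1/2"] hull_inc[of _ t convex] assms
    by (simp add: midpoint_def scaleR_add_right)
  then show ?thesis using gc hull_inc[of _ t convex] assms
    by (simp add: midpoint_def inner_add_right field_simps)
qed

text \<open>The hat function of \<open>v\<close> at \<open>midpoint p q\<close> is half the number
  of times that \<open>v\<close> occurs among \<open>p\<close> and \<open>q\<close>, so the midpoint
  determines the pair. The case \<open>p = q\<close> is included; hence vertices never coincide with
  edge midpoints.\<close>

lemma conforming_midpoint_inj:
  assumes T: "conforming T" "t \<in> T" "t' \<in> T" "{p, q} \<subseteq> t" "{p', q'} \<subseteq> t'"
    and eq: "midpoint p q = midpoint p' q'"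
  shows "{p, q} = {p', q'}"
proof -
  have *: "(if p = v then 1 else 0) + (if q = v then 1 else 0) = (if p' = v then 1 else (0::real)) + (if q' = v then 1 else 0)" for v
  proof -
    obtain f where f: "hat_on T v f" using hat_on_exists[OF T(1)] .
    have "(f p + f q) / 2 = (f p' + f q') / 2"
      using hat_on_midpoint[OF f T(2), of p q] hat_on_midpoint[OF f T(3), of p' q'] T eq by simp
    moreover have "f p = (if p = v then 1 else 0)" "f q = (if q = v then 1 else 0)"
        "f p' = (if p' = v then 1 else 0)" "f q' = (if q' = v then 1 else 0)"
      using hat_on_vertex[OF f] T by blast+
    ultimately show ?thesis by (smt (verit) field_sum_of_halves)
  qed
  have "v \<in> {p, q} \<longleftrightarrow> v \<in> {p', q'}" for v using *[of v] by (auto split: if_splits)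
  then show ?thesis by blast
qed

section \<open>Refinement\<close>

definition aff :: "(real^2) set \<Rightarrow> (real^2 \<Rightarrow> real) \<Rightarrow> bool" where
  "aff t f \<longleftrightarrow> (\<exists>a c. \<forall>x\<in>convex hull t. f x = a \<bullet> x + c)"

lemma affI: "(\<And>x. x \<in> convex hull t \<Longrightarrow> f x = a \<bullet> x + c) \<Longrightarrow> aff t f"
  unfolding aff_def by blast

lemma affE:
  assumes "aff t f"
  obtains a c where "\<And>x. x \<in> convex hull t \<Longrightarrow> f x = a \<bullet> x + c"
  using assms unfolding aff_def by blast

lemma aff_const: "aff t (\<lambda>x. k)"
  by (rule affI[of _ _ 0 k]) simp

lemma aff_add:
  assumes "aff t f" "aff t g"
  shows "aff t (\<lambda>x. f x + g x)"
proof -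
  obtain a c where 1: "\<And>x. x \<in> convex hull t \<Longrightarrow> f x = a \<bullet> x + c" using affE[OF assms(1)] by metis
  obtain a' c' where 2: "\<And>x. x \<in> convex hull t \<Longrightarrow> g x = a' \<bullet> x + c'" using affE[OF assms(2)] by metis
  show ?thesis by (rule affI[of _ _ "a + a'" "c + c'"]) (simp add: 1 2 inner_add_left)
qed

lemma aff_cmult:
  assumes "aff t f"
  shows "aff t (\<lambda>x. k * f x)"
proof -
  obtain a c where 1: "\<And>x. x \<in> convex hull t \<Longrightarrow> f x = a \<bullet> x + c" using affE[OF assms(1)] by metis
  show ?thesis by (rule affI[of _ _ "k *\<^sub>R a" "k * c"]) (simp add: 1 algebra_simps)
qed

lemma aff_diff: "aff t f \<Longrightarrow> aff t g \<Longrightarrow> aff t (\<lambda>x. f x - g x)"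
  using aff_add[of t f "\<lambda>x. - 1 * g x"] aff_cmult[of t g "-1"] by simp

lemma aff_sum: "(\<And>i. i \<in> I \<Longrightarrow> aff t (f i)) \<Longrightarrow> aff t (\<lambda>x. \<Sum>i\<in>I. f i x)"
  by (induction I rule: infinite_finite_induct) (auto intro: aff_add aff_const)

lemma aff_cong: "aff t g \<Longrightarrow> (\<And>x. x \<in> convex hull t \<Longrightarrow> f x = g x) \<Longrightarrow> aff t f"
  unfolding aff_def by auto

lemma aff_mono: "aff t f \<Longrightarrow> convex hull s \<subseteq> convex hull t \<Longrightarrow> aff s f"
  unfolding aff_def by blast

lemma aff_nonneg:
  assumes "aff t f" "\<And>x. x \<in> t \<Longrightarrow> 0 \<le> f x" "x \<in> convex hull t"
  shows "0 \<le> f x"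
proof -
  obtain a c where 1: "\<And>x. x \<in> convex hull t \<Longrightarrow> f x = a \<bullet> x + c" using affE[OF assms(1)] by metis
  have "0 \<bullet> x + 0 \<le> a \<bullet> x + c"
    by (rule affine_le_on_hull[OF _ assms(3)]) (use assms(2) 1 hull_inc[of _ t convex] in force)
  with 1[OF assms(3)] show ?thesis by simp
qed

lemma aff_le:
  assumes "aff t f" "aff t g" "\<And>x. x \<in> t \<Longrightarrow> f x \<le> g x" "x \<in> convex hull t"
  shows "f x \<le> g x"
  using aff_nonneg[OF aff_diff[OF assms(2,1)], of x] assms(3,4) by simp

lemma aff_eq:
  assumes "aff t f" "aff t g" "\<And>x. x \<in> t \<Longrightarrow> f x = g x" "x \<in> convex hull t"
  shows "f x = g x"
  by (rule antisym; rule aff_le) (use assms in auto)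

lemma midpoint_in_hull: "a \<in> t \<Longrightarrow> b \<in> t \<Longrightarrow> midpoint a b \<in> convex hull t"
  using convexD[OF convex_convex_hull[of t], of a b "1/2" "1/2"] hull_inc[of _ t convex]
  by (simp add: midpoint_def scaleR_add_right)

lemma aff_midpoint:
  assumes "aff t f" "a \<in> t" "b \<in> t"
  shows "f (midpoint a b) = (f a + f b) / 2"
proof -
  obtain g c where gc: "\<And>x. x \<in> convex hull t \<Longrightarrow> f x = g \<bullet> x + c" using affE[OF assms(1)] by metis
  show ?thesis using gc hull_inc[of _ t convex] assms midpoint_in_hull[OF assms(2,3)]
    by (simp add: midpoint_def inner_add_right field_simps)
qed

lemma hat_on_aff: "hat_on T p f \<Longrightarrow> t \<in> T \<Longrightarrow> aff t f"
  unfolding hat_on_def aff_def by auto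

section \<open>The four children of a triangle\<close>

definition corner :: "(real^2) set \<Rightarrow> real^2 \<Rightarrow> (real^2) set" where
  "corner t p = midpoint p ` t"

definition centre :: "(real^2) set \<Rightarrow> (real^2) set" where
  "centre t = {midpoint p q | p q. p \<in> t \<and> q \<in> t \<and> p \<noteq> q}"

lemma divide_eq: "divide t = insert (centre t) (corner t ` t)"
  by (simp add: divide_def centre_def corner_def[abs_def])

lemma corner_triple: "corner {p, q, r} p = {p, midpoint p q, midpoint p r}"
  by (simp add: corner_def)

lemma centre_triple:
  assumes "p \<noteq> q" "p \<noteq> r" "q \<noteq> r"
  shows "centre {p, q, r} = {midpoint p q, midpoint p r, midpoint q r}"
proof -
  have "centre {p, q, r} = {midpoint p q, midpoint p r, midpoint q p, midpoint q r, midpoint r p, midpoint r q}"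
    unfolding centre_def using assms by blast
  then show ?thesis by (simp add: midpoint_sym[of q p] midpoint_sym[of r p] midpoint_sym[of r q] insert_commute)
qed

lemma divide_cases [consumes 2, case_names corner centre]:
  assumes "triangle t" "s \<in> divide t"
  obtains (corner) p q r where "t = {p, q, r}" "p \<noteq> q" "p \<noteq> r" "q \<noteq> r"
      "s = {p, midpoint p q, midpoint p r}" "s = corner t p"
    | (centre) p q r where "t = {p, q, r}" "p \<noteq> q" "p \<noteq> r" "q \<noteq> r"
      "s = {midpoint p q, midpoint p r, midpoint q r}" "s = centre t"
proof -
  consider "s = centre t" | p where "p \<in> t" "s = corner t p" using assms(2) unfolding divide_eq by auto
  then show ?thesis
  proof cases
    case 1
    obtain p q r where "t = {p, q, r}" "p \<noteq> q" "p \<noteq> r" "q \<noteq> r" using assms(1) by (rule triangle_cases)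
    then show ?thesis using 1 centre_triple centre by metis
  next
    case 2
    obtain q r where "t = {p, q, r}" "p \<noteq> q" "p \<noteq> r" "q \<noteq> r" using assms(1) 2(1) by (rule triangle_cases_at)
    then show ?thesis using 2 corner_triple corner by metis
  qed
qed

text \<open>A corner child is the image under the homothety of ratio 1/2 about its vertex. The
  central child is turned upside down and needs ratio -1/2, whence the absolute value.\<close>

lemma divide_affine_image:
  assumes "triangle t" "s \<in> divide t"
  obtains z and e :: real where "\<bar>e\<bar> = 1/2" "s = (\<lambda>x. z + e *\<^sub>R x) ` t"
  using assms
proof (cases rule: divide_cases)
  case (corner p q r)
  have "s = (\<lambda>x. (1/2) *\<^sub>R p + (1/2) *\<^sub>R x) ` t" using corner
    by (simp add: midpoint_def scaleR_add_right[symmetric] flip: scaleR_2)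
  then show ?thesis by (rule that[rotated]) simp
next
  case (centre p q r)
  have *: "(1/2) *\<^sub>R (p + q + r) + (-1/2) *\<^sub>R p = midpoint q r"
       "(1/2) *\<^sub>R (p + q + r) + (-1/2) *\<^sub>R q = midpoint p r"
       "(1/2) *\<^sub>R (p + q + r) + (-1/2) *\<^sub>R r = midpoint p q"
    by (simp_all add: midpoint_def scaleR_add_right)
  have "s = (\<lambda>x. (1/2) *\<^sub>R (p + q + r) + (-1/2) *\<^sub>R x) ` t" using centre *
    by auto
  then show ?thesis by (rule that[rotated]) simp
qed

lemma triangle_similar:
  assumes "triangle t" "e \<noteq> 0"
  shows "triangle ((\<lambda>x. z + e *\<^sub>R x) ` t)"
proof -
  have inj: "inj ((*\<^sub>R) e :: real^2 \<Rightarrow> real^2)"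
    using assms(2) by (intro injI) (metis scaleR_left_imp_eq)
  then have "inj_on (\<lambda>x. z + e *\<^sub>R x) t" unfolding inj_on_def by (metis UNIV_I add_left_cancel)
  moreover have "\<not> affine_dependent ((\<lambda>x. z + e *\<^sub>R x) ` t)"
  proof -
    have "linear ((*\<^sub>R) e :: real^2 \<Rightarrow> real^2)" by (rule linear_scaleR)
    with inj have "aff_dim ((+) z ` ((*\<^sub>R) e ` t)) = aff_dim t"
      by (simp only: aff_dim_translation_eq aff_dim_injective_linear_image)
    then have "aff_dim ((\<lambda>x. z + e *\<^sub>R x) ` t) = aff_dim t" by (simp add: image_image)
    then show ?thesis using assms(1) calculation triangle_finite[OF assms(1)]
      unfolding triangle_def affine_independent_iff_card by (simp add: card_image)
  qed
  ultimately show ?thesis using assms(1) unfolding triangle_def by (simp add: card_image)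
qed

lemma triangle_divide:
  assumes "triangle t" "s \<in> divide t"
  shows "triangle s"
proof -
  obtain z and e :: real where "\<bar>e\<bar> = 1/2" "s = (\<lambda>x. z + e *\<^sub>R x) ` t"
    using divide_affine_image[OF assms] by metis
  then show ?thesis using triangle_similar[OF assms(1), of e z] by auto
qed

lemma divide_vertex:
  assumes "s \<in> divide t" "z \<in> s"
  obtains a b where "a \<in> t" "b \<in> t" "z = midpoint a b"
  using assms unfolding divide_eq corner_def centre_def by auto

lemma divide_hull_subset: "s \<in> divide t \<Longrightarrow> convex hull s \<subseteq> convex hull t"
  by (rule hull_minimal) (use midpoint_in_hull in \<open>auto elim!: divide_vertex\<close>)

lemma hull_triple_coords:
  fixes p q r :: "real^2"
  assumes "0 \<le> a" "0 \<le> b" "0 \<le> c" "a + b + c = 1" "x = a *\<^sub>R p + b *\<^sub>R q + c *\<^sub>R r"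
  shows "x \<in> convex hull {p, q, r}"
  unfolding convex_hull_3 using assms by blast

text \<open>A point with a barycentric coordinate at least 1/2 lies in the corner child of that
  vertex; if all coordinates are at most 1/2 it lies in the central child.\<close>

lemma divide_hull_cover:
  assumes "triangle t"
  shows "(\<Union>s\<in>divide t. convex hull s) = convex hull t"
proof
  show "(\<Union>s\<in>divide t. convex hull s) \<subseteq> convex hull t" using divide_hull_subset by blast
  show "convex hull t \<subseteq> (\<Union>s\<in>divide t. convex hull s)"
  proof
    fix x assume x: "x \<in> convex hull t"
    have *: "x \<in> (\<Union>s\<in>divide t. convex hull s)"
      if t: "t = {p, q, r}" and abc: "0 \<le> a" "0 \<le> b" "0 \<le> c" "a + b + c = 1"
        "x = a *\<^sub>R p + b *\<^sub>R q + c *\<^sub>R r" and "a \<ge> 1/2" for p q r a b c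
    proof -
      have "x = (2 * a - 1) *\<^sub>R p + (2 * b) *\<^sub>R midpoint p q + (2 * c) *\<^sub>R midpoint p r"
      proof -
        have "2 * a - 1 + b + c = a" using abc(4) by simp
        then have "x = (2 * a - 1 + b + c) *\<^sub>R p + b *\<^sub>R q + c *\<^sub>R r" by (simp only: abc(5))
        then show ?thesis by (simp add: midpoint_def algebra_simps)
      qed
      then have "x \<in> convex hull (corner t p)" unfolding t corner_triple
        by (rule hull_triple_coords[rotated 4]) (use abc \<open>a \<ge> 1/2\<close> in auto)
      then show ?thesis using t unfolding divide_eq by auto
    qed
    obtain p q r where t: "t = {p, q, r}" and d: "p \<noteq> q" "p \<noteq> r" "q \<noteq> r" using assms by (rule triangle_cases)
    obtain a b c where abc: "0 \<le> a" "0 \<le> b" "0 \<le> c" "a + b + c = 1"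
        "x = a *\<^sub>R p + b *\<^sub>R q + c *\<^sub>R r" using x unfolding t convex_hull_3 by blast
    consider "a \<ge> 1/2" | "b \<ge> 1/2" | "c \<ge> 1/2" | "a \<le> 1/2" "b \<le> 1/2" "c \<le> 1/2" by linarith
    then show "x \<in> (\<Union>s\<in>divide t. convex hull s)"
    proof cases
      case 1
      show ?thesis by (rule *[of p q r a b c]) (use 1 abc t in auto)
    next
      case 2
      show ?thesis by (rule *[of q p r b a c]) (use 2 abc t in \<open>auto simp: add_ac insert_commute\<close>)
    next
      case 3
      show ?thesis by (rule *[of r q p c b a]) (use 3 abc t in \<open>auto simp: add_ac insert_commute\<close>)
    next
      case 4
      \<comment> \<open>Twice these numbers are the coordinates in the central child: the weight of
        an edge midpoint is 1 minus twice the coordinate of the opposite vertex.\<close>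
      define a' b' c' where "a' = (1 - 2 * a) / 2" "b' = (1 - 2 * b) / 2" "c' = (1 - 2 * c) / 2"
      then have e: "c' + b' = a" "c' + a' = b" "b' + a' = c" "0 \<le> a'" "0 \<le> b'" "0 \<le> c'" "2 * c' + 2 * b' + 2 * a' = 1"
        using abc(4) 4 by (simp_all add: field_simps)
      have "x = (c' + b') *\<^sub>R p + (c' + a') *\<^sub>R q + (b' + a') *\<^sub>R r" by (simp only: abc(5) e)
      then have "x = (2 * c') *\<^sub>R midpoint p q + (2 * b') *\<^sub>R midpoint p r + (2 * a') *\<^sub>R midpoint q r"
        by (simp add: midpoint_def algebra_simps)
      then have "x \<in> convex hull (centre t)" unfolding t centre_triple[OF d]
        by (rule hull_triple_coords[rotated 4]) (use e in auto)
      then show ?thesis unfolding divide_eq by auto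
    qed
  qed
qed

lemma refine_hull_cover:
  assumes "\<And>t. t \<in> T \<Longrightarrow> triangle t"
  shows "(\<Union>s\<in>refine T. convex hull s) = (\<Union>t\<in>T. convex hull t)"
proof -
  have "(\<Union>s\<in>refine T. convex hull s) = (\<Union>t\<in>T. \<Union>s\<in>divide t. convex hull s)"
    unfolding refine_def by simp
  then show ?thesis using divide_hull_cover assms by simp
qed

section \<open>Conformity of the refined mesh\<close>

lemma aff_divide: "aff t f \<Longrightarrow> s \<in> divide t \<Longrightarrow> aff s f"
  by (rule aff_mono[OF _ divide_hull_subset])

text \<open>The coarse hat function \<open>f\<close> is 1 at \<open>z\<close> and at most 1/2 at
  every other fine vertex. On each child \<open>2 * f x - 1\<close> keeps one sign, so cutting it
  off at zero leaves it affine there.\<close>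

lemma hat_on_refine_vertex:
  assumes T: "conforming T" and z: "z \<in> \<Union>T"
  shows "\<exists>f. hat_on (refine T) z f"
proof -
  obtain f where f: "hat_on T z f" using hat_on_exists[OF T] .
  note fv = hat_on_vertex[OF f]
  have "aff s (\<lambda>x. max 0 (2 * f x - 1))" if t: "t \<in> T" and s: "s \<in> divide t" for s t
  proof -
    have at: "aff t f" by (rule hat_on_aff[OF f t])
    have as: "aff s (\<lambda>x. 2 * f x - 1)"
      by (intro aff_diff aff_cmult aff_const aff_divide[OF at s])
    have "(\<forall>x\<in>s. 0 \<le> 2 * f x - 1) \<or> (\<forall>x\<in>s. 0 \<le> - 1 * (2 * f x - 1))"
      using conforming_triangle[OF T t] s
    proof (cases rule: divide_cases)
      case (corner p q r)
      with t show ?thesis by (auto simp: aff_midpoint[OF at] fv[of _ t])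
    next
      case (centre p q r)
      with t show ?thesis by (auto simp: aff_midpoint[OF at] fv[of _ t])
    qed
    then show ?thesis
    proof
      assume "\<forall>x\<in>s. 0 \<le> 2 * f x - 1"
      then have "0 \<le> 2 * f x - 1" if "x \<in> convex hull s" for x using aff_nonneg[OF as _ that] by blast
      then show ?thesis by (intro aff_cong[OF as]) auto
    next
      assume "\<forall>x\<in>s. 0 \<le> - 1 * (2 * f x - 1)"
      then have "0 \<le> - 1 * (2 * f x - 1)" if "x \<in> convex hull s" for x
        using aff_nonneg[OF aff_cmult[OF as] _ that] by blast
      then show ?thesis by (intro aff_cong[OF aff_const[of _ 0]]) fastforce
    qed
  qed
  moreover have "max 0 (2 * f y - 1) = (if y = z then 1 else 0)" if t: "t \<in> T" "s \<in> divide t" "y \<in> s" for y s t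
  proof -
    obtain a b where ab: "a \<in> t" "b \<in> t" "y = midpoint a b" using t divide_vertex by metis
    obtain t' where t': "t' \<in> T" "z \<in> t'" using z by auto
    have "y = z \<longleftrightarrow> a = z \<and> b = z"
      using conforming_midpoint_inj[OF T t(1) t'(1), of a b z z] ab t' by auto
    then show ?thesis using ab t by (auto simp: aff_midpoint[OF hat_on_aff[OF f t(1)]] fv[of _ t])
  qed
  ultimately have "hat_on (refine T) z (\<lambda>x. max 0 (2 * f x - 1))"
    unfolding hat_on_def refine_def aff_def by blast
  then show ?thesis by blast
qed

text \<open>With the hat functions \<open>f\<close>, \<open>g\<close> of the end points, the minimum
  is \<open>2 * g\<close> on a corner child at \<open>u\<close>, \<open>2 * f\<close> on a corner
  child at \<open>v\<close>, and \<open>2 * f + 2 * g - 1\<close> on the central child of a triangle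
  that has this edge. On all other children the last expression is at most zero, and the cut-off
  gives zero.\<close>

lemma hat_on_refine_midpoint:
  assumes T: "conforming T" and uv: "t0 \<in> T" "u \<in> t0" "v \<in> t0" "u \<noteq> v"
  shows "\<exists>f. hat_on (refine T) (midpoint u v) f"
proof -
  obtain f where f: "hat_on T u f" using hat_on_exists[OF T] .
  obtain g where g: "hat_on T v g" using hat_on_exists[OF T] .
  note fv = hat_on_vertex[OF f] note gv = hat_on_vertex[OF g]
  define h where "h x = max 0 (min (min (2 * f x) (2 * g x)) (2 * f x + 2 * g x - 1))" for x
  have "aff s h" if t: "t \<in> T" and s: "s \<in> divide t" for s t
  proof -
    have at: "aff t f" "aff t g" using hat_on_aff f g t by auto
    have as: "aff s f" "aff s g" by (intro aff_divide[OF _ s] at)+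
    have a3: "aff s (\<lambda>x. 2 * f x + 2 * g x - 1)"
      by (intro aff_diff aff_add aff_cmult aff_const as)
    note am = aff_midpoint[OF at(1)] aff_midpoint[OF at(2)]
    have 0: "aff s h" if "\<And>x. x \<in> s \<Longrightarrow> 2 * f x + 2 * g x - 1 \<le> 0"
    proof -
      have "h x = 0" if "x \<in> convex hull s" for x
      proof -
        have "2 * f x + 2 * g x - 1 \<le> 0" by (rule aff_le[OF a3 aff_const _ that]) fact
        then show ?thesis unfolding h_def by linarith
      qed
      then show ?thesis by (intro aff_cong[OF aff_const[of _ 0]])
    qed
    have nn: "0 \<le> f x" "0 \<le> g x" if "x \<in> convex hull t" for x
      by (rule aff_nonneg[OF _ _ that]; use at fv[OF _ t] gv[OF _ t] in auto)+
    have nns: "0 \<le> f x" "0 \<le> g x" if "x \<in> convex hull s" for x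
      using nn that divide_hull_subset[OF s] by auto
    show ?thesis
      using conforming_triangle[OF T t] s
    proof (cases rule: divide_cases)
      case (corner p q r)
      note vals = corner(1-5) t uv(4)
      consider "p = u" | "p = v" | "p \<noteq> u" "p \<noteq> v" by blast
      then show ?thesis
      proof cases
        case 1
        have *: "1/2 \<le> f x" if "x \<in> convex hull s" for x
          by (rule aff_le[OF aff_const[of s "1/2"] as(1) _ that]) (use vals 1 in \<open>auto simp: am fv[of _ t] gv[of _ t]\<close>)
        have le: "g x \<le> f x" if "x \<in> convex hull s" for x
          by (rule aff_le[OF as(2) as(1) _ that]) (use vals 1 in \<open>auto simp: am fv[of _ t] gv[of _ t]\<close>)
        have "h x = 2 * g x" if "x \<in> convex hull s" for x
          using le[OF that] *[OF that] nns[OF that] unfolding h_def by linarith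
        then show ?thesis by (intro aff_cong[OF aff_cmult[OF as(2), of 2]])
      next
        case 2
        have *: "1/2 \<le> g x" if "x \<in> convex hull s" for x
          by (rule aff_le[OF aff_const[of s "1/2"] as(2) _ that]) (use vals 2 in \<open>auto simp: am fv[of _ t] gv[of _ t]\<close>)
        have le: "f x \<le> g x" if "x \<in> convex hull s" for x
          by (rule aff_le[OF as(1) as(2) _ that]) (use vals 2 in \<open>auto simp: am fv[of _ t] gv[of _ t]\<close>)
        have "h x = 2 * f x" if "x \<in> convex hull s" for x
          using le[OF that] *[OF that] nns[OF that] unfolding h_def by linarith
        then show ?thesis by (intro aff_cong[OF aff_cmult[OF as(1), of 2]])
      next
        case 3
        show ?thesis by (rule 0) (use vals 3 in \<open>auto simp: am fv[of _ t] gv[of _ t]\<close>)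
      qed
    next
      case (centre p q r)
      note vals = centre(1-5) t uv(4)
      show ?thesis
      proof (cases "u \<in> t \<and> v \<in> t")
        case True
        have 1: "0 \<le> 2 * f x + 2 * g x - 1" if "x \<in> convex hull s" for x
          by (rule aff_nonneg[OF a3 _ that]) (use vals True in \<open>auto simp: am fv[of _ t] gv[of _ t]\<close>)
        have 2: "2 * f x \<le> 1" if "x \<in> convex hull s" for x
          by (rule aff_le[OF aff_cmult[OF as(1)] aff_const _ that])
            (use vals True in \<open>auto simp: am fv[of _ t] gv[of _ t]\<close>)
        have 3: "2 * g x \<le> 1" if "x \<in> convex hull s" for x
          by (rule aff_le[OF aff_cmult[OF as(2)] aff_const _ that])
            (use vals True in \<open>auto simp: am fv[of _ t] gv[of _ t]\<close>)
                have "h x = 2 * f x + 2 * g x - 1" if "x \<in> convex hull s" for x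
          using 1[OF that] 2[OF that] 3[OF that] unfolding h_def by linarith
        then show ?thesis by (intro aff_cong[OF a3])
      next
        case False
        show ?thesis by (rule 0) (use vals False in \<open>auto simp: am fv[of _ t] gv[of _ t]\<close>)
      qed
    qed
  qed
  moreover have "h y = (if y = midpoint u v then 1 else 0)" if t: "t \<in> T" "s \<in> divide t" "y \<in> s" for y s t
  proof -
    obtain a b where ab: "a \<in> t" "b \<in> t" "y = midpoint a b" using t divide_vertex by metis
    have "y = midpoint u v \<longleftrightarrow> {a, b} = {u, v}"
      using conforming_midpoint_inj[OF T t(1) uv(1), of a b u v] ab uv midpoint_sym
      by (auto simp: doubleton_eq_iff)
    then show ?thesis using ab t uv(4) unfolding h_def
      by (auto simp: aff_midpoint[OF hat_on_aff[OF f t(1)]] aff_midpoint[OF hat_on_aff[OF g t(1)]]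
          fv[of _ t] gv[of _ t] doubleton_eq_iff)
  qed
  ultimately have "hat_on (refine T) (midpoint u v) h"
    unfolding hat_on_def refine_def aff_def by blast
  then show ?thesis by blast
qed

lemma finite_divide: "finite t \<Longrightarrow> finite (divide t)"
  unfolding divide_eq by simp

lemma conforming_refine:
  assumes T: "conforming T"
  shows "conforming (refine T)"
proof (rule conformingI_hat)
  show "finite (refine T)" unfolding refine_def
    using conforming_finite[OF T] conforming_triangle[OF T] triangle_finite finite_divide by blast
  show "triangle s" if "s \<in> refine T" for s
    using that conforming_triangle[OF T] triangle_divide unfolding refine_def by blast
  fix z assume "z \<in> \<Union>(refine T)"
  then obtain t s where t: "t \<in> T" "s \<in> divide t" "z \<in> s" unfolding refine_def by blast
  then obtain a b where ab: "a \<in> t" "b \<in> t" "z = midpoint a b" using divide_vertex by metis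
  show "\<exists>f. hat_on (refine T) z f"
  proof (cases "a = b")
    case True
    then show ?thesis using hat_on_refine_vertex[OF T, of z] ab t by auto
  next
    case False
    then show ?thesis using hat_on_refine_midpoint[OF T t(1) ab(1,2)] ab by simp
  qed
qed

section \<open>Connectivity through edges\<close>

lemma triangle_interior_coords:
  assumes t: "triangle {p, q, r}" and d: "p \<noteq> q" "p \<noteq> r" "q \<noteq> r"
    and abc: "0 < a" "0 < b" "0 < c" "a + b + c = 1"
  shows "a *\<^sub>R p + b *\<^sub>R q + c *\<^sub>R r \<in> interior (convex hull {p, q, r})"
proof -
  let ?u = "\<lambda>x. if x = p then a else if x = q then b else c"
  have "(\<forall>x\<in>{p, q, r}. 0 < ?u x) \<and> sum ?u {p, q, r} = 1 \<and>
      (\<Sum>x\<in>{p, q, r}. ?u x *\<^sub>R x) = a *\<^sub>R p + b *\<^sub>R q + c *\<^sub>R r"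
    using abc d by (auto simp: add_ac)
  then show ?thesis
    using t unfolding triangle_def
    by (subst interior_convex_hull_explicit_minimal) (auto intro!: exI[of _ ?u])
qed

text \<open>Off the interior some barycentric coordinate vanishes; the two others are positive
  because the point is no vertex.\<close>

lemma triangle_boundary_point:
  assumes t: "triangle t" and z: "z \<in> convex hull t" "z \<notin> interior (convex hull t)" "z \<notin> t"
  shows "\<exists>p q. p \<in> t \<and> q \<in> t \<and> p \<noteq> q \<and> z \<in> open_segment p q"
proof -
  obtain p q r where pqr: "t = {p, q, r}" "p \<noteq> q" "p \<noteq> r" "q \<noteq> r" using t by (rule triangle_cases)
  obtain a b c where abc: "0 \<le> a" "0 \<le> b" "0 \<le> c" "a + b + c = 1"
      "z = a *\<^sub>R p + b *\<^sub>R q + c *\<^sub>R r" using z(1) unfolding pqr convex_hull_3 by blast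
  have *: ?thesis
    if "{x, y} \<subseteq> t" "x \<noteq> y" "0 \<le> u" "0 \<le> v" "u + v = 1" "z = u *\<^sub>R x + v *\<^sub>R y" for x y u v
  proof -
    have "u \<noteq> 0" "v \<noteq> 0" using that z(3) by auto
    then have "0 < v" "v < 1" "u = 1 - v" using that(3-5) by auto
    then have "z \<in> open_segment x y" using that(2,6) unfolding in_segment by blast
    then show ?thesis using that(1,2) by blast
  qed
  consider "a = 0" | "b = 0" | "c = 0" | "0 < a" "0 < b" "0 < c" using abc by linarith
  then show ?thesis
  proof cases
    case 1 then show ?thesis by (intro *[of q r b c]) (use abc pqr in auto)
  next
    case 2 then show ?thesis by (intro *[of p r a c]) (use abc pqr in auto)
  next
    case 3 then show ?thesis by (intro *[of p q a b]) (use abc pqr in auto)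
  next
    case 4
    then have "z \<in> interior (convex hull t)"
      using triangle_interior_coords[of p q r a b c] t pqr abc by simp
    with z(2) show ?thesis by simp
  qed
qed

text \<open>Ordered pairs: a shared edge is counted in both directions.\<close>

definition adjacent :: "(real^2) set set \<Rightarrow> ((real^2) set \<times> (real^2) set) set" where
  "adjacent T = {(t, t'). t \<in> T \<and> t' \<in> T \<and> card (t \<inter> t') = 2}"

definition adjacent_at :: "(real^2) set set \<Rightarrow> real^2 \<Rightarrow> ((real^2) set \<times> (real^2) set) set" where
  "adjacent_at T p = {(t, t'). (t, t') \<in> adjacent T \<and> p \<in> t \<and> p \<in> t'}"

text \<open>The facts about the domain and one mesh that are used on every level;
  \<open>triangulated_refine\<close> hands them on to the next level.\<close>

locale triangulated =
  fixes \<Omega> :: "(real^2) set" and T :: "(real^2) set set"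
  assumes conforming: "conforming T"
    and cover: "(\<Union>t\<in>T. convex hull t) = closure \<Omega>"
    and open_domain: "open \<Omega>"
    and regular_domain: "interior (closure \<Omega>) = \<Omega>"
    and bounded_domain: "bounded \<Omega>"
begin

lemma finite_T: "finite T" and triangle_T: "t \<in> T \<Longrightarrow> triangle t"
  and finite_vertices: "finite (\<Union>T)"
  using conforming_finite[OF conforming] conforming_triangle[OF conforming]
    conforming_finite_vertices[OF conforming] by auto

lemma triangulated_refine: "triangulated \<Omega> (refine T)"
  using conforming_refine[OF conforming] refine_hull_cover[of T] triangle_T cover
    open_domain regular_domain bounded_domain
  by unfold_locales auto

lemma hull_subset_closure: "t \<in> T \<Longrightarrow> convex hull t \<subseteq> closure \<Omega>"
  using cover by blast

lemma interior_hull_subset: "t \<in> T \<Longrightarrow> interior (convex hull t) \<subseteq> \<Omega>"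
  using interior_mono[OF hull_subset_closure] regular_domain by auto

lemma closed_hull_Union: "S \<subseteq> T \<Longrightarrow> closed (\<Union>t\<in>S. convex hull t)"
  by (intro closed_UN ballI compact_imp_closed triangle_hull_compact triangle_T)
    (auto intro: finite_subset[OF _ finite_T])

text \<open>The hat function of \<open>p\<close> is positive on the open edge but vanishes on every
  triangle that lacks \<open>p\<close>.\<close>

lemma mem_edge_imp_vertices:
  assumes "t \<in> T" "t' \<in> T" "p \<in> t" "q \<in> t" "z \<in> open_segment p q" "z \<in> convex hull t'"
  shows "p \<in> t'"
proof (rule ccontr)
  assume "p \<notin> t'"
  obtain f where f: "hat_on T p f" using hat_on_exists[OF conforming] .
  then have 0: "f z = 0" using hat_on_eq_0 assms \<open>p \<notin> t'\<close> by blast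
  obtain g c where gc: "\<And>x. x \<in> convex hull t \<Longrightarrow> f x = g \<bullet> x + c"
    using hat_onD[OF f assms(1)] by metis
  obtain u where u: "0 < u" "u < 1" "z = (1 - u) *\<^sub>R p + u *\<^sub>R q" and "p \<noteq> q"
    using assms(5) unfolding in_segment by blast
  have "z \<in> convex hull t" unfolding u(3)
    by (rule convexD[OF convex_convex_hull]) (use u assms hull_inc[of _ t convex] in auto)
  then have "f z = g \<bullet> z + c" by (rule gc)
  also have "\<dots> = (1 - u) * (g \<bullet> p + c) + u * (g \<bullet> q + c)"
    unfolding u(3) by (simp add: inner_add_right algebra_simps)
  also have "\<dots> = (1 - u) * f p + u * f q" using gc assms hull_inc[of _ t convex] by auto
  also have "\<dots> = 1 - u" using hat_on_vertex[OF f _ assms(1)] assms \<open>p \<noteq> q\<close> by simp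
  finally show False using 0 u by simp
qed

text \<open>The finitely many triangles that miss \<open>z\<close> form a closed set, which a small
  ball avoids.\<close>

lemma neighbourhood:
  assumes "z \<in> \<Omega>"
  obtains \<delta> where "\<delta> > 0" "ball z \<delta> \<subseteq> \<Omega>" "\<And>x. x \<in> ball z \<delta> \<Longrightarrow> \<exists>t\<in>T. z \<in> convex hull t \<and> x \<in> convex hull t"
proof -
  let ?F = "\<Union>t\<in>{t \<in> T. z \<notin> convex hull t}. convex hull t"
  have "closed ?F" by (rule closed_hull_Union) auto
  then have "open (\<Omega> - ?F)" using open_domain by (rule open_Diff[rotated])
  moreover have "z \<in> \<Omega> - ?F" using assms by auto
  ultimately obtain \<delta> where \<delta>: "\<delta> > 0" "ball z \<delta> \<subseteq> \<Omega> - ?F" by (rule openE)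
  have "\<exists>t\<in>T. z \<in> convex hull t \<and> x \<in> convex hull t" if "x \<in> ball z \<delta>" for x
  proof -
    have "x \<in> \<Omega>" "x \<notin> ?F" using that \<delta> by auto
    moreover have "x \<in> (\<Union>t\<in>T. convex hull t)" using cover closure_subset \<open>x \<in> \<Omega>\<close> by blast
    ultimately show ?thesis by blast
  qed
  then show ?thesis using that \<delta> by blast
qed

text \<open>An open edge lies in the domain or misses it entirely. All triangles near
  \<open>z\<close> have both \<open>p\<close> and \<open>q\<close> as vertices, so a ball around
  \<open>z\<close>, contracted towards an end point, stays covered by them. The image is a
  neighbourhood of \<open>z'\<close> inside the closure, and the interior of the closure is the
  domain.\<close>

lemma open_edge_subset:
  assumes "t \<in> T" "p \<in> t" "q \<in> t" "z \<in> open_segment p q" "z \<in> \<Omega>"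
  shows "open_segment p q \<subseteq> \<Omega>"
proof
  fix z' assume z': "z' \<in> open_segment p q"
  obtain u where u: "0 < u" "u < 1" "z = (1 - u) *\<^sub>R p + u *\<^sub>R q" and pq: "p \<noteq> q"
    using assms(4) unfolding in_segment by blast
  obtain u' where u': "0 < u'" "u' < 1" "z' = (1 - u') *\<^sub>R p + u' *\<^sub>R q"
    using z' unfolding in_segment by blast
  obtain \<delta> where \<delta>: "\<delta> > 0" "ball z \<delta> \<subseteq> \<Omega>"
    "\<And>x. x \<in> ball z \<delta> \<Longrightarrow> \<exists>t\<in>T. z \<in> convex hull t \<and> x \<in> convex hull t"
    using neighbourhood[OF assms(5)] by metis
  have *: "z' \<in> \<Omega>" if w: "w \<in> {p, q}" and s: "0 \<le> s" "s < 1" "z' = (1 - s) *\<^sub>R z + s *\<^sub>R w" for w s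
  proof -
    have "ball z' ((1 - s) * \<delta>) \<subseteq> closure \<Omega>"
    proof
      fix y assume y: "y \<in> ball z' ((1 - s) * \<delta>)"
      define x where "x = (1 / (1 - s)) *\<^sub>R (y - s *\<^sub>R w)"
      have yx: "y = (1 - s) *\<^sub>R x + s *\<^sub>R w" using s by (simp add: x_def)
      have "dist z' y = (1 - s) * dist z x" unfolding s(3) yx using s
        by (simp add: dist_norm scaleR_diff_right[symmetric])
      then have "x \<in> ball z \<delta>" using y s by simp
      then obtain t' where t': "t' \<in> T" "z \<in> convex hull t'" "x \<in> convex hull t'" using \<delta>(3) by blast
      have "w \<in> t'" using mem_edge_imp_vertices[OF assms(1) t'(1) assms(2,3,4) t'(2)]
          mem_edge_imp_vertices[OF assms(1) t'(1) assms(3,2) _ t'(2)] assms(4) w open_segment_commute by auto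
      then have "y \<in> convex hull t'" unfolding yx
        by (intro convexD[OF convex_convex_hull]) (use s t' hull_inc[of _ t' convex] in auto)
      then show "y \<in> closure \<Omega>" using hull_subset_closure t' by auto
    qed
    moreover have "z' \<in> ball z' ((1 - s) * \<delta>)" using s \<delta> by simp
    ultimately show ?thesis using regular_domain interiorI[of "ball z' ((1 - s) * \<delta>)"] by auto
  qed
  show "z' \<in> \<Omega>"
  proof (cases "u' \<le> u")
    case True
    have "u * (1 - (1 - u' / u)) = u'" using u by simp
    then have "z' = (1 - (1 - u' / u)) *\<^sub>R z + (1 - u' / u) *\<^sub>R p"
      unfolding u u' using u(1,2) by (simp add: algebra_simps flip: add_divide_distrib)
    then show ?thesis by (rule *[rotated 3]) (use True u u' in auto)
  next
    case False
    \<comment> \<open>For \<open>z'\<close> beyond \<open>z\<close> the contraction goes towards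
      \<open>q\<close>; \<open>1 - s\<close> is the ratio of the distances to
      \<open>q\<close>.\<close>
    define s where "s = 1 - (1 - u') / (1 - u)"
    have "(1 - s) * (1 - u) = 1 - u'" using u by (simp add: s_def)
    then have "u' = 1 - (1 - s) * (1 - u)" by simp
    then have "z' = (1 - (1 - (1 - s) * (1 - u))) *\<^sub>R p + (1 - (1 - s) * (1 - u)) *\<^sub>R q"
      using u'(3) by simp
    then have "z' = (1 - s) *\<^sub>R z + s *\<^sub>R q"
      unfolding u(3) by (simp add: algebra_simps)
    moreover have "0 \<le> s" "s < 1" using False u u' by (auto simp: s_def field_simps)
    ultimately show ?thesis by (intro *[of q s]) auto
  qed
qed

lemma midpoint_open_segment: "p \<noteq> q \<Longrightarrow> midpoint p q \<in> open_segment p (q :: real^2)"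
  by (simp add: midpoint_in_open_segment)

text \<open>The midpoint decides for the open edge; the end points follow because the domain is
  open.\<close>

lemma boundary_edge_disjoint:
  assumes "t \<in> T" "p \<in> t" "q \<in> t" "p \<noteq> q" "midpoint p q \<notin> \<Omega>"
  shows "closed_segment p q \<inter> \<Omega> = {}"
proof -
  have "open_segment p q \<inter> \<Omega> = {}"
    using open_edge_subset[OF assms(1,2,3)] midpoint_open_segment[OF assms(4)] assms(5) by blast
  then have "\<Omega> \<inter> closure (open_segment p q) = {}"
    using open_Int_closure_eq_empty[OF open_domain, of "open_segment p q"] by blast
  then show ?thesis using assms(4) by auto
qed

lemma card_common_vertices:
  assumes "t \<in> T" "t' \<in> T" "t \<noteq> t'"
  shows "card (t \<inter> t') \<le> 2"
proof (rule ccontr)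
  assume "\<not> ?thesis"
  moreover have "card t = 3" "card t' = 3" "finite t" "finite t'"
    using triangle_T assms triangle_finite unfolding triangle_def by auto
  ultimately have "t \<inter> t' = t" "t \<inter> t' = t'"
    using card_seteq[of t "t \<inter> t'"] card_seteq[of t' "t \<inter> t'"] by auto
  with assms(3) show False by auto
qed

lemma touching_imp_adjacent:
  assumes "t \<in> T" "t' \<in> T" "z \<in> convex hull t" "z \<in> convex hull t'" "z \<notin> \<Union>T" "t \<noteq> t'"
  shows "card (t \<inter> t') = 2"
proof -
  have z: "z \<in> convex hull (t \<inter> t')" using conforming_Int[OF conforming] assms by blast
  have "card (t \<inter> t') \<noteq> 0" using z triangle_finite[OF triangle_T[OF assms(1)]] by auto
  moreover have "card (t \<inter> t') \<noteq> 1"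
  proof
    assume "card (t \<inter> t') = 1"
    then obtain p where "t \<inter> t' = {p}" by (rule card_1_singletonE)
    with z assms(1,5) show False by auto
  qed
  ultimately show ?thesis using card_common_vertices[OF assms(1,2,6)] by linarith
qed

text \<open>The union of the triangles that can be reached is closed, and it is open away from the
  vertices as long as no boundary edge is met.\<close>

lemma chain_cover:
  assumes U: "open U" "connected U"
    and t0: "t0 \<in> T" "convex hull t0 \<inter> (U - \<Union>T) \<noteq> {}"
    and R: "R = {(t, t'). t \<in> T \<and> t' \<in> T \<and> convex hull t \<inter> convex hull t' \<inter> (U - \<Union>T) \<noteq> {}}"
    and nb: "\<And>t p q. (t0, t) \<in> R\<^sup>* \<Longrightarrow> t \<in> T \<Longrightarrow> p \<in> t \<Longrightarrow> q \<in> t \<Longrightarrow> p \<noteq> q \<Longrightarrow> midpoint p q \<notin> \<Omega> \<Longrightarrow>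
      open_segment p q \<inter> U = {}"
  shows "U - \<Union>T \<subseteq> (\<Union>t\<in>{t \<in> T. (t0, t) \<in> R\<^sup>*}. convex hull t)"
proof -
  define A where "A = (\<Union>t\<in>{t \<in> T. (t0, t) \<in> R\<^sup>*}. convex hull t)"
  let ?W = "U - \<Union>T"
  \<comment> \<open>In the plane a connected open set stays connected without finitely many points.
    The vertices are removed because triangles that meet only in a vertex are not
    neighbours.\<close>
  have conn: "connected ?W" by (rule connected_open_delete_finite[OF U _ finite_vertices]) simp
  have cl: "closed A" unfolding A_def by (rule closed_hull_Union) auto
  have "\<exists>\<delta>>0. ball z \<delta> \<subseteq> A" if z: "z \<in> ?W \<inter> A" for z
  proof -
    obtain t where t: "t \<in> T" "(t0, t) \<in> R\<^sup>*" "z \<in> convex hull t" using z unfolding A_def by blast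
    \<comment> \<open>Otherwise \<open>z\<close> would lie on a boundary edge of a reached triangle,
      and \<open>nb\<close> keeps such edges out of \<open>U\<close>.\<close>
    have "z \<in> \<Omega>"
    proof (rule ccontr)
      assume n: "z \<notin> \<Omega>"
      then have "z \<notin> interior (convex hull t)" using interior_hull_subset t by blast
      moreover have "z \<notin> t" using z t by blast
      ultimately obtain p q where pq: "p \<in> t" "q \<in> t" "p \<noteq> q" "z \<in> open_segment p q"
        using triangle_boundary_point triangle_T t by metis
      then have "midpoint p q \<notin> \<Omega>"
        using open_edge_subset[OF t(1) pq(1,2) midpoint_open_segment[OF pq(3)]] n by blast
      then show False using nb[OF t(2,1) pq(1-3)] pq z by blast
    qed
    then obtain \<delta> where \<delta>: "\<delta> > 0"
      "\<And>x. x \<in> ball z \<delta> \<Longrightarrow> \<exists>t\<in>T. z \<in> convex hull t \<and> x \<in> convex hull t"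
      using neighbourhood by metis
    have "x \<in> A" if "x \<in> ball z \<delta>" for x
    proof -
      obtain t' where t': "t' \<in> T" "z \<in> convex hull t'" "x \<in> convex hull t'" using \<delta> \<open>x \<in> ball z \<delta>\<close> by blast
      then have "(t, t') \<in> R" using t z unfolding R by blast
      then have "(t0, t') \<in> R\<^sup>*" using t(2) by (rule rtrancl_into_rtrancl[rotated])
      then show ?thesis using t' unfolding A_def by blast
    qed
    then show ?thesis using \<delta>(1) by blast
  qed
  then have "?W \<inter> A = ?W \<inter> interior A" using interior_subset by (auto simp: mem_interior)
  then have "openin (top_of_set ?W) (?W \<inter> A)" by (metis open_interior openin_open_Int)
  moreover have "closedin (top_of_set ?W) (?W \<inter> A)" using cl by (rule closedin_closed_Int)
  moreover have "?W \<inter> A \<noteq> {}" using t0 unfolding A_def by blast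
  ultimately have "?W \<inter> A = ?W" using conn unfolding connected_clopen by blast
  then show ?thesis unfolding A_def by blast
qed

text \<open>The hat function of \<open>p\<close> is 1 at \<open>p\<close> and vanishes on the hull
  of the other vertices. For a triangle without the vertex \<open>p\<close> this says that
  \<open>p\<close> lies outside of it.\<close>

lemma not_in_opposite_edge:
  assumes "t \<in> T" "p \<in> \<Union>T"
  shows "p \<notin> convex hull (t - {p})"
proof
  assume p: "p \<in> convex hull (t - {p})"
  obtain f where f: "hat_on T p f" using hat_on_exists[OF conforming] .
  have "aff (t - {p}) f" using hat_on_aff[OF f assms(1)] by (rule aff_mono) (simp add: hull_mono)
  then have "f p = 0"
    using aff_eq[OF _ aff_const[of _ 0] _ p] hat_on_vertex[OF f _ assms(1)] by auto
  then show False using hat_on_vertex[OF f] assms by auto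
qed

text \<open>If \<open>p\<close> is not in \<open>t\<close>, then \<open>t - {p}\<close> is all of
  \<open>t\<close>. So the ball meets only triangles at \<open>p\<close>, and none of their opposite
  edges: inside it the mesh is a star.\<close>

lemma star_neighbourhood:
  assumes "p \<in> \<Union>T"
  obtains \<epsilon> where "\<epsilon> > 0" "\<And>t. t \<in> T \<Longrightarrow> ball p \<epsilon> \<inter> convex hull (t - {p}) = {}"
proof -
  let ?K = "\<Union>t\<in>T. convex hull (t - {p})"
  have "closed ?K" using finite_T triangle_T triangle_finite
    by (intro closed_UN) (auto intro!: compact_imp_closed finite_imp_compact_convex_hull)
  then have "open (- ?K)" by (rule open_Compl)
  moreover have "p \<in> - ?K" using not_in_opposite_edge assms by blast
  ultimately obtain \<epsilon> where "\<epsilon> > 0" "ball p \<epsilon> \<subseteq> - ?K" by (rule openE)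
  then show ?thesis using that by blast
qed

text \<open>A walk around \<open>p\<close> in a small ball: if no boundary edge at \<open>p\<close>
  is met, the reached triangles cover the punctured ball. Then \<open>p\<close> is an interior
  point, and every triangle at \<open>p\<close> has been reached.\<close>

lemma star_chain:
  assumes p: "t0 \<in> T" "p \<in> t0"
    and nb: "\<And>t q. (t0, t) \<in> (adjacent_at T p)\<^sup>* \<Longrightarrow> t \<in> T \<Longrightarrow> p \<in> t \<Longrightarrow> q \<in> t \<Longrightarrow> p \<noteq> q \<Longrightarrow> midpoint p q \<in> \<Omega>"
  obtains \<epsilon> where "\<epsilon> > 0" "ball p \<epsilon> \<subseteq> \<Omega>"
    "\<And>t. t \<in> T \<Longrightarrow> p \<in> t \<Longrightarrow> (t0, t) \<in> (adjacent_at T p)\<^sup>*"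
proof -
  obtain \<epsilon> where \<epsilon>: "\<epsilon> > 0" "\<And>t. t \<in> T \<Longrightarrow> ball p \<epsilon> \<inter> convex hull (t - {p}) = {}"
    using star_neighbourhood p by blast
  define U where "U = ball p \<epsilon>"
  have UV: "U \<inter> \<Union>T = {p}"
  proof -
    have "q = p" if "q \<in> t" "t \<in> T" "q \<in> U" for q t
    proof (rule ccontr)
      assume "q \<noteq> p"
      then have "q \<in> convex hull (t - {p})" using that by (intro hull_inc) auto
      then show False using \<epsilon>(2) that unfolding U_def by blast
    qed
    then show ?thesis using p \<epsilon>(1) unfolding U_def by auto
  qed
  have star: "p \<in> t" if "t \<in> T" "convex hull t \<inter> U \<noteq> {}" for t
    using that \<epsilon>(2)[of t] unfolding U_def by (cases "p \<in> t") auto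
  have meet: "convex hull t \<inter> (U - \<Union>T) \<noteq> {}" if t: "t \<in> T" "p \<in> t" for t
  proof -
    obtain q r where q: "t = {p, q, r}" "p \<noteq> q" using triangle_T[OF t(1)] t(2) by (rule triangle_cases_at)
    have "p \<in> U \<inter> closure (open_segment p q)" using q \<epsilon>(1) by (simp add: U_def)
    moreover have "open U" by (simp add: U_def)
    ultimately have "open_segment p q \<inter> U \<noteq> {}"
      using open_Int_closure_eq_empty[of U "open_segment p q"] by blast
    then obtain x where x: "x \<in> open_segment p q" "x \<in> U" by blast
    have "x \<in> convex hull t"
      using x(1) q(1) closed_segment_subset[of p "convex hull t" q] hull_inc[of _ t convex]
      unfolding open_segment_def by auto
    moreover have "x \<noteq> p" using x(1) unfolding open_segment_def by auto
    ultimately show ?thesis using x UV by blast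
  qed
  define R where "R = {(t, t'). t \<in> T \<and> t' \<in> T \<and> convex hull t \<inter> convex hull t' \<inter> (U - \<Union>T) \<noteq> {}}"
  have R: "t = t' \<or> (t, t') \<in> adjacent_at T p" if "(t, t') \<in> R" for t t'
    using that touching_imp_adjacent star unfolding R_def adjacent_at_def adjacent_def by blast
  have Rs: "(t0, t) \<in> (adjacent_at T p)\<^sup>*" if "(t0, t) \<in> R\<^sup>*" for t
    using that by induction (use R in \<open>auto intro: rtrancl_into_rtrancl\<close>)
  have cov: "U - \<Union>T \<subseteq> (\<Union>t\<in>{t \<in> T. (t0, t) \<in> R\<^sup>*}. convex hull t)"
  proof (rule chain_cover[OF _ _ p(1) meet[OF p] R_def])
    fix t a b assume t: "(t0, t) \<in> R\<^sup>*" "t \<in> T" "a \<in> t" "b \<in> t" "a \<noteq> b" "midpoint a b \<notin> \<Omega>"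
    show "open_segment a b \<inter> U = {}"
    proof (cases "p \<in> {a, b}")
      case True
      have "p \<noteq> q \<Longrightarrow> q \<in> t \<Longrightarrow> midpoint p q \<in> \<Omega>" for q
        using nb[OF Rs[OF t(1)] t(2)] True t by blast
      then show ?thesis using True t(3-6) midpoint_sym by (metis insertE singletonD)
    next
      case False
      then have "open_segment a b \<subseteq> convex hull (t - {p})"
        using t closed_segment_subset[of a "convex hull (t - {p})" b] hull_inc[of _ "t - {p}" convex]
        unfolding open_segment_def by auto
      then show ?thesis using \<epsilon>(2)[OF t(2)] unfolding U_def by blast
    qed
  qed (auto simp: U_def)
  have "U \<subseteq> closure \<Omega>"
  proof
    fix x assume x: "x \<in> U"
    show "x \<in> closure \<Omega>"
    proof (cases "x = p")
      case True then show ?thesis using p hull_subset_closure hull_inc[of _ t0 convex] by blast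
    next
      case False
      then have "x \<in> U - \<Union>T" using x UV by blast
      then show ?thesis using cov hull_subset_closure by blast
    qed
  qed
  then have "U \<subseteq> \<Omega>" using interior_maximal[of U "closure \<Omega>"] regular_domain unfolding U_def by simp
  moreover have "(t0, t) \<in> (adjacent_at T p)\<^sup>*" if t: "t \<in> T" "p \<in> t" for t
  proof -
    obtain z where z: "z \<in> convex hull t" "z \<in> U - \<Union>T" using meet[OF t] by blast
    then obtain t' where t': "t' \<in> T" "(t0, t') \<in> R\<^sup>*" "z \<in> convex hull t'" using cov by blast
    then have "(t', t) \<in> R" using z t unfolding R_def by blast
    then show ?thesis using t'(2) Rs by (meson rtrancl.rtrancl_into_rtrancl)
  qed
  ultimately show ?thesis using that \<epsilon>(1) unfolding U_def by blast
qed

text \<open>A boundary edge misses the domain together with its end points, so an interior vertex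
  has none.\<close>

lemma star_connected:
  assumes "p \<in> \<Omega>" "t \<in> T" "p \<in> t" "t' \<in> T" "p \<in> t'"
  shows "(t, t') \<in> (adjacent_at T p)\<^sup>*"
proof -
  have "midpoint p q \<in> \<Omega>" if "s \<in> T" "p \<in> s" "q \<in> s" "p \<noteq> q" for s q
    using boundary_edge_disjoint[OF that] assms(1) by auto
  then show ?thesis using star_chain[OF assms(2,3)] assms(4,5) by metis
qed

text \<open>The triangles at a boundary vertex may form several fans. The claim concerns the fan of
  \<open>t\<close> only: if it had no boundary edge at \<open>p\<close>, it would surround
  \<open>p\<close>.\<close>

lemma star_boundary:
  assumes "p \<notin> \<Omega>" "t \<in> T" "p \<in> t"
  shows "\<exists>t' q. (t, t') \<in> (adjacent_at T p)\<^sup>* \<and> t' \<in> T \<and> p \<in> t' \<and> q \<in> t' \<and> p \<noteq> q \<and> midpoint p q \<notin> \<Omega>"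
proof (rule ccontr)
  assume n: "\<not> ?thesis"
  have "midpoint p q \<in> \<Omega>" if "(t, s) \<in> (adjacent_at T p)\<^sup>*" "s \<in> T" "p \<in> s" "q \<in> s" "p \<noteq> q" for s q
    using that n by blast
  then obtain \<epsilon> where "\<epsilon> > 0" "ball p \<epsilon> \<subseteq> \<Omega>" using star_chain[OF assms(2,3)] by metis
  then show False using assms(1) centre_in_ball by blast
qed

text \<open>Without a boundary edge the reached triangles would cover the plane up to finitely many
  points, but the domain is bounded.\<close>

lemma global_boundary:
  assumes "t \<in> T"
  shows "\<exists>t' p q. (t, t') \<in> (adjacent T)\<^sup>* \<and> t' \<in> T \<and> p \<in> t' \<and> q \<in> t' \<and> p \<noteq> q \<and> midpoint p q \<notin> \<Omega>"
proof (rule ccontr)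
  assume n: "\<not> ?thesis"
  define R where "R = {(t, t'). t \<in> T \<and> t' \<in> T \<and> convex hull t \<inter> convex hull t' \<inter> (UNIV - \<Union>T) \<noteq> {}}"
  have R: "t = t' \<or> (t, t') \<in> adjacent T" if "(t, t') \<in> R" for t t'
    using that touching_imp_adjacent unfolding R_def adjacent_def by blast
  have Rs: "(t, s) \<in> (adjacent T)\<^sup>*" if "(t, s) \<in> R\<^sup>*" for s
    using that by induction (use R in \<open>auto intro: rtrancl_into_rtrancl\<close>)
  have "convex hull t \<inter> (UNIV - \<Union>T) \<noteq> {}"
  proof
    assume "convex hull t \<inter> (UNIV - \<Union>T) = {}"
    then have "interior (convex hull t) \<subseteq> \<Union>T"
      using interior_subset[of "convex hull t"] by (metis Diff_Compl Diff_eq_empty_iff Compl_eq_Diff_UNIV double_complement subset_trans)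
    then have "finite (interior (convex hull t))" using finite_vertices by (rule finite_subset)
    then show False
      using finite_imp_not_open[of "interior (convex hull t)"]
        triangle_interior_nonempty[OF triangle_T[OF assms]] by blast
  qed
  then have "UNIV - \<Union>T \<subseteq> (\<Union>s\<in>{s \<in> T. (t, s) \<in> R\<^sup>*}. convex hull s)"
  proof (rule chain_cover[OF open_UNIV connected_UNIV assms _ R_def])
    fix s p q assume "(t, s) \<in> R\<^sup>*" "s \<in> T" "p \<in> s" "q \<in> s" "p \<noteq> q" "midpoint p q \<notin> \<Omega>"
    then show "open_segment p q \<inter> UNIV = {}" using n Rs by blast
  qed
  then have "UNIV - \<Union>T \<subseteq> closure \<Omega>" using hull_subset_closure by blast
  then have "UNIV \<subseteq> closure \<Omega> \<union> \<Union>T" by blast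
  moreover have "bounded (closure \<Omega> \<union> \<Union>T)"
    using bounded_domain finite_vertices by (simp add: bounded_closure finite_imp_bounded)
  ultimately show False using bounded_subset not_bounded_UNIV by blast
qed

end

section \<open>Crouzeix-Raviart interpolation\<close>

lemma conforming_singleton: "triangle t \<Longrightarrow> conforming {t}"
  unfolding conforming_def by simp

lemma triangle_midpoint_inj:
  assumes "triangle t" "{p, q} \<subseteq> t" "{p', q'} \<subseteq> t" "midpoint p q = midpoint p' q'"
  shows "{p, q} = {p', q'}"
  using conforming_midpoint_inj[OF conforming_singleton[OF assms(1)] _ _ assms(2,3,4)] by simp

lemma triangle_midpoint_neq:
  assumes t: "triangle {p, q, r}" and d: "p \<noteq> q" "p \<noteq> r" "q \<noteq> r"
  shows "midpoint p q \<noteq> midpoint p r" "midpoint p q \<noteq> midpoint q r" "midpoint p r \<noteq> midpoint q r"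
    "p \<noteq> midpoint q r" "q \<noteq> midpoint p r" "r \<noteq> midpoint p q"
    "p \<noteq> midpoint p q" "p \<noteq> midpoint p r" "q \<noteq> midpoint p q" "q \<noteq> midpoint q r" "r \<noteq> midpoint p r" "r \<noteq> midpoint q r"
proof -
  have *: "midpoint a b = midpoint c e \<longleftrightarrow> {a, b} = {c, e}" if "{a, b, c, e} \<subseteq> {p, q, r}" for a b c e
    using triangle_midpoint_inj[OF t, of a b c e] that midpoint_sym by (auto simp: doubleton_eq_iff)
  show "midpoint p q \<noteq> midpoint p r" "midpoint p q \<noteq> midpoint q r" "midpoint p r \<noteq> midpoint q r"
    using d by (simp_all add: * doubleton_eq_iff)
  show "p \<noteq> midpoint q r" "q \<noteq> midpoint p r" "r \<noteq> midpoint p q"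
    using *[of p p q r] *[of q q p r] *[of r r p q] d by (simp_all add: doubleton_eq_iff)
  show "p \<noteq> midpoint p q" "p \<noteq> midpoint p r" "q \<noteq> midpoint p q" "q \<noteq> midpoint q r" "r \<noteq> midpoint p r" "r \<noteq> midpoint q r"
    using *[of p p p q] *[of p p p r] *[of q q p q] *[of q q q r] *[of r r p r] *[of r r q r] d
    by (simp_all add: doubleton_eq_iff)
qed

lemma divide_triple:
  assumes "triangle {p, q, r}" "p \<noteq> q" "p \<noteq> r" "q \<noteq> r"
  shows "divide {p, q, r} = {{p, midpoint p q, midpoint p r}, {q, midpoint p q, midpoint q r},
      {r, midpoint p r, midpoint q r}, {midpoint p q, midpoint p r, midpoint q r}}"
proof -
  have "corner {p, q, r} q = {q, midpoint p q, midpoint q r}" "corner {p, q, r} r = {r, midpoint p r, midpoint q r}"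
    by (simp_all add: corner_def midpoint_sym insert_commute)
  then show ?thesis unfolding divide_eq using corner_triple centre_triple[OF assms(2-4)] by auto
qed

lemma sum_divide:
  assumes "triangle {p, q, r}" "p \<noteq> q" "p \<noteq> r" "q \<noteq> r"
  shows "sum f (divide {p, q, r}) = f {p, midpoint p q, midpoint p r} + f {q, midpoint p q, midpoint q r} +
      f {r, midpoint p r, midpoint q r} + (f {midpoint p q, midpoint p r, midpoint q r} :: 'a::comm_monoid_add)"
proof -
  note neq = triangle_midpoint_neq[OF assms] triangle_midpoint_neq[OF assms, symmetric]
  have "distinct [{p, midpoint p q, midpoint p r}, {q, midpoint p q, midpoint q r},
      {r, midpoint p r, midpoint q r}, {midpoint p q, midpoint p r, midpoint q r}]"
  proof -
    have "p \<notin> {q, midpoint p q, midpoint q r}" "p \<notin> {r, midpoint p r, midpoint q r}"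
      "p \<notin> {midpoint p q, midpoint p r, midpoint q r}" "q \<notin> {r, midpoint p r, midpoint q r}"
      "q \<notin> {midpoint p q, midpoint p r, midpoint q r}" "r \<notin> {midpoint p q, midpoint p r, midpoint q r}"
      by (simp_all add: neq assms(2-4))
    then show ?thesis by (metis distinct_length_2_or_more distinct_singleton insertI1)
  qed
  then show ?thesis unfolding divide_triple[OF assms] by (simp add: add.assoc)
qed

lemma card_divide:
  assumes "triangle t"
  shows "card (divide t) = 4"
proof -
  obtain p q r where "t = {p, q, r}" "p \<noteq> q" "p \<noteq> r" "q \<noteq> r" using assms by (rule triangle_cases)
  then show ?thesis using sum_divide[of p q r "\<lambda>_. 1 :: nat"] assms by simp
qed

text \<open>The Crouzeix-Raviart interpolant: the affine function whose values at the edge midpoints,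
  i.e. whose means over the edges, are prescribed by \<open>m\<close>.\<close>

definition is_cr :: "(real^2 \<Rightarrow> real^2 \<Rightarrow> real) \<Rightarrow> (real^2) set \<Rightarrow> (real^2) \<times> real \<Rightarrow> bool" where
  "is_cr m t gc \<longleftrightarrow> (\<forall>p\<in>t. \<forall>q\<in>t. p \<noteq> q \<longrightarrow> fst gc \<bullet> midpoint p q + snd gc = m p q)"

definition cr_grad :: "(real^2 \<Rightarrow> real^2 \<Rightarrow> real) \<Rightarrow> (real^2) set \<Rightarrow> real^2" where
  "cr_grad m t = fst (SOME gc. is_cr m t gc)"

definition cr :: "(real^2 \<Rightarrow> real^2 \<Rightarrow> real) \<Rightarrow> (real^2) set \<Rightarrow> real^2 \<Rightarrow> real" where
  "cr m t x = cr_grad m t \<bullet> x + snd (SOME gc. is_cr m t gc)"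

lemma cr_diff: "cr m t x - cr m t y = cr_grad m t \<bullet> (x - y)"
  by (simp add: cr_def inner_diff_right)

text \<open>The edge midpoints are the vertices of the central child, where affine interpolation
  applies. Symmetry of \<open>m\<close> makes it a function of the unordered edge.\<close>

lemma cr_exists:
  assumes "triangle t" "\<And>p q. m p q = m q p"
  shows "\<exists>gc. is_cr m t gc"
proof -
  obtain p q r where t: "t = {p, q, r}" and d: "p \<noteq> q" "p \<noteq> r" "q \<noteq> r" using assms(1) by (rule triangle_cases)
  note neq = triangle_midpoint_neq[OF assms(1)[unfolded t] d]
  have "triangle {midpoint p q, midpoint p r, midpoint q r}"
    using triangle_divide[OF assms(1)] divide_triple[OF assms(1)[unfolded t] d] t by blast
  then obtain g c where gc: "\<And>x. x \<in> {midpoint p q, midpoint p r, midpoint q r} \<Longrightarrow>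
      g \<bullet> x + c = (if x = midpoint p q then m p q else if x = midpoint p r then m p r else m q r)"
    using triangle_interpolation[of _ "\<lambda>x. if x = midpoint p q then m p q else if x = midpoint p r then m p r else m q r"]
    by metis
  have "g \<bullet> midpoint p q + c = m p q" "g \<bullet> midpoint p r + c = m p r" "g \<bullet> midpoint q r + c = m q r"
    using gc[of "midpoint p q"] gc[of "midpoint p r"] gc[of "midpoint q r"] neq by auto
  then have "is_cr m t (g, c)" unfolding is_cr_def t
    using assms(2) midpoint_sym[of q p] midpoint_sym[of r p] midpoint_sym[of r q] by (auto split: if_splits)
  then show ?thesis by blast
qed

lemma cr_midpoint:
  assumes "triangle t" "\<And>p q. m p q = m q p" "p \<in> t" "q \<in> t" "p \<noteq> q"
  shows "cr m t (midpoint p q) = m p q"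
  using someI_ex[OF cr_exists[of t m, OF assms(1,2)]] assms(3-5) unfolding is_cr_def cr_def cr_grad_def by blast

text \<open>At a vertex an affine function equals the sum of its values at the midpoints of the two
  edges there minus its value at the third midpoint. So the interpolant recovers the vertex values
  from their averages over the edges.\<close>

lemma cr_linear_eq:
  assumes "triangle t" "\<And>p q. p \<in> t \<Longrightarrow> q \<in> t \<Longrightarrow> p \<noteq> q \<Longrightarrow> m p q = (u p + u q) / 2"
    and "\<And>p q. m p q = m q p" "p \<in> t"
  shows "cr m t p = u p"
proof -
  obtain q r where t: "t = {p, q, r}" and d: "p \<noteq> q" "p \<noteq> r" "q \<noteq> r"
    using assms(1,4) by (rule triangle_cases_at)
  have "cr m t p = cr m t (midpoint p q) + cr m t (midpoint p r) - cr m t (midpoint q r)"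
    unfolding cr_def midpoint_def by (simp add: inner_add_right algebra_simps)
  also have "\<dots> = m p q + m p r - m q r"
    using cr_midpoint[of t m, OF assms(1,3)] t d by simp
  also have "\<dots> = (u p + u q) / 2 + (u p + u r) / 2 - (u q + u r) / 2"
    by (intro arg_cong2[where f = "(-)"] arg_cong2[where f = "(+)"] assms(2)) (use t d in auto)
  finally show ?thesis by (simp add: field_simps)
qed

text \<open>On each child the derivative along \<open>q - r\<close> is 4 times a difference of two
  edge means. In the sum the means on inner edges cancel, since \<open>m'\<close> has one value per
  edge, and the half edges combine to the coarse means on the two edges at \<open>p\<close>.\<close>

lemma cr_grad_sum_edge:
  assumes t: "triangle {p, q, r}" and d: "p \<noteq> q" "p \<noteq> r" "q \<noteq> r"
    and sym: "\<And>p q. m p q = m q p" "\<And>p q. m' p q = m' q p"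
    and mm: "\<And>a b. a \<in> {p, q, r} \<Longrightarrow> b \<in> {p, q, r} \<Longrightarrow> a \<noteq> b \<Longrightarrow>
      m a b = (m' a (midpoint a b) + m' (midpoint a b) b) / 2"
  shows "sum (cr_grad m') (divide {p, q, r}) \<bullet> (q - r) = 4 *\<^sub>R cr_grad m {p, q, r} \<bullet> (q - r)"
proof -
  define a b c where "a = midpoint q r" "b = midpoint p r" "c = midpoint p q"
  note abc = this
  note neq = triangle_midpoint_neq[OF t d, folded abc]
  have T: "triangle {p, c, b}" "triangle {q, c, a}" "triangle {r, b, a}" "triangle {c, b, a}"
    using triangle_divide[OF t] unfolding divide_triple[OF t d] abc by blast+
  have *: "cr_grad n s \<bullet> (q - r) = k * (n x y - n x' y')"
    if "triangle s" "\<And>p q. n p q = n q p" "x \<in> s" "y \<in> s" "x' \<in> s" "y' \<in> s" "x \<noteq> y" "x' \<noteq> y'"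
      "k *\<^sub>R (midpoint x y - midpoint x' y') = q - r" for s x y x' y' k n
  proof -
    have "k * (n x y - n x' y') = k * (cr n s (midpoint x y) - cr n s (midpoint x' y'))"
      using cr_midpoint[of s n] that by simp
    also have "\<dots> = cr_grad n s \<bullet> (k *\<^sub>R (midpoint x y - midpoint x' y'))" by (simp add: cr_diff)
    finally show ?thesis using that by simp
  qed
  \<comment> \<open>On each child a pair of edge midpoints differs by a quarter of
    \<open>q - r\<close>, on the parent by half of it.\<close>
  have v: "4 *\<^sub>R (midpoint p c - midpoint p b) = q - r" "4 *\<^sub>R (midpoint q c - midpoint c a) = q - r"
    "4 *\<^sub>R (midpoint b a - midpoint r b) = q - r" "4 *\<^sub>R (midpoint c a - midpoint b a) = q - r"
    "2 *\<^sub>R (midpoint p q - midpoint p r) = q - r"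
    unfolding abc midpoint_def by (simp_all add: algebra_simps scaleR_2 vec_eq_iff)
  have "cr_grad m' {p, c, b} \<bullet> (q - r) = 4 * (m' p c - m' p b)" using neq by (intro * T sym v) auto
  moreover have "cr_grad m' {q, c, a} \<bullet> (q - r) = 4 * (m' q c - m' c a)" using neq by (intro * T sym v) auto
  moreover have "cr_grad m' {r, b, a} \<bullet> (q - r) = 4 * (m' b a - m' r b)" using neq by (intro * T sym v) auto
  moreover have "cr_grad m' {c, b, a} \<bullet> (q - r) = 4 * (m' c a - m' b a)" using neq by (intro * T sym v) auto
  moreover have "cr_grad m {p, q, r} \<bullet> (q - r) = 2 * (m p q - m p r)" using d by (intro * t sym v) auto
  moreover have "m p q = (m' p c + m' q c) / 2" "m p r = (m' p b + m' r b) / 2"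
    using mm[of p q] mm[of p r] d sym(2)[of c q] sym(2)[of b r] by (auto simp: abc)
  ultimately show ?thesis unfolding sum_divide[OF t d]
    by (simp add: inner_add_left abc algebra_simps) (simp add: field_simps)
qed

text \<open>The children have equal areas, so this is the martingale property of the gradients. Two
  edge directions determine a vector.\<close>

lemma cr_grad_sum:
  assumes t: "triangle t"
    and sym: "\<And>p q. m p q = m q p" "\<And>p q. m' p q = m' q p"
    and mm: "\<And>a b. a \<in> t \<Longrightarrow> b \<in> t \<Longrightarrow> a \<noteq> b \<Longrightarrow> m a b = (m' a (midpoint a b) + m' (midpoint a b) b) / 2"
  shows "sum (cr_grad m') (divide t) = 4 *\<^sub>R cr_grad m t"
proof -
  obtain p q r where pqr: "t = {p, q, r}" and d: "p \<noteq> q" "p \<noteq> r" "q \<noteq> r" using t by (rule triangle_cases)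
  let ?a = "sum (cr_grad m') (divide t)" and ?b = "4 *\<^sub>R cr_grad m t"
  have 1: "?a \<bullet> (r - p) = ?b \<bullet> (r - p)"
    using cr_grad_sum_edge[of q r p m m'] t d sym mm unfolding pqr by (simp add: insert_commute)
  have 2: "?a \<bullet> (q - p) = ?b \<bullet> (q - p)"
    using cr_grad_sum_edge[of r q p m m'] t d sym mm unfolding pqr by (simp add: insert_commute)
  \<comment> \<open>The affine functions with these gradients that vanish at \<open>p\<close> agree
    at all three vertices.\<close>
  show ?thesis
    by (rule triangle_affine_unique(1)[OF t, where c = "- (?a \<bullet> p)" and c' = "- (?b \<bullet> p)"])
      (use 1 2 in \<open>auto simp: pqr inner_diff_right\<close>)
qed

lemma cr_grad_pythagoras:
  assumes t: "triangle t"
    and sym: "\<And>p q. m p q = m q p" "\<And>p q. m' p q = m' q p"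
    and mm: "\<And>a b. a \<in> t \<Longrightarrow> b \<in> t \<Longrightarrow> a \<noteq> b \<Longrightarrow> m a b = (m' a (midpoint a b) + m' (midpoint a b) b) / 2"
  shows "(\<Sum>s\<in>divide t. (norm (cr_grad m' s))\<^sup>2) =
    4 * (norm (cr_grad m t))\<^sup>2 + (\<Sum>s\<in>divide t. (norm (cr_grad m' s - cr_grad m t))\<^sup>2)"
proof -
  let ?g = "cr_grad m t"
  have "(\<Sum>s\<in>divide t. (norm (cr_grad m' s - ?g))\<^sup>2) =
    (\<Sum>s\<in>divide t. (norm (cr_grad m' s))\<^sup>2 - 2 * (cr_grad m' s \<bullet> ?g) + (norm ?g)\<^sup>2)"
    by (simp add: power2_norm_eq_inner algebra_simps inner_commute)
  also have "\<dots> = (\<Sum>s\<in>divide t. (norm (cr_grad m' s))\<^sup>2) - 2 * (sum (cr_grad m') (divide t) \<bullet> ?g) + 4 * (norm ?g)\<^sup>2"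
    by (simp add: sum.distrib sum_subtractf sum_distrib_left inner_sum_left card_divide[OF t])
  finally have "(\<Sum>s\<in>divide t. (norm (cr_grad m' s - ?g))\<^sup>2) = \<dots>" .
  moreover have "sum (cr_grad m') (divide t) \<bullet> ?g = 4 * (norm ?g)\<^sup>2"
    by (subst cr_grad_sum[where m = m]) (use assms in \<open>auto simp: power2_norm_eq_inner\<close>)
  ultimately show ?thesis by simp
qed

text \<open>A discrete Poincare inequality. The difference of the interpolants is affine on each
  child, agrees across inner edges at their midpoints, and has mean zero over each coarse edge. A
  path through three children joins the two halves of an edge, where the means are opposite numbers;
  a corner child is thus controlled, and one more step reaches the central child.\<close>

lemma cr_child_diff:
  assumes t: "triangle t"
    and sym: "\<And>p q. m p q = m q p" "\<And>p q. m' p q = m' q p"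
    and mm: "\<And>a b. a \<in> t \<Longrightarrow> b \<in> t \<Longrightarrow> a \<noteq> b \<Longrightarrow> m a b = (m' a (midpoint a b) + m' (midpoint a b) b) / 2"
    and h: "\<And>x y. x \<in> convex hull t \<Longrightarrow> y \<in> convex hull t \<Longrightarrow> dist x y \<le> h"
    and s: "s \<in> divide t" "x \<in> s"
  shows "\<bar>cr m' s x - cr m t x\<bar> \<le> 4 * h * (\<Sum>s\<in>divide t. norm (cr_grad m' s - cr_grad m t))"
proof -
  let ?S = "\<Sum>s\<in>divide t. norm (cr_grad m' s - cr_grad m t)"
  define \<delta> where "\<delta> s x = cr m' s x - cr m t x" for s x
  have fin: "finite (divide t)" by (intro finite_divide triangle_finite t)
  have S0: "0 \<le> ?S" by (simp add: sum_nonneg)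
  have step: "\<bar>\<delta> s x - \<delta> s y\<bar> \<le> h * ?S"
    if "s \<in> divide t" "x \<in> convex hull s" "y \<in> convex hull s" for s x y
  proof -
    have "\<delta> s x - \<delta> s y = (cr_grad m' s - cr_grad m t) \<bullet> (x - y)"
      unfolding \<delta>_def using cr_diff[of m' s x y] cr_diff[of m t x y] by (simp add: inner_diff_left)
    then have "\<bar>\<delta> s x - \<delta> s y\<bar> \<le> norm (cr_grad m' s - cr_grad m t) * norm (x - y)"
      using Cauchy_Schwarz_ineq2 by metis
    also have "\<dots> \<le> ?S * h"
      using h[of x y] that divide_hull_subset[of s t] member_le_sum[of s "divide t" "\<lambda>s. norm (cr_grad m' s - cr_grad m t)"] fin
      by (intro mult_mono S0) (auto simp: dist_norm)
    finally show ?thesis by (simp add: mult.commute)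
  qed
  have glue: "\<delta> s (midpoint a b) = \<delta> s' (midpoint a b)"
    if "s \<in> divide t" "s' \<in> divide t" "{a, b} \<subseteq> s" "{a, b} \<subseteq> s'" "a \<noteq> b" for s s' a b
    unfolding \<delta>_def using that cr_midpoint[OF triangle_divide[OF t] sym(2)] by simp
  \<comment> \<open>Three steps bound the difference of two opposite numbers, hence each of them by
    3/2; moving on to \<open>y\<close> gives 5/2, rounded up to 3.\<close>
  have corner_bound: "\<bar>\<delta> {p, midpoint p q, midpoint p r} y\<bar> \<le> 3 * (h * ?S)"
    if pqr: "t = {p, q, r}" and d: "p \<noteq> q" "p \<noteq> r" "q \<noteq> r"
      and y: "y \<in> convex hull {p, midpoint p q, midpoint p r}" for p q r y
  proof -
    define a b c where abc: "a = midpoint q r" "b = midpoint p r" "c = midpoint p q"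
    note neq = triangle_midpoint_neq[OF t[unfolded pqr] d, folded abc]
    have dv: "divide t = {{p, c, b}, {q, c, a}, {r, b, a}, {c, b, a}}"
      using divide_triple[OF t[unfolded pqr] d] unfolding pqr abc by simp
    have "\<bar>\<delta> {p, c, b} (midpoint p c) - \<delta> {p, c, b} (midpoint c b)\<bar> \<le> h * ?S"
      by (intro step midpoint_in_hull) (auto simp: dv)
    moreover have "\<delta> {p, c, b} (midpoint c b) = \<delta> {c, b, a} (midpoint c b)"
      by (rule glue) (use neq in \<open>auto simp: dv\<close>)
    moreover have "\<bar>\<delta> {c, b, a} (midpoint c b) - \<delta> {c, b, a} (midpoint c a)\<bar> \<le> h * ?S"
      by (intro step midpoint_in_hull) (auto simp: dv)
    moreover have "\<delta> {c, b, a} (midpoint c a) = \<delta> {q, c, a} (midpoint c a)"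
      by (rule glue) (use neq in \<open>auto simp: dv\<close>)
    moreover have "\<bar>\<delta> {q, c, a} (midpoint c a) - \<delta> {q, c, a} (midpoint c q)\<bar> \<le> h * ?S"
      by (intro step midpoint_in_hull) (auto simp: dv)
    \<comment> \<open>The coarse mean at \<open>c\<close> is the average of the two fine means, and
      the coarse interpolant is affine along the edge.\<close>
    moreover have "\<delta> {p, c, b} (midpoint p c) + \<delta> {q, c, a} (midpoint c q) = 0"
    proof -
      have "cr m' {p, c, b} (midpoint p c) = m' p c" "cr m' {q, c, a} (midpoint c q) = m' c q"
        using neq by (auto intro!: cr_midpoint triangle_divide[OF t] sym simp: dv)
      moreover have "cr m t (midpoint p c) + cr m t (midpoint c q) = 2 * cr m t c"
        unfolding cr_def abc midpoint_def by (simp add: inner_add_right algebra_simps)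
      moreover have "cr m t c = (m' p c + m' c q) / 2"
        using cr_midpoint[OF t sym(1), of p q] mm[of p q] d pqr by (simp add: abc)
      ultimately show ?thesis unfolding \<delta>_def by simp
    qed
    moreover have "\<bar>\<delta> {p, c, b} y - \<delta> {p, c, b} (midpoint p c)\<bar> \<le> h * ?S"
      using y by (intro step midpoint_in_hull) (auto simp: dv abc)
    ultimately show ?thesis unfolding abc by linarith
  qed
  have hS: "0 \<le> h * ?S" using step[OF s(1) hull_inc[OF s(2)] hull_inc[OF s(2)]] by simp
  have "\<bar>\<delta> s x\<bar> \<le> 4 * (h * ?S)"
    using t s(1)
  proof (cases rule: divide_cases)
    case (corner p q r)
    then have "\<bar>\<delta> s x\<bar> \<le> 3 * (h * ?S)" using corner_bound[OF corner(1-4), of x] hull_inc[OF s(2), of convex] by simp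
    then show ?thesis using hS by simp
  next
    case (centre p q r)
    let ?z = "midpoint (midpoint p q) (midpoint p r)" and ?s = "{p, midpoint p q, midpoint p r}"
    have neq: "midpoint p q \<noteq> midpoint p r" using triangle_midpoint_neq t centre by metis
    have s': "?s \<in> divide t" using divide_triple t centre(1-4) by auto
    have "\<bar>\<delta> ?s ?z\<bar> \<le> 3 * (h * ?S)"
      by (rule corner_bound[OF centre(1-4)]) (auto intro: midpoint_in_hull)
    moreover have "\<delta> ?s ?z = \<delta> s ?z"
      by (rule glue) (use neq s s' centre in auto)
    moreover have "\<bar>\<delta> s x - \<delta> s ?z\<bar> \<le> h * ?S"
      by (rule step) (use s centre hull_inc[OF s(2)] in \<open>auto intro!: midpoint_in_hull\<close>)
    ultimately show ?thesis by linarith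
  qed
  then show ?thesis unfolding \<delta>_def by (simp add: mult.assoc)
qed

text \<open>Boundary edges occur with both orders of their end points. Testing only the midpoint is
  enough by \<open>open_edge_subset\<close>.\<close>

definition boundary_edges :: "(real^2) set \<Rightarrow> (real^2) set set \<Rightarrow> ((real^2) set \<times> (real^2) \<times> (real^2)) set" where
  "boundary_edges \<Omega> T = {(t, p, q). t \<in> T \<and> p \<in> t \<and> q \<in> t \<and> p \<noteq> q \<and> midpoint p q \<notin> \<Omega>}"

lemma centre_edge_interior:
  assumes t: "triangle {p, q, r}" and d: "p \<noteq> q" "p \<noteq> r" "q \<noteq> r"
  shows "midpoint (midpoint p q) (midpoint p r) \<in> interior (convex hull {p, q, r})"
proof -
  have "midpoint (midpoint p q) (midpoint p r) = (1/2) *\<^sub>R p + (1/4) *\<^sub>R q + (1/4) *\<^sub>R r"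
    by (simp add: midpoint_def vec_eq_iff field_simps)
  then show ?thesis using triangle_interior_coords[OF t d, of "1/2" "1/4" "1/4"] by simp
qed

section \<open>Parents, edges and valences under refinement\<close>

context triangulated
begin

lemma midpoint_inj:
  assumes "t \<in> T" "t' \<in> T" "{p, q} \<subseteq> t" "{p', q'} \<subseteq> t'" "midpoint p q = midpoint p' q'"
  shows "{p, q} = {p', q'}"
  using conforming_midpoint_inj[OF conforming assms] .

lemma corner_vertex: "x \<in> corner t p \<longleftrightarrow> (\<exists>z\<in>t. x = midpoint p z)"
  unfolding corner_def by auto

lemma centre_vertex: "x \<in> centre t \<longleftrightarrow> (\<exists>p\<in>t. \<exists>q\<in>t. p \<noteq> q \<and> x = midpoint p q)"
  unfolding centre_def by auto

text \<open>A vertex \<open>midpoint p q\<close> of a child reveals \<open>p\<close> and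
  \<open>q\<close>, and the vertices of a single child involve all vertices of its parent.\<close>

lemma parent_unique:
  assumes t: "t \<in> T" "t' \<in> T" and s: "s \<in> divide t" "s \<in> divide t'"
  shows "t = t'"
proof -
  have *: "{p, q} \<subseteq> t'" if pq: "midpoint p q \<in> s" "{p, q} \<subseteq> t" for p q
  proof -
    obtain a b where ab: "a \<in> t'" "b \<in> t'" "midpoint p q = midpoint a b"
      using divide_vertex[OF s(2) pq(1)] by metis
    then have "{p, q} = {a, b}" using midpoint_inj[OF t pq(2), of a b] by simp
    then show ?thesis using ab by auto
  qed
  have "t \<subseteq> t'" using triangle_T[OF t(1)] s(1)
  proof (cases rule: divide_cases)
    case (corner p q r)
    then show ?thesis using *[of p q] *[of p r] by auto
  next
    case (centre p q r)
    then show ?thesis using *[of p q] *[of p r] by auto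
  qed
  moreover have "card t = card t'" "finite t'"
    using triangle_T t triangle_finite unfolding triangle_def by auto
  ultimately show ?thesis by (intro card_subset_eq) auto
qed

lemma sum_refine: "(\<Sum>s\<in>refine T. f s) = (\<Sum>t\<in>T. \<Sum>s\<in>divide t. f s)"
  unfolding refine_def
  by (rule sum.UNION_disjoint) (use finite_T finite_divide triangle_finite triangle_T parent_unique in blast)+

text \<open>The central child has one vertex on each edge of the parent. So a child with two
  distinct vertices on \<open>e\<close> is the corner child at an end point of
  \<open>e\<close>.\<close>

lemma shared_edge_corner:
  assumes t: "t \<in> T" and e: "e \<subseteq> t" "card e \<le> 2" and s: "s \<in> divide t"
    and x: "x = midpoint a b" "{a, b} \<subseteq> e" "x \<in> s" and y: "y = midpoint c d" "{c, d} \<subseteq> e" "y \<in> s" "x \<noteq> y"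
  shows "\<exists>p\<in>e. s = corner t p"
proof -
  have fe: "finite e" using e(1) triangle_finite[OF triangle_T[OF t]] finite_subset by blast
  have "s = centre t \<or> (\<exists>p\<in>t. s = corner t p)" using s unfolding divide_eq by auto
  then show ?thesis
  proof
    assume "s = centre t"
    then obtain p q p' q' where pq: "p \<in> t" "q \<in> t" "p \<noteq> q" "x = midpoint p q"
        "p' \<in> t" "q' \<in> t" "p' \<noteq> q'" "y = midpoint p' q'" using x y centre_vertex by metis
    have "{p, q} = {a, b}" "{p', q'} = {c, d}"
      using midpoint_inj[OF t t, of p q a b] midpoint_inj[OF t t, of p' q' c d] pq x y e by auto
    then have "{p, q} \<subseteq> e" "{p', q'} \<subseteq> e" using x(2) y(2) by simp_all
    moreover have "card {p, q} = 2" "card {p', q'} = 2" using pq(3,7) by simp_all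
    ultimately have "{p, q} = e" "{p', q'} = e" using e(2) fe by (metis card_seteq)+
    then have "midpoint p q = midpoint p' q'" by (metis doubleton_eq_iff midpoint_sym)
    then show ?thesis using pq(4,8) y(4) by metis
  next
    assume "\<exists>p\<in>t. s = corner t p"
    then obtain p z where p: "p \<in> t" "s = corner t p" "z \<in> t" "x = midpoint p z"
      using x corner_vertex by blast
    then have "{p, z} = {a, b}" using midpoint_inj[OF t t, of p z a b] x e by auto
    then have "p \<in> e" using x(2) by blast
    then show ?thesis using p(2) by blast
  qed
qed

text \<open>A fine shared edge lies inside one parent or is half of a coarse shared edge; in the
  latter case its triangles are corner children at the same end of that edge.\<close>

lemma adjacent_refine:
  assumes "(s, s') \<in> adjacent (refine T)"
  shows "(\<exists>t\<in>T. s \<in> divide t \<and> s' \<in> divide t) \<or>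
    (\<exists>t t' p. (t, t') \<in> adjacent T \<and> p \<in> t \<inter> t' \<and> s = corner t p \<and> s' = corner t' p)"
proof -
  obtain t t' where t: "t \<in> T" "t' \<in> T" "s \<in> divide t" "s' \<in> divide t'" and c: "card (s \<inter> s') = 2"
    using assms unfolding adjacent_def refine_def by blast
  show ?thesis
  proof (cases "t = t'")
    case False
    obtain x y where xy: "x \<in> s \<inter> s'" "y \<in> s \<inter> s'" "x \<noteq> y"
      using c by (metis card_2_iff insertI1 insert_commute)
    have mid: "\<exists>a b. x = midpoint a b \<and> {a, b} \<subseteq> t \<inter> t'" if x: "x \<in> s \<inter> s'" for x
    proof -
      obtain a b where ab: "a \<in> t" "b \<in> t" "x = midpoint a b" using divide_vertex[OF t(3)] x by blast
      obtain a' b' where ab': "a' \<in> t'" "b' \<in> t'" "x = midpoint a' b'" using divide_vertex[OF t(4)] x by blast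
      have "{a, b} = {a', b'}" using midpoint_inj[OF t(1,2), of a b a' b'] ab ab' by simp
      moreover have "{a', b'} \<subseteq> t'" using ab' by simp
      ultimately have "{a, b} \<subseteq> t'" by simp
      then have "{a, b} \<subseteq> t \<inter> t'" using ab by simp
      then show ?thesis using ab(3) by blast
    qed
    obtain a b where ab: "x = midpoint a b" "{a, b} \<subseteq> t \<inter> t'" using mid xy by blast
    obtain c d where cd: "y = midpoint c d" "{c, d} \<subseteq> t \<inter> t'" using mid xy by blast
    have ft: "finite t" using triangle_finite[OF triangle_T[OF t(1)]] .
    have le: "card (t \<inter> t') \<le> 2" by (rule card_common_vertices[OF t(1,2) False])
    have "\<not> card (t \<inter> t') \<le> 1"
    proof
      assume "card (t \<inter> t') \<le> 1"
      then have "u = v" if "u \<in> t \<inter> t'" "v \<in> t \<inter> t'" for u v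
        using that ft card_le_Suc0_iff_eq[of "t \<inter> t'"] by auto
      then show False using ab cd xy(3) by (metis insert_subset)
    qed
    then have "(t, t') \<in> adjacent T" using le t unfolding adjacent_def by auto
    obtain p where p: "p \<in> t \<inter> t'" "s = corner t p"
      using shared_edge_corner[OF t(1) _ le t(3) ab _ cd _ xy(3)] xy by blast
    obtain p' where p': "p' \<in> t \<inter> t'" "s' = corner t' p'"
      using shared_edge_corner[OF t(2) _ le t(4) ab _ cd _ xy(3)] xy by blast
    \<comment> \<open>Corner children at different ends would have only the midpoint of the edge in
      common.\<close>
    have "p = p'"
    proof (rule ccontr)
      assume "p \<noteq> p'"
      have "x = midpoint p p'" if x: "x \<in> s \<inter> s'" for x
      proof -
        obtain z where z: "z \<in> t" "x = midpoint p z" using x p corner_vertex by blast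
        obtain z' where z': "z' \<in> t'" "x = midpoint p' z'" using x p' corner_vertex by blast
        have "{p, z} = {p', z'}" using midpoint_inj[OF t(1,2), of p z p' z'] z z' p p' by auto
        then show ?thesis using \<open>p \<noteq> p'\<close> z by (auto simp: doubleton_eq_iff)
      qed
      then show False using xy by metis
    qed
    then show ?thesis using p p' \<open>(t, t') \<in> adjacent T\<close> by blast
  qed (use t in blast)
qed

text \<open>An edge that cuts through the parent has its midpoint in the interior of the parent
  (\<open>cut\<close>), so only halves of the parent's edges remain; such a half belongs to a
  boundary edge (\<open>side\<close>).\<close>

lemma boundary_edges_refine:
  assumes "(s, a, b) \<in> boundary_edges \<Omega> (refine T)"
  shows "\<exists>t p q. (t, p, q) \<in> boundary_edges \<Omega> T \<and>
    ((s, a, b) = (corner t p, p, midpoint p q) \<or> (s, a, b) = (corner t p, midpoint p q, p))"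
proof -
  obtain t where t: "t \<in> T" "s \<in> divide t" and ab: "a \<in> s" "b \<in> s" "a \<noteq> b" "midpoint a b \<notin> \<Omega>"
    using assms unfolding boundary_edges_def refine_def by blast
  have cut: False if "t = {p, q, r}" "p \<noteq> q" "p \<noteq> r" "q \<noteq> r" "{a, b} = {midpoint p q, midpoint p r}" for p q r
  proof -
    have "midpoint (midpoint p q) (midpoint p r) \<in> \<Omega>"
      using centre_edge_interior[of p q r] triangle_T[OF t(1)] interior_hull_subset[OF t(1)] that by auto
    then show False using that(5) ab(4) by (metis doubleton_eq_iff midpoint_sym)
  qed
  have side: "(t, p, q) \<in> boundary_edges \<Omega> T" if "p \<in> t" "q \<in> t" "p \<noteq> q" "{a, b} = {p, midpoint p q}" for p q
  proof -
    have "midpoint p (midpoint p q) \<notin> \<Omega>" using that(4) ab(4) by (metis doubleton_eq_iff midpoint_sym)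
    moreover have "midpoint p (midpoint p q) = (1 - 1/4) *\<^sub>R p + (1/4) *\<^sub>R q"
      by (simp add: midpoint_def vec_eq_iff field_simps)
    then have "midpoint p (midpoint p q) \<in> open_segment p q"
      unfolding in_segment using \<open>p \<noteq> q\<close> by (intro conjI exI[of _ "1/4"]) auto
    ultimately have "midpoint p q \<notin> \<Omega>"
      using open_edge_subset[OF t(1) that(1,2) midpoint_open_segment[OF that(3)]] by blast
    then show ?thesis using that t unfolding boundary_edges_def by simp
  qed
  show ?thesis using triangle_T[OF t(1)] t(2)
  proof (cases rule: divide_cases)
    case (corner p q r)
    then consider "{a, b} = {p, midpoint p q}" | "{a, b} = {p, midpoint p r}" | "{a, b} = {midpoint p q, midpoint p r}"
      using ab(1-3) by auto
    then show ?thesis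
    proof cases
      case 1
      then have "(t, p, q) \<in> boundary_edges \<Omega> T" using side[of p q] corner by auto
      then show ?thesis using 1 corner(6) by (auto simp: doubleton_eq_iff)
    next
      case 2
      then have "(t, p, r) \<in> boundary_edges \<Omega> T" using side[of p r] corner by auto
      then show ?thesis using 2 corner(6) by (auto simp: doubleton_eq_iff)
    next
      case 3
      then show ?thesis using cut corner by blast
    qed
  next
    case (centre p q r)
    then consider "{a, b} = {midpoint p q, midpoint p r}" | "{a, b} = {midpoint q p, midpoint q r}" | "{a, b} = {midpoint r p, midpoint r q}"
      using ab(1-3) midpoint_sym[of q p] midpoint_sym[of r p] midpoint_sym[of r q] by auto
    then have False
      by cases (use cut[of p q r] cut[of q p r] cut[of r p q] centre(1-4) in \<open>auto simp: insert_commute\<close>)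
    then show ?thesis ..
  qed
qed

text \<open>The two bounds are carried along together. The count at an old vertex does not grow; a
  new vertex is an edge midpoint and meets at most the four children of each triangle at that edge.
  A half edge inherits the count of its coarse edge, and an inner edge belongs to children of a
  single parent, whence \<open>4 \<le> M\<close>.\<close>

lemma valence_refine:
  assumes V: "\<And>p. card {t \<in> T. p \<in> t} \<le> 4 * M"
    and E: "\<And>p q. p \<noteq> q \<Longrightarrow> card {t \<in> T. p \<in> t \<and> q \<in> t} \<le> M" and M: "4 \<le> M"
  shows "card {s \<in> refine T. z \<in> s} \<le> 4 * M" "a \<noteq> b \<Longrightarrow> card {s \<in> refine T. a \<in> s \<and> b \<in> s} \<le> M"
proof -
  have corner_only: "p \<in> t \<and> s = corner t p"
    if c: "t \<in> T" "s \<in> divide t" "p \<in> s" "t' \<in> T" "p \<in> t'" for s t t' p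
  proof -
    obtain a b where ab: "a \<in> t" "b \<in> t" "p = midpoint a b" using divide_vertex[OF c(2,3)] by metis
    then have e: "midpoint a b = midpoint p p" by (metis midpoint_idem)
    have "{a, b} = {p, p}" by (rule midpoint_inj[OF c(1,4) _ _ e]) (use ab(1,2) c(5) in simp_all)
    then have p: "p \<in> t" using ab(1) by (metis insertI1 insert_absorb2 singletonD)
    have "s = centre t \<or> (\<exists>q\<in>t. s = corner t q)" using c(2) unfolding divide_eq by auto
    then show ?thesis
    proof
      assume "s = centre t"
      then obtain x y where "x \<in> t" "y \<in> t" "x \<noteq> y" "p = midpoint x y" using centre_vertex c(3) by blast
      moreover from this have "midpoint x y = midpoint p p" by (metis midpoint_idem)
      ultimately have "{x, y} = {p, p}" using midpoint_inj[OF c(1,1), of x y p p] p by simp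
      then show ?thesis using \<open>x \<noteq> y\<close> by (metis insertI1 insertI2 insert_absorb2 singletonD)
    next
      assume "\<exists>q\<in>t. s = corner t q"
      then obtain q z where "q \<in> t" "s = corner t q" "z \<in> t" "p = midpoint q z" using corner_vertex c(3) by blast
      moreover from this have "midpoint q z = midpoint p p" by (metis midpoint_idem)
      ultimately have "{q, z} = {p, p}" using midpoint_inj[OF c(1,1), of q z p p] p by simp
      then have "q = p" by (metis insertI1 insert_absorb2 singletonD)
      then show ?thesis using p \<open>s = corner t q\<close> by simp
    qed
  qed
  have finT: "finite {t \<in> T. P t}" for P using finite_T by simp
  show "card {s \<in> refine T. z \<in> s} \<le> 4 * M"
  proof (cases "z \<in> \<Union>T")
    case True
    then have "{s \<in> refine T. z \<in> s} \<subseteq> (\<lambda>t. corner t z) ` {t \<in> T. z \<in> t}"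
      using corner_only unfolding refine_def by blast
    then have "card {s \<in> refine T. z \<in> s} \<le> card {t \<in> T. z \<in> t}"
      using surj_card_le[OF finT] by blast
    then show ?thesis using V[of z] by simp
  next
    case False
    show ?thesis
    proof (cases "\<exists>t\<in>T. \<exists>p\<in>t. \<exists>q\<in>t. z = midpoint p q")
      case True
      then obtain t p q where t: "t \<in> T" "p \<in> t" "q \<in> t" "z = midpoint p q" by blast
      then have "p \<noteq> q" using False by auto
      have "{s \<in> refine T. z \<in> s} \<subseteq> (\<Union>t\<in>{t \<in> T. p \<in> t \<and> q \<in> t}. divide t)"
      proof
        fix s assume "s \<in> {s \<in> refine T. z \<in> s}"
        then obtain t' where t': "t' \<in> T" "s \<in> divide t'" "z \<in> s" unfolding refine_def by blast
        then obtain a b where "a \<in> t'" "b \<in> t'" "z = midpoint a b" using divide_vertex by metis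
        then have "p \<in> t'" "q \<in> t'" using midpoint_inj[OF t(1) t'(1), of p q a b] t
            by (metis doubleton_eq_iff insert_subset empty_subsetI)+
        then show "s \<in> (\<Union>t\<in>{t \<in> T. p \<in> t \<and> q \<in> t}. divide t)" using t' by blast
      qed
      then have "card {s \<in> refine T. z \<in> s} \<le> card (\<Union>t\<in>{t \<in> T. p \<in> t \<and> q \<in> t}. divide t)"
        by (rule card_mono[rotated]) (use finT finite_divide triangle_finite triangle_T in auto)
      also have "\<dots> \<le> (\<Sum>t\<in>{t \<in> T. p \<in> t \<and> q \<in> t}. card (divide t))" by (rule card_UN_le[OF finT])
      also have "\<dots> = 4 * card {t \<in> T. p \<in> t \<and> q \<in> t}" using card_divide triangle_T by simp
      also have "\<dots> \<le> 4 * M" using E[OF \<open>p \<noteq> q\<close>] by simp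
      finally show ?thesis .
    next
      case False
      have "z \<notin> s" if s: "s \<in> refine T" for s
      proof
        assume z: "z \<in> s"
        obtain t where t: "t \<in> T" "s \<in> divide t" using s unfolding refine_def by blast
        obtain a b where "a \<in> t" "b \<in> t" "z = midpoint a b" using divide_vertex[OF t(2) z] by metis
        then show False using False t(1) by metis
      qed
      then have e: "{s \<in> refine T. z \<in> s} = {}" by blast
      show ?thesis unfolding e by simp
    qed
  qed
  assume "a \<noteq> b"
  show "card {s \<in> refine T. a \<in> s \<and> b \<in> s} \<le> M"
  proof (cases "\<exists>s0\<in>refine T. a \<in> s0 \<and> b \<in> s0")
    case True
    then obtain s0 t0 where s0: "t0 \<in> T" "s0 \<in> divide t0" "a \<in> s0" "b \<in> s0" unfolding refine_def by blast
    obtain p q where pq: "p \<in> t0" "q \<in> t0" "a = midpoint p q" using divide_vertex s0 by metis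
    obtain x y where xy: "x \<in> t0" "y \<in> t0" "b = midpoint x y" using divide_vertex s0 by metis
    let ?X = "{p, q, x, y}"
    have sub: "?X \<subseteq> t" if t: "t \<in> T" "s \<in> divide t" "a \<in> s" "b \<in> s" for s t
    proof -
      obtain p' q' where "p' \<in> t" "q' \<in> t" "a = midpoint p' q'" using divide_vertex t by metis
      moreover obtain x' y' where "x' \<in> t" "y' \<in> t" "b = midpoint x' y'" using divide_vertex t by metis
      ultimately have "{p, q} \<subseteq> t" "{x, y} \<subseteq> t"
        using midpoint_inj[OF s0(1) t(1), of p q p' q'] midpoint_inj[OF s0(1) t(1), of x y x' y'] pq xy
        by (metis insert_subset empty_subsetI)+
      then show ?thesis by blast
    qed
    show ?thesis
    proof (cases "p = q \<or> x = y")
      case True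
      have "\<exists>v w. v \<in> {a, b} \<and> v \<in> t0 \<and> w \<in> ?X \<and> w \<noteq> v"
      proof (cases "p = q")
        case True
        then have "a = p" using pq by simp
        then have "x \<noteq> p \<or> y \<noteq> p" using xy \<open>a \<noteq> b\<close> by auto
        then show ?thesis using \<open>a = p\<close> pq(1) by blast
      next
        case False
        then have "b = x" using \<open>p = q \<or> x = y\<close> xy by simp
        moreover have "p \<noteq> x \<or> q \<noteq> x" using False by auto
        ultimately show ?thesis using xy(1) by blast
      qed
      then obtain v w where v: "v \<in> {a, b}" "v \<in> t0" and w: "w \<in> ?X" "w \<noteq> v" by blast
      have "{s \<in> refine T. a \<in> s \<and> b \<in> s} \<subseteq> (\<lambda>t. corner t v) ` {t \<in> T. v \<in> t \<and> w \<in> t}"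
      proof
        fix s assume "s \<in> {s \<in> refine T. a \<in> s \<and> b \<in> s}"
        then obtain t where t: "t \<in> T" "s \<in> divide t" "a \<in> s" "b \<in> s" unfolding refine_def by blast
        then have "v \<in> t \<and> s = corner t v" using corner_only[OF t(1,2) _ s0(1) v(2)] v(1) by blast
        then show "s \<in> (\<lambda>t. corner t v) ` {t \<in> T. v \<in> t \<and> w \<in> t}" using sub[OF t] w t(1) by blast
      qed
      then have "card {s \<in> refine T. a \<in> s \<and> b \<in> s} \<le> card {t \<in> T. v \<in> t \<and> w \<in> t}"
        by (rule surj_card_le[OF finT])
      then show ?thesis using E[of v w] w by simp
    next
      case False
      \<comment> \<open>Two different edges of \<open>t0\<close> have at least three end points
        together, and these determine the parent.\<close>
      have X3: "card ?X \<ge> 3"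
      proof -
        have "{p, q} \<noteq> {x, y}" using pq xy \<open>a \<noteq> b\<close> by (metis doubleton_eq_iff midpoint_sym)
        then have "x \<notin> {p, q} \<or> y \<notin> {p, q}" using False by auto
        then have "card {p, q, x} = 3 \<or> card {p, q, y} = 3" using False by auto
        moreover have "card {p, q, x} \<le> card ?X" "card {p, q, y} \<le> card ?X" by (auto intro!: card_mono)
        ultimately show ?thesis by auto
      qed
      have "{s \<in> refine T. a \<in> s \<and> b \<in> s} \<subseteq> divide t0"
      proof
        fix s assume "s \<in> {s \<in> refine T. a \<in> s \<and> b \<in> s}"
        then obtain t where t: "t \<in> T" "s \<in> divide t" "a \<in> s" "b \<in> s" unfolding refine_def by blast
        have "card t = 3" "finite t" "card t0 = 3" "finite t0"
          using triangle_T t s0 triangle_finite unfolding triangle_def by auto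
        then have "?X = t" "?X = t0" using sub[OF t] sub[OF s0] X3 by (metis card_seteq)+
        then show "s \<in> divide t0" using t by simp
      qed
      then have "card {s \<in> refine T. a \<in> s \<and> b \<in> s} \<le> card (divide t0)"
        by (rule card_mono[rotated]) (intro finite_divide triangle_finite triangle_T s0)
      then show ?thesis using card_divide[OF triangle_T[OF s0(1)]] M by simp
    qed
  next
    case False
    then have e: "{s \<in> refine T. a \<in> s \<and> b \<in> s} = {}" by blast
    show ?thesis unfolding e by simp
  qed
qed

end

section \<open>Jumps and nodal values\<close>

lemma norm_add_square_le: "(norm (x + y :: 'a::real_inner))\<^sup>2 \<le> 2 * (norm x)\<^sup>2 + 2 * (norm y)\<^sup>2"
proof -
  have "0 \<le> (norm (x - y))\<^sup>2" by simp
  then show ?thesis by (simp add: power2_norm_eq_inner inner_add inner_diff inner_commute)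
qed

lemma norm_diff_square_le: "(norm (x - y :: 'a::real_inner))\<^sup>2 \<le> 2 * (norm x)\<^sup>2 + 2 * (norm y)\<^sup>2"
  using norm_add_square_le[of x "- y"] by simp

text \<open>The factor 3/2 instead of 2 is what makes the jump recursion contract: two halves of an
  edge and the weight 1/4 turn it into 3/4, while 2 would give 1.\<close>

lemma norm_add_square_le_weighted:
  "(norm (x + y :: 'a::real_inner))\<^sup>2 \<le> (3/2) * (norm x)\<^sup>2 + 3 * (norm y)\<^sup>2"
proof -
  have "0 \<le> (norm (x - 2 *\<^sub>R y))\<^sup>2" by simp
  then show ?thesis by (simp add: power2_norm_eq_inner inner_add inner_diff inner_commute)
qed

lemma sum_image_bound:
  fixes f :: "'a \<Rightarrow> real"
  assumes "finite I" "A \<subseteq> h ` I" "\<And>x. 0 \<le> f x"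
  shows "sum f A \<le> (\<Sum>i\<in>I. f (h i))"
proof -
  have "sum f A \<le> sum f (h ` I)" using assms by (intro sum_mono2) auto
  also have "\<dots> \<le> sum (f \<circ> h) I" by (rule sum_image_le) (use assms in auto)
  finally show ?thesis by (simp add: o_def)
qed

lemma sum_Un_bound:
  fixes f :: "'a \<Rightarrow> real"
  assumes "finite A" "finite B" "\<And>x. 0 \<le> f x"
  shows "sum f (A \<union> B) \<le> sum f A + sum f B"
proof -
  have "0 \<le> sum f (A \<inter> B)" using assms(3) by (simp add: sum_nonneg)
  then show ?thesis using sum_Un[OF assms(1,2), of f] by simp
qed

lemma chain_bound:
  fixes f :: "'a \<Rightarrow> real" and W :: real
  assumes "finite R" "(x, y) \<in> R\<^sup>*" "\<And>a b. (a, b) \<in> R \<Longrightarrow> \<bar>f a - f b\<bar> \<le> W" "0 \<le> W"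
  shows "\<bar>f x - f y\<bar> \<le> card R * W"
proof -
  obtain n where n: "n \<le> card R" "(x, y) \<in> R ^^ n"
    using assms(2) unfolding rtrancl_finite_eq_relpow[OF assms(1)] by blast
  have "\<bar>f x - f y\<bar> \<le> n * W"
    using n(2)
  proof (induction n arbitrary: y)
    case (Suc n)
    then obtain z where "(x, z) \<in> R ^^ n" "(z, y) \<in> R" by auto
    then have "\<bar>f x - f z\<bar> \<le> n * W" "\<bar>f z - f y\<bar> \<le> W" using Suc.IH assms(3) by auto
    then show ?case by (simp add: algebra_simps)
  qed simp
  also have "\<dots> \<le> card R * W" using n(1) assms(4) by (simp add: mult_right_mono)
  finally show ?thesis .
qed

text \<open>Jumps of the full gradient, without weights by edge lengths. At a boundary edge the jump
  is the one to the zero extension.\<close>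

definition jumps :: "(real^2) set \<Rightarrow> (real^2) set set \<Rightarrow> ((real^2) set \<Rightarrow> real^2) \<Rightarrow> real" where
  "jumps \<Omega> T G = (\<Sum>(t, t')\<in>adjacent T. (norm (G t - G t'))\<^sup>2) +
     (\<Sum>(t, p, q)\<in>boundary_edges \<Omega> T. (norm (G t))\<^sup>2)"

definition child_defect :: "(real^2) set set \<Rightarrow> ((real^2) set \<Rightarrow> real^2) \<Rightarrow> ((real^2) set \<Rightarrow> real^2) \<Rightarrow> real" where
  "child_defect T G G' = (\<Sum>t\<in>T. \<Sum>s\<in>divide t. (norm (G' s - G t))\<^sup>2)"

text \<open>The conforming companion of the Crouzeix-Raviart interpolant. Which of the triangles at an
  interior vertex is selected does not matter.\<close>

definition nodal_value :: "(real^2) set \<Rightarrow> (real^2) set set \<Rightarrow> (real^2 \<Rightarrow> real^2 \<Rightarrow> real) \<Rightarrow> real^2 \<Rightarrow> real" where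
  "nodal_value \<Omega> T m p = (if p \<in> \<Omega> then cr m (SOME t. t \<in> T \<and> p \<in> t) p else 0)"

section \<open>Recursion for the jumps\<close>

context triangulated
begin

lemma card_T: "t \<in> T \<Longrightarrow> card t = 3" and finite_t: "t \<in> T \<Longrightarrow> finite t"
  using triangle_T triangle_finite unfolding triangle_def by auto

lemma finite_adjacent: "finite (adjacent T)"
  by (rule finite_subset[of _ "T \<times> T"]) (use finite_T in \<open>auto simp: adjacent_def\<close>)

lemma finite_boundary_edges: "finite (boundary_edges \<Omega> T)"
  by (rule finite_subset[of _ "T \<times> \<Union>T \<times> \<Union>T"])
    (use finite_T finite_vertices in \<open>auto simp: boundary_edges_def\<close>)

text \<open>Starts the recursion on the coarsest mesh, where a dependence on the number of triangles
  is harmless. The 9 counts ordered pairs of vertices of a triangle.\<close>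

lemma jumps_le:
  assumes "card T \<le> n"
  shows "jumps \<Omega> T G \<le> (4 * real n + 9) * (\<Sum>t\<in>T. (norm (G t))\<^sup>2)"
proof -
  let ?S = "\<Sum>t\<in>T. (norm (G t))\<^sup>2"
  have "(\<Sum>(t, t')\<in>adjacent T. (norm (G t - G t'))\<^sup>2) \<le> (\<Sum>(t, t')\<in>T \<times> T. (norm (G t - G t'))\<^sup>2)"
    using finite_T by (intro sum_mono2) (auto simp: adjacent_def)
  also have "\<dots> \<le> (\<Sum>(t, t')\<in>T \<times> T. 2 * (norm (G t))\<^sup>2 + 2 * (norm (G t'))\<^sup>2)"
    by (rule sum_mono) (simp add: case_prod_beta norm_diff_square_le)
  also have "\<dots> = 4 * card T * ?S"
    by (simp add: sum.cartesian_product[symmetric] sum.distrib sum_distrib_left[symmetric])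
  finally have 1: "(\<Sum>(t, t')\<in>adjacent T. (norm (G t - G t'))\<^sup>2) \<le> 4 * card T * ?S" .
  have "(\<Sum>(t, p, q)\<in>boundary_edges \<Omega> T. (norm (G t))\<^sup>2) \<le> (\<Sum>(t, p, q)\<in>(SIGMA t:T. t \<times> t). (norm (G t))\<^sup>2)"
    using finite_T finite_t by (intro sum_mono2) (auto simp: boundary_edges_def intro!: finite_SigmaI)
  also have "\<dots> = (\<Sum>t\<in>T. \<Sum>x\<in>t \<times> t. (norm (G t))\<^sup>2)"
    using finite_T finite_t by (subst sum.Sigma) (auto intro!: sum.cong)
  also have "\<dots> = 9 * ?S" using card_T by (simp add: card_cartesian_product sum_distrib_left)
  finally have 2: "(\<Sum>(t, p, q)\<in>boundary_edges \<Omega> T. (norm (G t))\<^sup>2) \<le> 9 * ?S" .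
  have "4 * real (card T) * ?S \<le> 4 * n * ?S" using assms by (intro mult_right_mono) (auto simp: sum_nonneg)
  then show ?thesis using 1 2 unfolding jumps_def by (simp add: algebra_simps)
qed

lemma sum_vertices_bound:
  assumes N: "\<And>p. card {t \<in> T. p \<in> t} \<le> N" and F: "\<And>p. (0::real) \<le> F p"
  shows "(\<Sum>t\<in>T. \<Sum>p\<in>t. F p) \<le> N * (\<Sum>p\<in>\<Union>T. F p)"
proof -
  have "(\<Sum>t\<in>T. \<Sum>p\<in>t. F p) = (\<Sum>t\<in>T. \<Sum>p\<in>{p \<in> \<Union>T. p \<in> t}. F p)"
    by (intro sum.cong refl) auto
  also have "\<dots> = (\<Sum>p\<in>\<Union>T. \<Sum>t\<in>{t \<in> T. p \<in> t}. F p)"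
    by (rule sum.swap_restrict[OF finite_T finite_vertices])
  also have "\<dots> = (\<Sum>p\<in>\<Union>T. card {t \<in> T. p \<in> t} * F p)" by simp
  also have "\<dots> \<le> (\<Sum>p\<in>\<Union>T. N * F p)"
    using N F by (intro sum_mono mult_right_mono) (auto simp: of_nat_mono)
  finally show ?thesis by (simp add: sum_distrib_left)
qed

text \<open>A neighbour shares one of the three vertices of \<open>t\<close>, and at most
  \<open>N\<close> triangles contain that vertex.\<close>

lemma sum_adjacent_bound:
  assumes N: "\<And>p. card {t \<in> T. p \<in> t} \<le> N" and F: "\<And>t. (0::real) \<le> F t"
  shows "(\<Sum>(t, t')\<in>adjacent T. F t) \<le> 3 * N * (\<Sum>t\<in>T. F t)"
    and "(\<Sum>(t, t')\<in>adjacent T. F t') \<le> 3 * N * (\<Sum>t\<in>T. F t)"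
proof -
  have *: "(\<Sum>(t, t')\<in>A. F t) \<le> 3 * N * (\<Sum>t\<in>T. F t)" if A: "A \<subseteq> adjacent T" for A
  proof -
    let ?I = "SIGMA t:T. SIGMA p:t. {t' \<in> T. p \<in> t'}"
    have sub: "A \<subseteq> (\<lambda>(t, p, t'). (t, t')) ` ?I"
    proof
      fix z assume "z \<in> A"
      then obtain t t' where z: "z = (t, t')" "t \<in> T" "t' \<in> T" "card (t \<inter> t') = 2"
        using A unfolding adjacent_def by blast
      then have "t \<inter> t' \<noteq> {}" by auto
      then show "z \<in> (\<lambda>(t, p, t'). (t, t')) ` ?I" using z by force
    qed
    have fin: "finite ?I" using finite_T finite_t by (intro finite_SigmaI) auto
    have "(\<Sum>(t, t')\<in>A. F t) \<le> (\<Sum>i\<in>?I. (\<lambda>(t, t'). F t) ((\<lambda>(t, p, t'). (t, t')) i))"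
      by (rule sum_image_bound[OF fin sub]) (use F in auto)
    also have "\<dots> = (\<Sum>(t, p, t')\<in>?I. F t)" by (intro sum.cong) auto
    also have "\<dots> = (\<Sum>t\<in>T. \<Sum>(p, t')\<in>(SIGMA p:t. {t' \<in> T. p \<in> t'}). F t)"
      using finite_T finite_t by (subst sum.Sigma) (auto intro!: sum.cong finite_SigmaI)
    also have "\<dots> = (\<Sum>t\<in>T. \<Sum>p\<in>t. \<Sum>t'\<in>{t' \<in> T. p \<in> t'}. F t)"
      using finite_T finite_t by (intro sum.cong refl, subst sum.Sigma) auto
    also have "\<dots> \<le> (\<Sum>t\<in>T. \<Sum>p\<in>t. N * F t)"
      using N F by (intro sum_mono) (auto intro!: mult_right_mono simp: of_nat_mono)
    also have "\<dots> = 3 * N * (\<Sum>t\<in>T. F t)" using card_T by (simp add: sum_distrib_left mult.assoc)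
    finally show ?thesis .
  qed
  from *[of "adjacent T"] show "(\<Sum>(t, t')\<in>adjacent T. F t) \<le> 3 * N * (\<Sum>t\<in>T. F t)" by simp
  have "(\<Sum>(t, t')\<in>adjacent T. F t') = (\<Sum>(t, t')\<in>adjacent T. F t)"
    by (rule sum.reindex_bij_witness[of _ prod.swap prod.swap]) (auto simp: adjacent_def Int_commute)
  with *[of "adjacent T"] show "(\<Sum>(t, t')\<in>adjacent T. F t') \<le> 3 * N * (\<Sum>t\<in>T. F t)" by simp
qed

lemma corner_in_divide: "p \<in> t \<Longrightarrow> corner t p \<in> divide t"
  unfolding divide_eq by auto

text \<open>Edges inside a parent see only the defects. A coarse edge passes its jump on to two
  halves, each with factor 3/2, together with the defects next to it. The 70 is 16 from the inner
  edges plus 54 from the boundary, and \<open>72 * real N\<close> stems from the defects at the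
  halves of shared edges.\<close>

lemma jumps_refine:
  assumes N: "\<And>p. card {t \<in> T. p \<in> t} \<le> N"
  shows "jumps \<Omega> (refine T) G' \<le> 3 * jumps \<Omega> T G + (70 + 72 * real N) * child_defect T G G'"
proof -
  define S where "S t = (\<Sum>s\<in>divide t. (norm (G' s - G t))\<^sup>2)" for t
  have S0: "0 \<le> S t" for t unfolding S_def by (simp add: sum_nonneg)
  have fd: "finite (divide t)" if "t \<in> T" for t using finite_divide finite_t that by blast
  have SD: "(norm (G' s - G t))\<^sup>2 \<le> S t" if "t \<in> T" "s \<in> divide t" for s t
    unfolding S_def using that fd by (intro member_le_sum) auto
  let ?f = "\<lambda>(s, s'). (norm (G' s - G' s'))\<^sup>2"
  let ?I1 = "SIGMA t:T. divide t \<times> divide t" and ?I2 = "SIGMA (t, t'):adjacent T. t \<inter> t'"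
  let ?A1 = "snd ` ?I1" and ?A2 = "(\<lambda>((t, t'), p). (corner t p, corner t' p)) ` ?I2"
  have fin1: "finite ?I1" using finite_T fd by (intro finite_SigmaI) auto
  have fin2: "finite ?I2" using finite_adjacent finite_t by (intro finite_SigmaI) (auto simp: adjacent_def)
  have "adjacent (refine T) \<subseteq> ?A1 \<union> ?A2"
  proof
    fix z assume "z \<in> adjacent (refine T)"
    moreover obtain s s' where z: "z = (s, s')" by fastforce
    ultimately consider t where "t \<in> T" "s \<in> divide t" "s' \<in> divide t"
      | t t' p where "(t, t') \<in> adjacent T" "p \<in> t \<inter> t'" "s = corner t p" "s' = corner t' p"
      using adjacent_refine by blast
    then show "z \<in> ?A1 \<union> ?A2"
    proof cases
      case 1
      then have "(t, s, s') \<in> ?I1" by simp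
      then have "snd (t, s, s') \<in> ?A1" by (rule imageI)
      then show ?thesis unfolding z by (simp only: snd_conv Un_iff simp_thms)
    next
      case 2
      then have "((t, t'), p) \<in> ?I2" by simp
      then have "(\<lambda>((t, t'), p). (corner t p, corner t' p)) ((t, t'), p) \<in> ?A2" by (rule imageI)
      then show ?thesis unfolding z 2(3,4) by (simp only: case_prod_conv Un_iff simp_thms)
    qed
  qed
  then have "sum ?f (adjacent (refine T)) \<le> sum ?f (?A1 \<union> ?A2)"
    by (rule sum_mono2[rotated]) (use fin1 fin2 in auto)
  also have "\<dots> \<le> sum ?f ?A1 + sum ?f ?A2" using fin1 fin2 by (intro sum_Un_bound) auto
  also have "sum ?f ?A1 \<le> (\<Sum>i\<in>?I1. ?f (snd i))" by (rule sum_image_bound[OF fin1]) auto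
  also have "\<dots> = (\<Sum>t\<in>T. \<Sum>(s, s')\<in>divide t \<times> divide t. (norm (G' s - G' s'))\<^sup>2)"
    using finite_T fd by (subst sum.Sigma) (auto intro!: sum.cong)
  also have "\<dots> \<le> (\<Sum>t\<in>T. \<Sum>(s, s')\<in>divide t \<times> divide t. 2 * (norm (G' s - G t))\<^sup>2 + 2 * (norm (G' s' - G t))\<^sup>2)"
  proof (intro sum_mono, clarify)
    fix t s s'
    show "(norm (G' s - G' s'))\<^sup>2 \<le> 2 * (norm (G' s - G t))\<^sup>2 + 2 * (norm (G' s' - G t))\<^sup>2"
      using norm_diff_square_le[of "G' s - G t" "G' s' - G t"] by simp
  qed
  also have "\<dots> = (\<Sum>t\<in>T. 16 * S t)"
    unfolding S_def using card_divide triangle_T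
    by (intro sum.cong refl) (simp add: sum.cartesian_product[symmetric] sum.distrib sum_distrib_left[symmetric])
  also have "sum ?f ?A2 \<le> (\<Sum>i\<in>?I2. ?f ((\<lambda>((t, t'), p). (corner t p, corner t' p)) i))"
    by (rule sum_image_bound[OF fin2]) auto
  also have "\<dots> = (\<Sum>x\<in>adjacent T. \<Sum>p\<in>fst x \<inter> snd x. ?f (corner (fst x) p, corner (snd x) p))"
    using finite_adjacent finite_t by (subst sum.Sigma) (auto intro!: sum.cong simp: adjacent_def)
  also have "\<dots> \<le> (\<Sum>x\<in>adjacent T. \<Sum>p\<in>fst x \<inter> snd x. (3/2) * (norm (G (fst x) - G (snd x)))\<^sup>2 + 6 * (S (fst x) + S (snd x)))"
  proof (intro sum_mono)
    fix x p assume x: "x \<in> adjacent T" "p \<in> fst x \<inter> snd x"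
    obtain t t' where tt: "x = (t, t')" by fastforce
    have t: "t \<in> T" "t' \<in> T" "p \<in> t" "p \<in> t'" using x tt by (auto simp: adjacent_def)
    let ?d = "G' (corner t p) - G t" and ?d' = "G' (corner t' p) - G t'"
    have "G' (corner t p) - G' (corner t' p) = (G t - G t') + (?d - ?d')" by simp
    then have "(norm (G' (corner t p) - G' (corner t' p)))\<^sup>2 \<le> (3/2) * (norm (G t - G t'))\<^sup>2 + 3 * (norm (?d - ?d'))\<^sup>2"
      using norm_add_square_le_weighted by metis
    moreover have "(norm (?d - ?d'))\<^sup>2 \<le> 2 * (norm ?d)\<^sup>2 + 2 * (norm ?d')\<^sup>2" by (rule norm_diff_square_le)
    moreover have "(norm ?d)\<^sup>2 \<le> S t" "(norm ?d')\<^sup>2 \<le> S t'" using SD t corner_in_divide by blast+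
    ultimately show "?f (corner (fst x) p, corner (snd x) p) \<le>
        (3/2) * (norm (G (fst x) - G (snd x)))\<^sup>2 + 6 * (S (fst x) + S (snd x))" unfolding tt by simp
  qed
  also have "\<dots> = (\<Sum>x\<in>adjacent T. 3 * (norm (G (fst x) - G (snd x)))\<^sup>2 + 12 * (S (fst x) + S (snd x)))"
    by (intro sum.cong refl) (auto simp: adjacent_def)
  also have "\<dots> = 3 * (\<Sum>(t, t')\<in>adjacent T. (norm (G t - G t'))\<^sup>2) +
      12 * ((\<Sum>(t, t')\<in>adjacent T. S t) + (\<Sum>(t, t')\<in>adjacent T. S t'))"
    by (simp add: sum.distrib sum_distrib_left case_prod_beta algebra_simps)
  also have "\<dots> \<le> 3 * (\<Sum>(t, t')\<in>adjacent T. (norm (G t - G t'))\<^sup>2) + 12 * (3 * N * sum S T + 3 * N * sum S T)"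
    using sum_adjacent_bound[OF N S0] by (intro add_left_mono mult_left_mono add_mono) auto
  finally have 1: "sum ?f (adjacent (refine T)) \<le> 16 * sum S T +
      (3 * (\<Sum>(t, t')\<in>adjacent T. (norm (G t - G t'))\<^sup>2) + 72 * N * sum S T)"
    by (simp add: sum_distrib_left[symmetric])
  let ?g = "\<lambda>(s, a, b). (norm (G' s))\<^sup>2"
  let ?h1 = "\<lambda>(t, p, q). (corner t p, p, midpoint p q)" and ?h2 = "\<lambda>(t, p, q). (corner t p, midpoint p q, p)"
  note fb = finite_boundary_edges
  have "boundary_edges \<Omega> (refine T) \<subseteq> ?h1 ` boundary_edges \<Omega> T \<union> ?h2 ` boundary_edges \<Omega> T"
  proof
    fix z assume "z \<in> boundary_edges \<Omega> (refine T)"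
    moreover obtain s a b where z: "z = (s, a, b)" by (metis surj_pair)
    ultimately obtain t p q where tpq: "(t, p, q) \<in> boundary_edges \<Omega> T"
        "z = ?h1 (t, p, q) \<or> z = ?h2 (t, p, q)" using boundary_edges_refine by fastforce
    then show "z \<in> ?h1 ` boundary_edges \<Omega> T \<union> ?h2 ` boundary_edges \<Omega> T" by blast
  qed
  then have "sum ?g (boundary_edges \<Omega> (refine T)) \<le> sum ?g (?h1 ` boundary_edges \<Omega> T \<union> ?h2 ` boundary_edges \<Omega> T)"
    by (rule sum_mono2[rotated]) (use fb in auto)
  also have "\<dots> \<le> sum ?g (?h1 ` boundary_edges \<Omega> T) + sum ?g (?h2 ` boundary_edges \<Omega> T)"
    using fb by (intro sum_Un_bound) auto
  also have "\<dots> \<le> (\<Sum>x\<in>boundary_edges \<Omega> T. ?g (?h1 x)) + (\<Sum>x\<in>boundary_edges \<Omega> T. ?g (?h2 x))"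
    using fb by (intro add_mono sum_image_bound) auto
  also have "\<dots> = (\<Sum>(t, p, q)\<in>boundary_edges \<Omega> T. 2 * (norm (G' (corner t p)))\<^sup>2)"
    by (simp add: sum.distrib[symmetric] case_prod_beta)
  also have "\<dots> \<le> (\<Sum>(t, p, q)\<in>boundary_edges \<Omega> T. 3 * (norm (G t))\<^sup>2 + 6 * S t)"
  proof (intro sum_mono, clarify)
    fix t p q assume "(t, p, q) \<in> boundary_edges \<Omega> T"
    then have t: "t \<in> T" "p \<in> t" by (auto simp: boundary_edges_def)
    have "(norm (G' (corner t p)))\<^sup>2 \<le> (3/2) * (norm (G t))\<^sup>2 + 3 * (norm (G' (corner t p) - G t))\<^sup>2"
      using norm_add_square_le_weighted[of "G t" "G' (corner t p) - G t"] by simp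
    moreover have "(norm (G' (corner t p) - G t))\<^sup>2 \<le> S t" using SD t corner_in_divide by blast
    ultimately show "2 * (norm (G' (corner t p)))\<^sup>2 \<le> 3 * (norm (G t))\<^sup>2 + 6 * S t" by simp
  qed
  also have "\<dots> = 3 * (\<Sum>(t, p, q)\<in>boundary_edges \<Omega> T. (norm (G t))\<^sup>2) + 6 * (\<Sum>(t, p, q)\<in>boundary_edges \<Omega> T. S t)"
    by (simp add: sum.distrib sum_distrib_left case_prod_beta)
  also have "(\<Sum>(t, p, q)\<in>boundary_edges \<Omega> T. S t) \<le> (\<Sum>(t, p, q)\<in>(SIGMA t:T. t \<times> t). S t)"
    using finite_T finite_t S0 by (intro sum_mono2) (auto simp: boundary_edges_def intro!: finite_SigmaI)
  also have "\<dots> = (\<Sum>t\<in>T. \<Sum>x\<in>t \<times> t. S t)"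
    using finite_T finite_t by (subst sum.Sigma) (auto intro!: sum.cong)
  also have "\<dots> = 9 * sum S T" using card_T by (simp add: card_cartesian_product sum_distrib_left)
  finally have 2: "sum ?g (boundary_edges \<Omega> (refine T)) \<le>
      3 * (\<Sum>(t, p, q)\<in>boundary_edges \<Omega> T. (norm (G t))\<^sup>2) + 54 * sum S T" by linarith
  have "child_defect T G G' = sum S T" unfolding child_defect_def S_def ..
  then show ?thesis using 1 2 unfolding jumps_def by (simp add: algebra_simps)
qed


section \<open>Error of the conforming companion\<close>

lemma cr_jump:
  fixes h :: real
  assumes sym: "\<And>p q. m p q = m q p"
    and h: "\<And>t x y. t \<in> T \<Longrightarrow> x \<in> convex hull t \<Longrightarrow> y \<in> convex hull t \<Longrightarrow> dist x y \<le> h"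
    and tt: "(t, t') \<in> adjacent_at T p"
  shows "\<bar>cr m t p - cr m t' p\<bar> \<le> h * norm (cr_grad m t - cr_grad m t')"
proof -
  have t: "t \<in> T" "t' \<in> T" "p \<in> t" "p \<in> t'" "card (t \<inter> t') = 2"
    using tt unfolding adjacent_at_def adjacent_def by auto
  obtain q where q: "q \<in> t \<inter> t'" "q \<noteq> p" using t(5) by (metis card_2_iff insertI1 insertI2)
  let ?z = "midpoint p q"
  \<comment> \<open>Both interpolants take the prescribed mean at the midpoint of the shared edge,
    so they drift apart only through their gradients on the way to \<open>p\<close>.\<close>
  have "cr m t ?z = cr m t' ?z"
    using cr_midpoint[of t m p q] cr_midpoint[of t' m p q] triangle_T t q sym by simp
  then have "cr m t p - cr m t' p = (cr_grad m t - cr_grad m t') \<bullet> (p - ?z)"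
    using cr_diff[of m t p ?z] cr_diff[of m t' p ?z] by (simp add: inner_diff_left)
  then have "\<bar>cr m t p - cr m t' p\<bar> \<le> norm (cr_grad m t - cr_grad m t') * norm (p - ?z)"
    using Cauchy_Schwarz_ineq2 by metis
  also have "\<dots> \<le> norm (cr_grad m t - cr_grad m t') * h"
    using h[OF t(1) hull_inc[OF t(3)] midpoint_in_hull[OF t(3)]] q
    by (intro mult_left_mono) (auto simp: dist_norm)
  finally show ?thesis by (simp add: mult.commute)
qed

lemma cr_boundary_value:
  fixes h :: real
  assumes sym: "\<And>p q. m p q = m q p"
    and h: "\<And>t x y. t \<in> T \<Longrightarrow> x \<in> convex hull t \<Longrightarrow> y \<in> convex hull t \<Longrightarrow> dist x y \<le> h"
    and bdry: "\<And>t p q. (t, p, q) \<in> boundary_edges \<Omega> T \<Longrightarrow> m p q = 0"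
    and t: "(t, p, q) \<in> boundary_edges \<Omega> T" and x: "x \<in> t"
  shows "\<bar>cr m t x\<bar> \<le> h * norm (cr_grad m t)"
proof -
  let ?z = "midpoint p q"
  have t': "t \<in> T" "p \<in> t" "q \<in> t" "p \<noteq> q" using t unfolding boundary_edges_def by auto
  have "cr m t ?z = 0" using cr_midpoint[of t m p q] bdry[OF t] t' triangle_T sym by simp
  then have "cr m t x = cr_grad m t \<bullet> (x - ?z)" using cr_diff[of m t x ?z] by simp
  then have "\<bar>cr m t x\<bar> \<le> norm (cr_grad m t) * norm (x - ?z)"
    using Cauchy_Schwarz_ineq2 by metis
  also have "\<dots> \<le> norm (cr_grad m t) * h"
    using h[OF t'(1) hull_inc[OF x] midpoint_in_hull[OF t'(2,3)]]
    by (intro mult_left_mono) (auto simp: dist_norm)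
  finally show ?thesis by (simp add: mult.commute)
qed

lemma finite_adjacent_at: "finite (adjacent_at T p)"
  by (rule finite_subset[OF _ finite_adjacent]) (auto simp: adjacent_at_def)

lemma card_adjacent_at:
  assumes "card {t \<in> T. p \<in> t} \<le> N"
  shows "card (adjacent_at T p) \<le> N\<^sup>2"
proof -
  have "card (adjacent_at T p) \<le> card ({t \<in> T. p \<in> t} \<times> {t \<in> T. p \<in> t})"
    using finite_T by (intro card_mono) (auto simp: adjacent_at_def adjacent_def)
  also have "\<dots> \<le> N * N" using assms by (simp add: card_cartesian_product mult_mono)
  finally show ?thesis by (simp add: power2_eq_square)
qed

text \<open>At an interior vertex a chain of neighbours leads from \<open>t\<close> to the selected
  triangle; at a boundary vertex one leads to a triangle with a boundary edge, where the interpolant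
  is small. A chain has at most \<open>N\<^sup>2\<close> steps; squaring its length gives the fourth
  power of \<open>N\<close>, and Cauchy-Schwarz another square. The 2s come from splitting a square
  at a boundary vertex.\<close>

lemma nodal_value_error:
  fixes h :: real
  assumes sym: "\<And>p q. m p q = m q p"
    and h: "\<And>t x y. t \<in> T \<Longrightarrow> x \<in> convex hull t \<Longrightarrow> y \<in> convex hull t \<Longrightarrow> dist x y \<le> h"
    and bdry: "\<And>t p q. (t, p, q) \<in> boundary_edges \<Omega> T \<Longrightarrow> m p q = 0"
    and N: "\<And>p. card {t \<in> T. p \<in> t} \<le> N"
    and t: "t \<in> T" "p \<in> t"
  shows "(cr m t p - nodal_value \<Omega> T m p)\<^sup>2 \<le> (2 * real N ^ 6 + 2) * h\<^sup>2 *
    ((\<Sum>(t, t')\<in>adjacent_at T p. (norm (cr_grad m t - cr_grad m t'))\<^sup>2) +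
     (\<Sum>(t, q)\<in>{(t, q). (t, p, q) \<in> boundary_edges \<Omega> T}. (norm (cr_grad m t))\<^sup>2))"
    (is "_ \<le> _ * (?A + ?B)")
proof -
  have fB: "finite {(t, q). (t, p, q) \<in> boundary_edges \<Omega> T}"
    by (rule finite_subset[of _ "T \<times> \<Union>T"])
      (use finite_T finite_vertices in \<open>auto simp: boundary_edges_def\<close>)
  have h0: "0 \<le> h" using h[OF t(1) hull_inc[OF t(2)] hull_inc[OF t(2)]] by simp
  let ?w = "\<lambda>x. norm (cr_grad m (fst x) - cr_grad m (snd x))"
  let ?R = "adjacent_at T p"
  have A0: "0 \<le> ?A" "0 \<le> ?B" by (auto intro!: sum_nonneg)
  have chain: "(cr m t p - cr m t' p)\<^sup>2 \<le> real N ^ 6 * h\<^sup>2 * ?A" if "(t, t') \<in> ?R\<^sup>*" for t'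
  proof -
    have "\<bar>cr m t p - cr m t' p\<bar> \<le> card ?R * (h * sum ?w ?R)"
    proof (rule chain_bound[where f = "\<lambda>t. cr m t p", OF finite_adjacent_at that])
      fix a b assume ab: "(a, b) \<in> ?R"
      have "\<bar>cr m a p - cr m b p\<bar> \<le> h * norm (cr_grad m a - cr_grad m b)" by (rule cr_jump[OF sym h ab])
      also have "\<dots> \<le> h * sum ?w ?R"
        using member_le_sum[of "(a, b)" ?R ?w] ab finite_adjacent_at by (intro mult_left_mono h0) auto
      finally show "\<bar>cr m a p - cr m b p\<bar> \<le> h * sum ?w ?R" .
    qed (simp add: h0 sum_nonneg)
    then have "(cr m t p - cr m t' p)\<^sup>2 \<le> (card ?R * (h * sum ?w ?R))\<^sup>2"
      by (rule abs_le_square_iff[THEN iffD1, OF order_trans[OF _ abs_ge_self]])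
    also have "\<dots> = (real (card ?R))\<^sup>2 * h\<^sup>2 * (sum ?w ?R)\<^sup>2" by (simp add: power_mult_distrib)
    also have "\<dots> \<le> (real (card ?R))\<^sup>2 * h\<^sup>2 * ((\<Sum>x\<in>?R. (?w x)\<^sup>2) * card ?R)"
      by (intro mult_left_mono sum_squared_le_sum_of_squares) auto
    also have "\<dots> = real (card ?R) ^ 3 * (h\<^sup>2 * ?A)"
      by (simp add: case_prod_beta power2_eq_square power3_eq_cube)
    also have "\<dots> \<le> real (N\<^sup>2) ^ 3 * (h\<^sup>2 * ?A)"
      using card_adjacent_at[OF N] A0 by (intro mult_right_mono power_mono) auto
    finally show ?thesis by (simp add: power_mult[symmetric] mult.assoc)
  qed
  show ?thesis
  proof (cases "p \<in> \<Omega>")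
    case True
    define t' where "t' = (SOME t. t \<in> T \<and> p \<in> t)"
    have t': "t' \<in> T \<and> p \<in> t'" unfolding t'_def by (rule someI[of _ t]) (use t in simp)
    then have "(cr m t p - cr m t' p)\<^sup>2 \<le> real N ^ 6 * h\<^sup>2 * ?A"
      using chain star_connected[OF True t] by blast
    also have "\<dots> \<le> (2 * real N ^ 6 + 2) * h\<^sup>2 * (?A + ?B)"
      using A0 by (intro mult_mono) auto
    finally show ?thesis using True unfolding nodal_value_def t'_def by simp
  next
    case False
    obtain t' q where t': "(t, t') \<in> ?R\<^sup>*" "(t', p, q) \<in> boundary_edges \<Omega> T"
      using star_boundary[OF False t] unfolding boundary_edges_def by blast
    then have p: "p \<in> t'" unfolding boundary_edges_def by auto
    have "(cr m t' p)\<^sup>2 \<le> (h * norm (cr_grad m t'))\<^sup>2"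
      using cr_boundary_value[OF sym h bdry t'(2) p]
      by (rule abs_le_square_iff[THEN iffD1, OF order_trans[OF _ abs_ge_self]])
    also have "\<dots> \<le> h\<^sup>2 * ?B"
      using member_le_sum[of "(t', q)" "{(t, q). (t, p, q) \<in> boundary_edges \<Omega> T}" "\<lambda>(t, q). (norm (cr_grad m t))\<^sup>2"] t'(2) fB
      unfolding power_mult_distrib by (intro mult_left_mono) auto
    finally have b: "(cr m t' p)\<^sup>2 \<le> h\<^sup>2 * ?B" .
    have "(cr m t p)\<^sup>2 \<le> 2 * (cr m t p - cr m t' p)\<^sup>2 + 2 * (cr m t' p)\<^sup>2"
      using norm_add_square_le[of "cr m t p - cr m t' p" "cr m t' p"] by simp
    also have "\<dots> \<le> 2 * (real N ^ 6 * h\<^sup>2 * ?A) + 2 * (h\<^sup>2 * ?B)"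
      using chain[OF t'(1)] b by linarith
    also have "\<dots> \<le> (2 * real N ^ 6 + 2) * h\<^sup>2 * ?A + (2 * real N ^ 6 + 2) * h\<^sup>2 * ?B"
      unfolding mult.assoc[symmetric] using A0 by (intro add_mono mult_right_mono) auto
    also have "\<dots> = (2 * real N ^ 6 + 2) * h\<^sup>2 * (?A + ?B)" by (simp add: distrib_left)
    finally show ?thesis using False unfolding nodal_value_def by simp
  qed
qed

text \<open>Each vertex lies in at most \<open>N\<close> triangles. A pair of neighbours is seen
  from its two common vertices, a boundary triple from its first end point only.\<close>

lemma nodal_value_error_sum:
  fixes h :: real
  assumes sym: "\<And>p q. m p q = m q p"
    and h: "\<And>t x y. t \<in> T \<Longrightarrow> x \<in> convex hull t \<Longrightarrow> y \<in> convex hull t \<Longrightarrow> dist x y \<le> h"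
    and bdry: "\<And>t p q. (t, p, q) \<in> boundary_edges \<Omega> T \<Longrightarrow> m p q = 0"
    and N: "\<And>p. card {t \<in> T. p \<in> t} \<le> N"
  shows "(\<Sum>t\<in>T. \<Sum>p\<in>t. (cr m t p - nodal_value \<Omega> T m p)\<^sup>2) \<le>
    2 * real N * (2 * real N ^ 6 + 2) * h\<^sup>2 * jumps \<Omega> T (cr_grad m)"
proof -
  define A where "A p = (\<Sum>x\<in>adjacent_at T p. (norm (cr_grad m (fst x) - cr_grad m (snd x)))\<^sup>2)" for p
  define B where "B p = (\<Sum>x\<in>{(t, q). (t, p, q) \<in> boundary_edges \<Omega> T}. (norm (cr_grad m (fst x)))\<^sup>2)" for p
  let ?C = "(2 * real N ^ 6 + 2) * h\<^sup>2"
  have AB: "0 \<le> A p" "0 \<le> B p" for p unfolding A_def B_def by (auto intro: sum_nonneg)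
  have "(\<Sum>t\<in>T. \<Sum>p\<in>t. (cr m t p - nodal_value \<Omega> T m p)\<^sup>2) \<le> (\<Sum>t\<in>T. \<Sum>p\<in>t. ?C * (A p + B p))"
    using nodal_value_error[OF sym h bdry N] unfolding A_def B_def
    by (intro sum_mono) (simp add: case_prod_beta)
  also have "\<dots> \<le> N * (\<Sum>p\<in>\<Union>T. ?C * (A p + B p))"
    by (rule sum_vertices_bound[OF N]) (use AB in \<open>auto intro!: mult_nonneg_nonneg\<close>)
  also have "\<dots> = N * ?C * (sum A (\<Union>T) + sum B (\<Union>T))"
    by (simp add: sum_distrib_left[symmetric] sum.distrib)
  also have "\<dots> \<le> N * ?C * (2 * jumps \<Omega> T (cr_grad m))"
  proof (rule mult_left_mono)
    have "sum A (\<Union>T) = (\<Sum>p\<in>\<Union>T. \<Sum>x\<in>{x \<in> adjacent T. p \<in> fst x \<inter> snd x}. (norm (cr_grad m (fst x) - cr_grad m (snd x)))\<^sup>2)"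
      unfolding A_def adjacent_at_def by (intro sum.cong) auto
    also have "\<dots> = (\<Sum>x\<in>adjacent T. \<Sum>p\<in>{p \<in> \<Union>T. p \<in> fst x \<inter> snd x}. (norm (cr_grad m (fst x) - cr_grad m (snd x)))\<^sup>2)"
      by (rule sum.swap_restrict[OF finite_vertices finite_adjacent])
    also have "\<dots> = (\<Sum>x\<in>adjacent T. 2 * (norm (cr_grad m (fst x) - cr_grad m (snd x)))\<^sup>2)"
    proof (intro sum.cong refl)
      fix x assume "x \<in> adjacent T"
      then have "{p \<in> \<Union>T. p \<in> fst x \<inter> snd x} = fst x \<inter> snd x" "card (fst x \<inter> snd x) = 2"
        unfolding adjacent_def by auto
      then show "(\<Sum>p\<in>{p \<in> \<Union>T. p \<in> fst x \<inter> snd x}. (norm (cr_grad m (fst x) - cr_grad m (snd x)))\<^sup>2) =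
          2 * (norm (cr_grad m (fst x) - cr_grad m (snd x)))\<^sup>2" by simp
    qed
    finally have 1: "sum A (\<Union>T) = 2 * (\<Sum>(t, t')\<in>adjacent T. (norm (cr_grad m t - cr_grad m t'))\<^sup>2)"
      by (simp add: sum_distrib_left case_prod_beta)
    have "sum B (\<Union>T) = (\<Sum>p\<in>\<Union>T. \<Sum>x\<in>{x \<in> boundary_edges \<Omega> T. fst (snd x) = p}. (norm (cr_grad m (fst x)))\<^sup>2)"
      unfolding B_def
      by (intro sum.cong refl sum.reindex_bij_witness[of _ "\<lambda>x. (fst x, snd (snd x))" "\<lambda>x. (fst x, p, snd x)" for p]) auto
    also have "\<dots> = (\<Sum>x\<in>boundary_edges \<Omega> T. \<Sum>p\<in>{p \<in> \<Union>T. fst (snd x) = p}. (norm (cr_grad m (fst x)))\<^sup>2)"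
      by (rule sum.swap_restrict[OF finite_vertices finite_boundary_edges])
    also have "\<dots> = (\<Sum>x\<in>boundary_edges \<Omega> T. (norm (cr_grad m (fst x)))\<^sup>2)"
    proof (intro sum.cong refl)
      fix x assume "x \<in> boundary_edges \<Omega> T"
      then have "{p \<in> \<Union>T. fst (snd x) = p} = {fst (snd x)}" unfolding boundary_edges_def by auto
      then show "(\<Sum>p\<in>{p \<in> \<Union>T. fst (snd x) = p}. (norm (cr_grad m (fst x)))\<^sup>2) = (norm (cr_grad m (fst x)))\<^sup>2" by simp
    qed
    finally have 2: "sum B (\<Union>T) = (\<Sum>(t, p, q)\<in>boundary_edges \<Omega> T. (norm (cr_grad m t))\<^sup>2)"
      by (simp add: case_prod_beta)
    have "0 \<le> (\<Sum>(t, p, q)\<in>boundary_edges \<Omega> T. (norm (cr_grad m t))\<^sup>2)" by (auto intro: sum_nonneg)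
    then show "sum A (\<Union>T) + sum B (\<Union>T) \<le> 2 * jumps \<Omega> T (cr_grad m)"
      unfolding 1 2 jumps_def by simp
  qed simp
  finally show ?thesis by (simp add: algebra_simps)
qed

text \<open>The constant grows with the number of triangles, so this is only good on the coarsest level.\<close>

lemma nodal_value_poincare:
  fixes h :: real
  assumes sym: "\<And>p q. m p q = m q p"
    and h: "\<And>t x y. t \<in> T \<Longrightarrow> x \<in> convex hull t \<Longrightarrow> y \<in> convex hull t \<Longrightarrow> dist x y \<le> h"
    and bdry: "\<And>t p q. (t, p, q) \<in> boundary_edges \<Omega> T \<Longrightarrow> m p q = 0"
    and p: "p \<in> \<Union>T"
  shows "(nodal_value \<Omega> T m p)\<^sup>2 \<le>
    (2 * real (card (adjacent T)) + 2)\<^sup>2 * h\<^sup>2 * real (card T) * (\<Sum>t\<in>T. (norm (cr_grad m t))\<^sup>2)"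
proof -
  obtain t0 where t0: "t0 \<in> T" "p \<in> t0" using p by blast
  have h0: "0 \<le> h" using h[OF t0(1) hull_inc[OF t0(2)] hull_inc[OF t0(2)]] by simp
  let ?S = "\<Sum>t\<in>T. norm (cr_grad m t)"
  have S0: "0 \<le> ?S" by (simp add: sum_nonneg)
  have S: "norm (cr_grad m t) \<le> ?S" if "t \<in> T" for t
    using that finite_T by (intro member_le_sum) auto
  have inside: "\<bar>cr m t x - cr m t y\<bar> \<le> h * ?S" if "t \<in> T" "x \<in> convex hull t" "y \<in> convex hull t" for t x y
  proof -
    have "\<bar>cr m t x - cr m t y\<bar> \<le> norm (cr_grad m t) * norm (x - y)"
      unfolding cr_diff by (rule Cauchy_Schwarz_ineq2)
    also have "\<dots> \<le> ?S * h" using S[OF that(1)] h[OF that] S0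
      by (intro mult_mono) (auto simp: dist_norm)
    finally show ?thesis by (simp add: mult.commute)
  qed
  \<comment> \<open>One base vertex per triangle makes the value a function of the triangle, as
    \<open>chain_bound\<close> requires.\<close>
  define v where "v t = (SOME x. x \<in> t)" for t :: "(real^2) set"
  have v: "v t \<in> t" if "t \<in> T" for t
    unfolding v_def using card_T[OF that] by (intro some_in_eq[THEN iffD2]) auto
  have "(nodal_value \<Omega> T m p)\<^sup>2 \<le> ((2 * real (card (adjacent T)) + 2) * h * ?S)\<^sup>2"
  proof (cases "p \<in> \<Omega>")
    case True
    define t where "t = (SOME t. t \<in> T \<and> p \<in> t)"
    have t: "t \<in> T" "p \<in> t" using someI[of "\<lambda>t. t \<in> T \<and> p \<in> t" t0] t0 unfolding t_def by auto
    obtain t' x y where t': "(t, t') \<in> (adjacent T)\<^sup>*" "(t', x, y) \<in> boundary_edges \<Omega> T"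
      using global_boundary[OF t(1)] unfolding boundary_edges_def by blast
    have T': "t' \<in> T" using t'(2) unfolding boundary_edges_def by auto
    \<comment> \<open>Crossing a shared edge through its midpoint costs one diameter in each of the
      two triangles.\<close>
    have "\<bar>cr m t (v t) - cr m t' (v t')\<bar> \<le> card (adjacent T) * (2 * (h * ?S))"
    proof (rule chain_bound[where f = "\<lambda>t. cr m t (v t)", OF finite_adjacent t'(1)])
      fix a b assume "(a, b) \<in> adjacent T"
      then have ab: "a \<in> T" "b \<in> T" "card (a \<inter> b) = 2" unfolding adjacent_def by auto
      then obtain x y where xy: "x \<in> a" "x \<in> b" "y \<in> a" "y \<in> b" "x \<noteq> y"
        by (metis Int_iff card_2_iff insertI1 insertI2)
      have "cr m a (midpoint x y) = cr m b (midpoint x y)"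
        using cr_midpoint[of a m x y] cr_midpoint[of b m x y] triangle_T ab xy sym by simp
      moreover have "\<bar>cr m a (v a) - cr m a (midpoint x y)\<bar> \<le> h * ?S"
        "\<bar>cr m b (v b) - cr m b (midpoint x y)\<bar> \<le> h * ?S"
        using inside[OF ab(1) hull_inc[OF v[OF ab(1)]] midpoint_in_hull[OF xy(1,3)]]
          inside[OF ab(2) hull_inc[OF v[OF ab(2)]] midpoint_in_hull[OF xy(2,4)]] by simp_all
      ultimately show "\<bar>cr m a (v a) - cr m b (v b)\<bar> \<le> 2 * (h * ?S)" by linarith
    qed (simp add: h0 S0)
    moreover have "\<bar>cr m t p - cr m t (v t)\<bar> \<le> h * ?S"
      using t v by (auto intro!: inside hull_inc)
    moreover have "\<bar>cr m t' (v t')\<bar> \<le> h * ?S"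
    proof -
      have "\<bar>cr m t' (v t')\<bar> \<le> h * norm (cr_grad m t')"
        by (rule cr_boundary_value[OF sym h bdry t'(2) v[OF T']])
      then show ?thesis using mult_left_mono[OF S[OF T'] h0] by linarith
    qed
    ultimately have "\<bar>cr m t p\<bar> \<le> card (adjacent T) * (2 * (h * ?S)) + h * ?S + h * ?S" by linarith
    also have "\<dots> = (2 * real (card (adjacent T)) + 2) * h * ?S" by (simp add: algebra_simps)
    finally have "\<bar>nodal_value \<Omega> T m p\<bar> \<le> (2 * real (card (adjacent T)) + 2) * h * ?S"
      using True unfolding nodal_value_def t_def by simp
    then show ?thesis by (rule abs_le_square_iff[THEN iffD1, OF order_trans[OF _ abs_ge_self]])
  qed (simp add: nodal_value_def)
  also have "\<dots> = (2 * real (card (adjacent T)) + 2)\<^sup>2 * h\<^sup>2 * ?S\<^sup>2" by (simp add: power_mult_distrib)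
  also have "\<dots> \<le> (2 * real (card (adjacent T)) + 2)\<^sup>2 * h\<^sup>2 * ((\<Sum>t\<in>T. (norm (cr_grad m t))\<^sup>2) * card T)"
    by (intro mult_left_mono sum_squared_le_sum_of_squares) auto
  finally show ?thesis by (simp add: mult_ac)
qed

end

section \<open>The hierarchy of levels\<close>

text \<open>The mean over the edge from \<open>p\<close> to \<open>q\<close> of a function that is linear on each of the \<open>2 ^ n\<close>
  equal parts of the edge.\<close>

primrec edge_mean :: "(real^2 \<Rightarrow> real) \<Rightarrow> nat \<Rightarrow> real^2 \<Rightarrow> real^2 \<Rightarrow> real" where
  "edge_mean u 0 p q = (u p + u q) / 2"
| "edge_mean u (Suc n) p q = (edge_mean u n p (midpoint p q) + edge_mean u n (midpoint p q) q) / 2"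

lemma edge_mean_commute: "edge_mean u n p q = edge_mean u n q p"
proof (induction n arbitrary: p q)
  case (Suc n)
  show ?case using Suc[of p "midpoint p q"] Suc[of "midpoint p q" q] by (simp add: midpoint_sym)
qed simp

lemma edge_mean_eq_0: "(\<And>x. x \<in> closed_segment p q \<Longrightarrow> u x = 0) \<Longrightarrow> edge_mean u n p q = 0"
proof (induction n arbitrary: p q)
  case (Suc n)
  have m: "midpoint p q \<in> closed_segment p q" by simp
  have "edge_mean u n p (midpoint p q) = 0" "edge_mean u n (midpoint p q) q = 0"
    using Suc.prems subset_closed_segment[of p "midpoint p q" p q] subset_closed_segment[of "midpoint p q" q p q] m
    by (auto intro!: Suc.IH)
  then show ?case by simp
qed simp

lemma mesh_1: "mesh T 1 = T" and mesh_Suc: "1 \<le> k \<Longrightarrow> mesh T (Suc k) = refine (mesh T k)"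
proof -
  show "mesh T 1 = T" by (simp add: mesh_def)
  assume "1 \<le> k"
  then obtain j where "k = Suc j" by (cases k) auto
  then show "mesh T (Suc k) = refine (mesh T k)" by (simp add: mesh_def)
qed

lemmas mesh_Suc_0 = mesh_1[unfolded One_nat_def]

lemma triangulated_mesh:
  assumes "triangulated \<Omega> T" "1 \<le> k"
  shows "triangulated \<Omega> (mesh T k)"
  using assms(2)
proof (induction k rule: dec_induct)
  case base
  then show ?case using assms(1) mesh_1 by simp
next
  case (step k)
  then show ?case using mesh_Suc triangulated.triangulated_refine by metis
qed

text \<open>Up to translation, scaling and point reflection only the shapes of \<open>T1\<close>
  occur, so bounds for all levels can be computed on \<open>T1\<close>. The scale is 1 on level
  1.\<close>

lemma mesh_similar:
  assumes "triangulated \<Omega> T" "1 \<le> k" "s \<in> mesh T k"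
  shows "\<exists>t\<in>T. \<exists>z e. \<bar>e\<bar> = 2 / 2 ^ k \<and> s = (\<lambda>x. z + e *\<^sub>R x) ` t"
  using assms(2,3)
proof (induction k arbitrary: s rule: dec_induct)
  case base
  then have "s \<in> T" "s = (\<lambda>x. 0 + 1 *\<^sub>R x) ` s" using mesh_1 by auto
  then show ?case by (intro bexI[of _ s] exI[of _ 0] exI[of _ 1]) auto
next
  case (step k)
  then obtain s' where s': "s' \<in> mesh T k" "s \<in> divide s'" using mesh_Suc unfolding refine_def by auto
  then obtain t z e where t: "t \<in> T" "\<bar>e\<bar> = 2 / 2 ^ k" "s' = (\<lambda>x. z + e *\<^sub>R x) ` t" using step.IH by blast
  have "triangle s'" using triangulated.triangle_T[OF triangulated_mesh[OF assms(1) step.hyps(1)] s'(1)] .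
  then obtain z' e' where e': "\<bar>e'\<bar> = 1/2" "s = (\<lambda>x. z' + e' *\<^sub>R x) ` s'"
    using divide_affine_image[OF _ s'(2)] by metis
  have "s = (\<lambda>x. (z' + e' *\<^sub>R z) + (e' * e) *\<^sub>R x) ` t"
    unfolding e'(2) t(3) image_image by (simp add: scaleR_add_right add.assoc)
  moreover have "\<bar>e' * e\<bar> = 2 / 2 ^ Suc k" using t e' by (simp add: abs_mult)
  ultimately show ?case using t(1) by blast
qed

lemma mesh_valence:
  assumes T: "triangulated \<Omega> T" and "1 \<le> k"
  shows "(\<forall>p. card {t \<in> mesh T k. p \<in> t} \<le> 4 * max 4 (card T)) \<and>
    (\<forall>p q. p \<noteq> q \<longrightarrow> card {t \<in> mesh T k. p \<in> t \<and> q \<in> t} \<le> max 4 (card T))"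
  using assms(2)
proof (induction k rule: dec_induct)
  case base
  have 1: "card {t \<in> T. P t} \<le> max 4 (card T)" for P
    using card_mono[OF triangulated.finite_T[OF T], of "{t \<in> T. P t}"] by auto
  have 2: "card {t \<in> T. P t} \<le> 4 * max 4 (card T)" for P using 1[of P] by linarith
  show ?case unfolding mesh_1 by (intro conjI allI impI 1 2)
next
  case (step k)
  interpret triangulated \<Omega> "mesh T k" by (rule triangulated_mesh[OF T step.hyps(1)])
  show ?case unfolding mesh_Suc[OF step.hyps(1)]
    using valence_refine[of "max 4 (card T)"] step.IH by simp
qed

text \<open>\<open>u\<close> stands for the finite element function extended by zero, which makes
  its means over boundary edges vanish; \<open>J\<close> is the finest level and \<open>H\<close>
  bounds the diameters on level 1.\<close>

locale multilevel =
  fixes \<Omega> :: "(real^2) set" and T1 :: "(real^2) set set" and u :: "real^2 \<Rightarrow> real" and J :: nat and H :: real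
  assumes T1: "triangulated \<Omega> T1"
    and u_outside: "\<And>x. x \<notin> \<Omega> \<Longrightarrow> u x = 0"
    and J: "1 \<le> J"
    and H: "\<And>t x y. t \<in> T1 \<Longrightarrow> x \<in> convex hull t \<Longrightarrow> y \<in> convex hull t \<Longrightarrow> dist x y \<le> H"
begin

abbreviation "M k \<equiv> mesh T1 k"
text \<open>An edge of level \<open>k\<close> consists of \<open>2 ^ (J - k)\<close> edges of the
  finest level, so for a function linear on these it is the exact mean.\<close>

definition "m k = edge_mean u (J - k)"
definition "N = 4 * max 4 (card T1)"
abbreviation "G k \<equiv> cr_grad (m k)"
definition "U k = nodal_value \<Omega> (M k) (m k)"
text \<open>The powers of 4 turn sums over triangles into sums weighted by the areas.\<close>

definition "E k = (\<Sum>t\<in>M k. (norm (G k t))\<^sup>2) / 4 ^ k"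
definition "X k = jumps \<Omega> (M k) (G k) / 4 ^ k"
definition "Y k = child_defect (M k) (G k) (G (Suc k)) / 4 ^ Suc k"
text \<open>No power of 4 here: in the plane a plain sum of squared nodal values already scales like
  a squared gradient norm.\<close>

definition "err k = (\<Sum>t\<in>M k. \<Sum>p\<in>t. (cr (m k) t p - U k p)\<^sup>2)"
definition "hat k p = (SOME f. hat_on (M k) p f)"
text \<open>The companion as a function. The value zero for the absent level 0 lets the telescoping
  sum start with the coarsest companion itself.\<close>

definition "F k x = (if k = 0 then 0 else \<Sum>p\<in>nodes \<Omega> (M k). U k p * hat k p x)"

section \<open>Energy and jumps over the levels\<close>

lemma tri: "1 \<le> k \<Longrightarrow> triangulated \<Omega> (M k)"
  by (rule triangulated_mesh[OF T1])

lemma m_sym: "m k p q = m k q p"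
  unfolding m_def by (rule edge_mean_commute)

lemma m_step: "k < J \<Longrightarrow> m k p q = (m (Suc k) p (midpoint p q) + m (Suc k) (midpoint p q) q) / 2"
  unfolding m_def by (subst Suc_diff_Suc[symmetric]) auto

lemma m_boundary:
  assumes "1 \<le> k" "(t, p, q) \<in> boundary_edges \<Omega> (M k)"
  shows "m k p q = 0"
  using triangulated.boundary_edge_disjoint[OF tri[OF assms(1)], of t p q] assms(2) u_outside
  unfolding boundary_edges_def m_def by (intro edge_mean_eq_0) auto

lemma H_level:
  assumes "1 \<le> k" "t \<in> M k" "x \<in> convex hull t" "y \<in> convex hull t"
  shows "dist x y \<le> 2 * H / 2 ^ k"
proof -
  obtain t1 z e where t: "t1 \<in> T1" "\<bar>e\<bar> = 2 / 2 ^ k" "t = (\<lambda>x. z + e *\<^sub>R x) ` t1"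
    using mesh_similar[OF T1 assms(1,2)] by blast
  then have "convex hull t = (\<lambda>x. z + e *\<^sub>R x) ` (convex hull t1)" by (simp only: convex_hull_affinity)
  then obtain x' y' where xy: "x' \<in> convex hull t1" "y' \<in> convex hull t1" "x = z + e *\<^sub>R x'" "y = z + e *\<^sub>R y'"
    using assms(3,4) by blast
  have "dist x y = \<bar>e\<bar> * dist x' y'" unfolding xy by (simp add: dist_norm scaleR_diff_right[symmetric])
  also have "\<dots> \<le> \<bar>e\<bar> * H" using H[OF t(1) xy(1,2)] by (intro mult_left_mono) auto
  finally show ?thesis using t(2) by simp
qed

lemma N_level: "1 \<le> k \<Longrightarrow> card {t \<in> M k. p \<in> t} \<le> N"
  using mesh_valence[OF T1, of k] unfolding N_def by blast

lemma nonneg: "0 \<le> E k" "0 \<le> X k" "0 \<le> Y k" "0 \<le> err k"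
  unfolding E_def X_def Y_def err_def jumps_def child_defect_def
  by (auto intro!: sum_nonneg divide_nonneg_nonneg add_nonneg_nonneg)

text \<open>Pythagoras on every parent; its factor 4 is the one between \<open>4 ^ k\<close> and
  \<open>4 ^ Suc k\<close>.\<close>

lemma E_Suc:
  assumes "1 \<le> k" "k < J"
  shows "E (Suc k) = E k + Y k"
proof -
  interpret triangulated \<Omega> "M k" by (rule tri[OF assms(1)])
  have "(\<Sum>s\<in>M (Suc k). (norm (G (Suc k) s))\<^sup>2) = (\<Sum>t\<in>M k. \<Sum>s\<in>divide t. (norm (G (Suc k) s))\<^sup>2)"
    unfolding mesh_Suc[OF assms(1)] by (rule sum_refine)
  also have "\<dots> = (\<Sum>t\<in>M k. 4 * (norm (G k t))\<^sup>2 + (\<Sum>s\<in>divide t. (norm (G (Suc k) s - G k t))\<^sup>2))"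
    by (intro sum.cong refl cr_grad_pythagoras triangle_T m_sym m_step assms)
  finally show ?thesis unfolding E_def Y_def child_defect_def
    by (simp add: sum.distrib sum_distrib_left[symmetric] add_divide_distrib)
qed

lemma E_sum: "1 \<le> k \<Longrightarrow> k \<le> J \<Longrightarrow> E 1 + (\<Sum>j=1..<k. Y j) = E k"
proof (induction k rule: dec_induct)
  case (step k)
  then show ?case using E_Suc[of k] by simp
qed simp

lemma X_Suc:
  assumes "1 \<le> k" "k < J"
  shows "X (Suc k) \<le> (3/4) * X k + (70 + 72 * real N) * Y k"
proof -
  interpret triangulated \<Omega> "M k" by (rule tri[OF assms(1)])
  have "jumps \<Omega> (M (Suc k)) (G (Suc k)) \<le> 3 * jumps \<Omega> (M k) (G k) + (70 + 72 * real N) * child_defect (M k) (G k) (G (Suc k))"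
    unfolding mesh_Suc[OF assms(1)] by (rule jumps_refine[OF N_level[OF assms(1)]])
  then have "jumps \<Omega> (M (Suc k)) (G (Suc k)) / 4 ^ Suc k \<le>
      (3 * jumps \<Omega> (M k) (G k) + (70 + 72 * real N) * child_defect (M k) (G k) (G (Suc k))) / 4 ^ Suc k"
    by (rule divide_right_mono) simp
  then show ?thesis unfolding X_def Y_def by (simp add: add_divide_distrib)
qed

text \<open>A recursion of ratio 3/4 sums up with the factor 4. The extra \<open>3 * X k\<close> is
  what later levels may still inherit: the geometric series of 3/4 without its first term.\<close>

lemma X_sum:
  "1 \<le> k \<Longrightarrow> k \<le> J \<Longrightarrow> (\<Sum>j=1..k. X j) + 3 * X k \<le> 4 * X 1 + 4 * (70 + 72 * real N) * (\<Sum>j=1..<k. Y j)"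
proof (induction k rule: dec_induct)
  case (step k)
  then have "(\<Sum>j=1..k. X j) + 3 * X k \<le> 4 * X 1 + 4 * (70 + 72 * real N) * (\<Sum>j=1..<k. Y j)"
    "X (Suc k) \<le> (3/4) * X k + (70 + 72 * real N) * Y k" using X_Suc[of k] by auto
  then show ?case using step by (simp add: algebra_simps)
qed simp

lemma X_1: "X 1 \<le> (4 * real (card T1) + 9) * E 1"
  using triangulated.jumps_le[OF T1 order_refl, of "G 1"] unfolding X_def E_def mesh_1
  by (simp add: divide_right_mono)

text \<open>\<open>E 1\<close> and the martingale differences add up to \<open>E J\<close>, so both
  get the common constant with 36 + 280 = 316.\<close>

lemma X_total: "(\<Sum>k=1..J. X k) \<le> (16 * real (card T1) + 316 + 288 * real N) * E J"
proof -
  have "(\<Sum>j=1..J. X j) \<le> 4 * X 1 + 4 * (70 + 72 * real N) * (\<Sum>j=1..<J. Y j)"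
    using X_sum[OF J order_refl] nonneg(2)[of J] by linarith
  also have "\<dots> \<le> 4 * ((4 * real (card T1) + 9) * E 1) + 4 * (70 + 72 * real N) * (\<Sum>j=1..<J. Y j)"
    using X_1 by linarith
  also have "\<dots> \<le> (16 * real (card T1) + 316 + 288 * real N) * E 1 + (16 * real (card T1) + 316 + 288 * real N) * (\<Sum>j=1..<J. Y j)"
    unfolding mult.assoc[symmetric]
    by (intro add_mono mult_right_mono) (auto simp: nonneg intro!: sum_nonneg)
  also have "\<dots> = (16 * real (card T1) + 316 + 288 * real N) * E J"
    unfolding E_sum[OF J order_refl, symmetric] by (simp only: distrib_left)
  finally show ?thesis .
qed

lemma err_le:
  assumes "1 \<le> k"
  shows "err k \<le> 8 * real N * (2 * real N ^ 6 + 2) * H\<^sup>2 * X k"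
proof -
  interpret triangulated \<Omega> "M k" by (rule tri[OF assms])
  have "err k \<le> 2 * real N * (2 * real N ^ 6 + 2) * (2 * H / 2 ^ k)\<^sup>2 * jumps \<Omega> (M k) (G k)"
    unfolding err_def U_def
    by (intro nodal_value_error_sum m_sym H_level[OF assms] m_boundary[OF assms] N_level[OF assms])
  also have "(2 * H / 2 ^ k)\<^sup>2 = 4 * H\<^sup>2 / 4 ^ k"
    by (simp add: power_divide power_mult_distrib power_mult[symmetric] power2_eq_square flip: power_mult_distrib)
  finally show ?thesis unfolding X_def by simp
qed

section \<open>The companions as piecewise linear functions\<close>

lemma hat_on_hat: "1 \<le> k \<Longrightarrow> hat_on (M k) p (hat k p)"
  unfolding hat_def using hat_on_exists[OF triangulated.conforming[OF tri]] someI_ex by metis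

lemma finite_nodes: "1 \<le> k \<Longrightarrow> finite (nodes \<Omega> (M k))"
  unfolding nodes_def using triangulated.finite_vertices[OF tri] by blast

lemma aff_hat: "1 \<le> k \<Longrightarrow> t \<in> M k \<Longrightarrow> aff t (hat k p)"
  using hat_on_hat hat_on_aff by blast

lemma aff_F: "1 \<le> k \<Longrightarrow> t \<in> M k \<Longrightarrow> aff t (F k)"
  unfolding F_def[abs_def] by (simp add: aff_sum aff_cmult aff_hat)

lemma U_outside: "p \<notin> \<Omega> \<Longrightarrow> U k p = 0"
  unfolding U_def nodal_value_def by simp

lemma nodal_sum:
  assumes "1 \<le> k" "t \<in> M k" "q \<in> t"
  shows "(\<Sum>p\<in>nodes \<Omega> (M k). c p * hat k p q) = (if q \<in> \<Omega> then c q else 0)"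
proof -
  have "(\<Sum>p\<in>nodes \<Omega> (M k). c p * hat k p q) = (\<Sum>p\<in>nodes \<Omega> (M k). if q = p then c p else 0)"
    using hat_on_vertex[OF hat_on_hat[OF assms(1)] assms(3,2)] by (intro sum.cong) auto
  also have "\<dots> = (if q \<in> \<Omega> then c q else 0)"
    using finite_nodes[OF assms(1)] assms(2,3) by (simp add: nodes_def) blast
  finally show ?thesis .
qed

lemma F_vertex: "1 \<le> k \<Longrightarrow> t \<in> M k \<Longrightarrow> q \<in> t \<Longrightarrow> F k q = U k q"
  using nodal_sum[of k t q "U k"] U_outside by (simp add: F_def)

lemma F_midpoint: "1 \<le> k \<Longrightarrow> t \<in> M k \<Longrightarrow> p \<in> t \<Longrightarrow> q \<in> t \<Longrightarrow> F k (midpoint p q) = (U k p + U k q) / 2"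
  using aff_midpoint[OF aff_F] F_vertex by simp

text \<open>Hat functions are summed over interior nodes only, so the coarse companion must vanish
  at the boundary vertices of the finer mesh. Such a vertex is an old one or the midpoint of a
  boundary edge, whose end points are outside the domain too.\<close>

lemma F_outside:
  assumes k: "1 \<le> k" "s \<in> M (Suc k)" "q \<in> s" "q \<notin> \<Omega>"
  shows "F k q = 0"
proof -
  interpret triangulated \<Omega> "M k" by (rule tri[OF k(1)])
  obtain t where t: "t \<in> M k" "s \<in> divide t" using k mesh_Suc unfolding refine_def by auto
  obtain a b where ab: "a \<in> t" "b \<in> t" "q = midpoint a b" using divide_vertex[OF t(2) k(3)] by metis
  have "a \<notin> \<Omega> \<and> b \<notin> \<Omega>"
  proof (cases "a = b")
    case False
    then show ?thesis using boundary_edge_disjoint[OF t(1) ab(1,2)] ab(3) k(4) by auto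
  qed (use ab k in simp)
  then show ?thesis using F_midpoint[OF k(1) t(1) ab(1,2)] U_outside ab(3) by simp
qed

lemma aff_F_prev:
  assumes "1 \<le> k" "t \<in> M k"
  shows "aff t (F (k - 1))"
proof (cases "k = 1")
  case True
  then show ?thesis by (simp add: F_def[abs_def] aff_const)
next
  case False
  then obtain j where j: "k = Suc j" "1 \<le> j" using assms(1) by (cases k) auto
  then obtain t' where t': "t' \<in> M j" "t \<in> divide t'" using assms(2) mesh_Suc unfolding refine_def by auto
  show ?thesis using aff_divide[OF aff_F[OF j(2) t'(1)] t'(2)] j(1) by simp
qed

text \<open>Both sides are affine on the triangles of level \<open>k\<close>, so vertices suffice;
  at boundary vertices both companions vanish.\<close>

lemma F_diff_expansion:
  assumes k: "1 \<le> k" and x: "x \<in> closure \<Omega>"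
  shows "F k x - F (k - 1) x = (\<Sum>p\<in>nodes \<Omega> (M k). (F k p - F (k - 1) p) * hat k p x)"
proof -
  obtain t where t: "t \<in> M k" "x \<in> convex hull t" using triangulated.cover[OF tri[OF k]] x by blast
  show ?thesis
  proof (rule aff_eq[OF _ _ _ t(2)])
    show "aff t (\<lambda>x. F k x - F (k - 1) x)" using aff_F aff_F_prev k t by (intro aff_diff)
    show "aff t (\<lambda>x. \<Sum>p\<in>nodes \<Omega> (M k). (F k p - F (k - 1) p) * hat k p x)"
      using k t by (intro aff_sum aff_cmult aff_hat)
    fix q assume q: "q \<in> t"
    have "F k q - F (k - 1) q = 0" if "q \<notin> \<Omega>"
    proof -
      have "F (k - 1) q = 0"
      proof (cases "k = 1")
        case False
        then show ?thesis using F_outside[of "k - 1" t q] k t q that by simp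
      qed (simp add: F_def)
      then show ?thesis using F_vertex[OF k t(1) q] U_outside[OF that] by simp
    qed
    then show "F k q - F (k - 1) q = (\<Sum>p\<in>nodes \<Omega> (M k). (F k p - F (k - 1) p) * hat k p q)"
      using nodal_sum[OF k t(1) q, of "\<lambda>p. F k p - F (k - 1) p"] by simp
  qed
qed

lemma telescoping:
  assumes "x \<in> closure \<Omega>"
  shows "(\<Sum>k=1..J. \<Sum>p\<in>nodes \<Omega> (M k). (F k p - F (k - 1) p) * hat k p x) = F J x"
proof -
  have "(\<Sum>k=1..J. \<Sum>p\<in>nodes \<Omega> (M k). (F k p - F (k - 1) p) * hat k p x) = (\<Sum>k=1..J. F k x - F (k - 1) x)"
    using F_diff_expansion assms by (intro sum.cong) auto
  also have "\<dots> = F J x - F 0 x"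
  proof -
    have "(\<Sum>k=1..n. F k x - F (k - 1) x) = F n x - F 0 x" for n by (induction n) simp_all
    then show ?thesis .
  qed
  finally show ?thesis by (simp add: F_def)
qed

lemma cr_top: "t \<in> M J \<Longrightarrow> p \<in> t \<Longrightarrow> cr (m J) t p = u p"
  using triangulated.triangle_T[OF tri[OF J]] m_sym by (intro cr_linear_eq) (auto simp: m_def)

text \<open>On level \<open>J\<close> the edge means are averages of vertex values, so the
  interpolant takes the values of \<open>u\<close> at vertices, whichever triangle is
  selected.\<close>

lemma U_top:
  assumes "t \<in> M J" "p \<in> t"
  shows "U J p = u p"
proof (cases "p \<in> \<Omega>")
  case True
  let ?t = "SOME t. t \<in> M J \<and> p \<in> t"
  have "?t \<in> M J \<and> p \<in> ?t" by (rule someI[of _ t]) (use assms in simp)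
  then show ?thesis using cr_top True unfolding U_def nodal_value_def by simp
qed (use U_outside u_outside in simp)

text \<open>As \<open>F 0\<close> is zero there is no difference to exploit, and the Poincare
  inequality on the fixed coarsest mesh is used. The leading 4 undoes the weight in
  \<open>E 1\<close>.\<close>

lemma level_1:
  "(\<Sum>i\<in>nodes \<Omega> (M 1). (F 1 i - F 0 i)\<^sup>2) \<le>
    4 * real (card (\<Union>T1)) * (2 * real (card (adjacent T1)) + 2)\<^sup>2 * H\<^sup>2 * real (card T1) * E 1"
proof -
  interpret triangulated \<Omega> T1 by (rule T1)
  let ?P = "(2 * real (card (adjacent T1)) + 2)\<^sup>2 * H\<^sup>2 * real (card T1) * (\<Sum>t\<in>T1. (norm (G 1 t))\<^sup>2)"
  have "(F 1 i - F 0 i)\<^sup>2 \<le> ?P" if i: "i \<in> nodes \<Omega> (M 1)" for i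
  proof -
    obtain t where t: "t \<in> M 1" "i \<in> t" using i unfolding nodes_def by auto
    have "F 1 i - F 0 i = nodal_value \<Omega> T1 (m 1) i"
      using F_vertex[OF _ t] unfolding U_def mesh_1 by (simp add: F_def[of 0])
    moreover have "(nodal_value \<Omega> T1 (m 1) i)\<^sup>2 \<le> ?P"
      by (rule nodal_value_poincare[OF m_sym H m_boundary[of 1, unfolded mesh_1]])
        (use t in \<open>auto simp: mesh_Suc_0\<close>)
    ultimately show ?thesis by simp
  qed
  then have "(\<Sum>i\<in>nodes \<Omega> (M 1). (F 1 i - F 0 i)\<^sup>2) \<le> card (nodes \<Omega> (M 1)) * ?P"
    by (rule sum_bounded_above)
  also have "\<dots> \<le> real (card (\<Union>T1)) * ?P"
    using card_mono[OF finite_vertices, of "nodes \<Omega> T1"] unfolding mesh_1 nodes_def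
    by (intro mult_right_mono mult_nonneg_nonneg sum_nonneg) auto
  finally show ?thesis unfolding E_def mesh_1 by simp
qed

text \<open>At a fine vertex the increment splits into the companion error of the fine level, the
  difference of the interpolants on child and parent, and the companion error of the coarse level. A
  square of three terms costs 3, and the children of a triangle have 12 vertices in all: 36 is 12
  times 3, and 36864 is 36 times 64 times the 16 from the mesh size.\<close>

lemma level_Suc:
  assumes k: "1 \<le> k" "k < J"
  shows "(\<Sum>i\<in>nodes \<Omega> (M (Suc k)). (F (Suc k) i - F k i)\<^sup>2) \<le>
    3 * err (Suc k) + 36 * err k + 36864 * H\<^sup>2 * Y k"
proof -
  interpret triangulated \<Omega> "M k" by (rule tri[OF k(1)])
  let ?h = "2 * H / 2 ^ k"
  let ?D = "\<lambda>t. \<Sum>s\<in>divide t. (norm (G (Suc k) s - G k t))\<^sup>2"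
  let ?e = "\<lambda>t. \<Sum>p\<in>t. (cr (m k) t p - U k p)\<^sup>2"
  have fd: "finite (divide t)" if "t \<in> M k" for t using finite_divide finite_t that by blast
  have fs: "finite s" if "t \<in> M k" "s \<in> divide t" for s t
    using that triangle_divide[OF triangle_T] triangle_finite by blast
  have cs: "card s = 3" if "t \<in> M k" "s \<in> divide t" for s t
    using that triangle_divide[OF triangle_T] unfolding triangle_def by blast
  let ?I = "SIGMA t:M k. SIGMA s:divide t. s"
  have fI: "finite ?I" using finite_T fd fs by (intro finite_SigmaI) auto
  have "nodes \<Omega> (M (Suc k)) \<subseteq> (\<lambda>(t, s, i). i) ` ?I"
  proof
    fix i assume "i \<in> nodes \<Omega> (M (Suc k))"
    then obtain t s where "t \<in> M k" "s \<in> divide t" "i \<in> s"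
      unfolding nodes_def mesh_Suc[OF k(1)] refine_def by blast
    then have "(t, s, i) \<in> ?I" by simp
    then show "i \<in> (\<lambda>(t, s, i). i) ` ?I" by force
  qed
  then have "(\<Sum>i\<in>nodes \<Omega> (M (Suc k)). (F (Suc k) i - F k i)\<^sup>2) \<le>
      (\<Sum>x\<in>?I. (F (Suc k) ((\<lambda>(t, s, i). i) x) - F k ((\<lambda>(t, s, i). i) x))\<^sup>2)"
    by (rule sum_image_bound[OF fI]) simp
  also have "\<dots> = (\<Sum>t\<in>M k. \<Sum>x\<in>(SIGMA s:divide t. s). (F (Suc k) (snd x) - F k (snd x))\<^sup>2)"
    using finite_T fd fs by (subst sum.Sigma) (auto intro!: sum.cong finite_SigmaI)
  also have "\<dots> = (\<Sum>t\<in>M k. \<Sum>s\<in>divide t. \<Sum>i\<in>s. (F (Suc k) i - F k i)\<^sup>2)"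
    using fd fs by (intro sum.cong refl, subst sum.Sigma) (auto intro!: sum.cong)
  also have "\<dots> \<le> (\<Sum>t\<in>M k. \<Sum>s\<in>divide t. \<Sum>i\<in>s. 3 * (cr (m (Suc k)) s i - U (Suc k) i)\<^sup>2 +
      (3 * (64 * ?h\<^sup>2 * ?D t) + 3 * ?e t))"
  proof (intro sum_mono)
    fix t s i assume t: "t \<in> M k" and s: "s \<in> divide t" and i: "i \<in> s"
    obtain a b where ab: "a \<in> t" "b \<in> t" "i = midpoint a b" using divide_vertex[OF s i] by metis
    have sM: "s \<in> M (Suc k)" using t s mesh_Suc[OF k(1)] unfolding refine_def by auto
    define x where "x = U (Suc k) i - cr (m (Suc k)) s i"
    define y where "y = cr (m (Suc k)) s i - cr (m k) t i"
    define z where "z = ((cr (m k) t a - U k a) + (cr (m k) t b - U k b)) / 2"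
    \<comment> \<open>A fine vertex is a midpoint of coarse vertices, where the coarse interpolant
      and the coarse companion are both averages.\<close>
    have "cr (m k) t i = (cr (m k) t a + cr (m k) t b) / 2"
      unfolding ab(3) cr_def midpoint_def by (simp add: inner_add_right field_simps)
    then have "F (Suc k) i - F k i = x + y + z"
      using F_vertex[OF _ sM i] F_midpoint[OF k(1) t ab(1,2)] ab(3)
      unfolding x_def y_def z_def by (simp add: field_simps)
    then have "(F (Suc k) i - F k i)\<^sup>2 = (x + y + z)\<^sup>2" by simp
    moreover have "(x + y + z)\<^sup>2 \<le> 3 * x\<^sup>2 + 3 * y\<^sup>2 + 3 * z\<^sup>2"
      using zero_le_power2[of "x - y"] zero_le_power2[of "x - z"] zero_le_power2[of "y - z"]
      by (simp add: power2_eq_square algebra_simps)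
    \<comment> \<open>The 64 is the square of the 4 in \<open>cr_child_diff\<close>, times 4
      children from Cauchy-Schwarz.\<close>
    moreover have "y\<^sup>2 \<le> 64 * ?h\<^sup>2 * ?D t"
    proof -
      have "\<bar>y\<bar> \<le> 4 * ?h * (\<Sum>s\<in>divide t. norm (G (Suc k) s - G k t))"
        unfolding y_def
        by (intro cr_child_diff triangle_T[OF t] m_sym m_step[OF k(2)] H_level[OF k(1) t] s i)
      then have "y\<^sup>2 \<le> (4 * ?h * (\<Sum>s\<in>divide t. norm (G (Suc k) s - G k t)))\<^sup>2"
        by (rule abs_le_square_iff[THEN iffD1, OF order_trans[OF _ abs_ge_self]])
      also have "\<dots> = 16 * ?h\<^sup>2 * (\<Sum>s\<in>divide t. norm (G (Suc k) s - G k t))\<^sup>2"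
        by (simp only: power_mult_distrib) simp
      also have "\<dots> \<le> 16 * ?h\<^sup>2 * (?D t * card (divide t))"
        by (intro mult_left_mono sum_squared_le_sum_of_squares) simp
      finally show ?thesis using card_divide[OF triangle_T[OF t]] by simp
    qed
    moreover have "z\<^sup>2 \<le> ?e t"
    proof -
      let ?a = "cr (m k) t a - U k a" and ?b = "cr (m k) t b - U k b"
      have "?a\<^sup>2 \<le> ?e t" "?b\<^sup>2 \<le> ?e t"
        using member_le_sum[of a t "\<lambda>p. (cr (m k) t p - U k p)\<^sup>2"]
          member_le_sum[of b t "\<lambda>p. (cr (m k) t p - U k p)\<^sup>2"] ab finite_t[OF t] by auto
      moreover have "z\<^sup>2 \<le> (?a\<^sup>2 + ?b\<^sup>2) / 2"
        using zero_le_power2[of "?a - ?b"] unfolding z_def by (simp add: power2_eq_square field_simps)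
      moreover have "(v + w) / 2 \<le> s" if "v \<le> s" "w \<le> s" for v w s :: real using that by simp
      ultimately show ?thesis by (meson order_trans)
    qed
    moreover have "x\<^sup>2 = (cr (m (Suc k)) s i - U (Suc k) i)\<^sup>2" unfolding x_def by (rule power2_commute)
    ultimately show "(F (Suc k) i - F k i)\<^sup>2 \<le> 3 * (cr (m (Suc k)) s i - U (Suc k) i)\<^sup>2 +
        (3 * (64 * ?h\<^sup>2 * ?D t) + 3 * ?e t)" by linarith
  qed
  also have "\<dots> = (\<Sum>t\<in>M k. (\<Sum>s\<in>divide t. \<Sum>i\<in>s. 3 * (cr (m (Suc k)) s i - U (Suc k) i)\<^sup>2) +
      12 * (3 * (64 * ?h\<^sup>2 * ?D t) + 3 * ?e t))"
  proof (intro sum.cong refl)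
    fix t assume t: "t \<in> M k"
    have "(\<Sum>s\<in>divide t. \<Sum>i\<in>s. f s i + c) = (\<Sum>s\<in>divide t. \<Sum>i\<in>s. f s i) + 12 * c"
      for f :: "(real^2) set \<Rightarrow> real^2 \<Rightarrow> real" and c
      using cs[OF t] card_divide[OF triangle_T[OF t]] by (simp add: sum.distrib)
    then show "(\<Sum>s\<in>divide t. \<Sum>i\<in>s. 3 * (cr (m (Suc k)) s i - U (Suc k) i)\<^sup>2 +
      (3 * (64 * ?h\<^sup>2 * ?D t) + 3 * ?e t)) = (\<Sum>s\<in>divide t. \<Sum>i\<in>s. 3 * (cr (m (Suc k)) s i - U (Suc k) i)\<^sup>2) +
      12 * (3 * (64 * ?h\<^sup>2 * ?D t) + 3 * ?e t)" .
  qed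
  also have "\<dots> = 3 * err (Suc k) + 2304 * ?h\<^sup>2 * child_defect (M k) (G k) (G (Suc k)) + 36 * err k"
    unfolding err_def child_defect_def mesh_Suc[OF k(1)] sum_refine
    by (simp add: sum.distrib sum_distrib_left[symmetric] algebra_simps)
  also have "?h\<^sup>2 = 16 * H\<^sup>2 / 4 ^ Suc k"
    by (simp add: power_divide power_mult_distrib power_mult[symmetric] power2_eq_square flip: power_mult_distrib)
  finally show ?thesis unfolding Y_def by simp
qed

text \<open>Built from \<open>T1\<close> and \<open>H\<close> alone, so that it can be fixed before
  the function and the number of levels.\<close>

definition "bound = 4 * real (card (\<Union>T1)) * (2 * real (card (adjacent T1)) + 2)\<^sup>2 * H\<^sup>2 * real (card T1) +
  (39 * (8 * real N * (2 * real N ^ 6 + 2) * H\<^sup>2) * (16 * real (card T1) + 316 + 288 * real N) + 36864 * H\<^sup>2)"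

theorem coefficient_bound:
  "(\<Sum>k=1..J. \<Sum>i\<in>nodes \<Omega> (M k). (F k i - F (k - 1) i)\<^sup>2) \<le> bound * E J"
proof -
  let ?A = "\<lambda>k. \<Sum>i\<in>nodes \<Omega> (M k). (F k i - F (k - 1) i)\<^sup>2"
  define c where "c = 8 * real N * (2 * real N ^ 6 + 2) * H\<^sup>2"
  define d where "d = 36864 * H\<^sup>2"
  define K where "K = 16 * real (card T1) + 316 + 288 * real N"
  define B where "B = 4 * real (card (\<Union>T1)) * (2 * real (card (adjacent T1)) + 2)\<^sup>2 * H\<^sup>2 * real (card T1)"
  have c0: "0 \<le> c" "0 \<le> d" "0 \<le> B" by (simp_all add: c_def d_def B_def)
  have E1: "E 1 \<le> E J" and YJ: "(\<Sum>k=1..<J. Y k) \<le> E J"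
    using E_sum[OF J order_refl] nonneg(1)[of 1] sum_nonneg[of "{1..<J}" Y] nonneg(3) by auto
  have "(\<Sum>k=1..J. ?A k) = ?A 1 + (\<Sum>k=Suc 1..J. ?A k)" using J by (rule sum.atLeast_Suc_atMost)
  also have "(\<Sum>k=Suc 1..J. ?A k) = (\<Sum>k=1..<J. ?A (Suc k))"
    by (rule sum.reindex_bij_witness[of _ Suc "\<lambda>k. k - 1"]) auto
  \<comment> \<open>An \<open>X k\<close> enters once as fine level with factor 3 and once as coarse
    level with factor 36, which makes the 39 below.\<close>
  also have "\<dots> \<le> (\<Sum>k=1..<J. c * (3 * X (Suc k)) + c * (36 * X k) + d * Y k)"
  proof (rule sum_mono)
    fix k assume k: "k \<in> {1..<J}"
    then show "?A (Suc k) \<le> c * (3 * X (Suc k)) + c * (36 * X k) + d * Y k"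
      using level_Suc[of k] err_le[of k] err_le[of "Suc k"]
      unfolding c_def[symmetric] d_def[symmetric] by simp
  qed
  also have "\<dots> = c * (3 * (\<Sum>k=1..<J. X (Suc k)) + 36 * (\<Sum>k=1..<J. X k)) + d * (\<Sum>k=1..<J. Y k)"
    by (simp add: sum.distrib sum_distrib_left distrib_left)
  also have "\<dots> \<le> c * (39 * (\<Sum>k=1..J. X k)) + d * (\<Sum>k=1..<J. Y k)"
  proof -
    have "(\<Sum>k=1..<J. X (Suc k)) = (\<Sum>k=Suc 1..J. X k)"
      by (rule sum.reindex_bij_witness[of _ "\<lambda>k. k - 1" Suc]) auto
    also have "\<dots> \<le> (\<Sum>k=1..J. X k)" by (intro sum_mono2) (auto simp: nonneg)
    finally have "(\<Sum>k=1..<J. X (Suc k)) \<le> (\<Sum>k=1..J. X k)" .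
    moreover have "(\<Sum>k=1..<J. X k) \<le> (\<Sum>k=1..J. X k)" by (intro sum_mono2) (auto simp: nonneg)
    ultimately show ?thesis by (intro add_right_mono mult_left_mono c0) linarith
  qed
  also have "\<dots> \<le> c * (39 * (K * E J)) + d * E J"
    by (intro add_mono mult_left_mono X_total[folded K_def] YJ c0) auto
  also have "?A 1 \<le> B * E J"
    using level_1 mult_left_mono[OF E1 c0(3)] unfolding B_def[symmetric] by simp
  finally have "(\<Sum>k=1..J. ?A k) \<le> B * E J + (c * (39 * (K * E J)) + d * E J)" by simp
  moreover have "bound = B + (39 * c * K + d)"
    unfolding bound_def B_def c_def d_def K_def ..
  ultimately show ?thesis by (simp add: algebra_simps)
qed

end

section \<open>Boundary values in the Sobolev space\<close>

lemma has_derivative_grad: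
  assumes "f differentiable (at x)"
  shows "(f has_derivative (\<lambda>h. grad f x \<bullet> h)) (at x)"
proof -
  let ?D = "frechet_derivative f (at x)"
  have D: "(f has_derivative ?D) (at x)" using assms by (simp add: frechet_derivative_works)
  then have lin: "linear ?D" by (simp add: has_derivative_linear)
  have "?D h = grad f x \<bullet> h" for h
  proof -
    have "?D h = ?D (\<Sum>i\<in>UNIV. (h $ i) *\<^sub>R axis i 1)"
      using basis_expansion[of h] by (simp add: scalar_mult_eq_scaleR)
    also have "\<dots> = (\<Sum>i\<in>UNIV. (h $ i) * ?D (axis i 1))" using lin by (simp add: linear_sum linear_scale)
    also have "\<dots> = grad f x \<bullet> h" by (simp add: grad_def inner_vec_def mult.commute)
    finally show ?thesis .
  qed
  then have "?D = (\<lambda>h. grad f x \<bullet> h)" by (rule ext)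
  with D show ?thesis by simp
qed

lemma has_derivative_imp_grad:
  assumes "(f has_derivative (\<lambda>h. g \<bullet> h)) (at x)"
  shows "grad f x = g"
proof -
  have "(f has_derivative frechet_derivative f (at x)) (at x)"
    using assms by (metis differentiableI frechet_derivative_works)
  then have "frechet_derivative f (at x) = (\<lambda>h. g \<bullet> h)" using assms by (rule has_derivative_unique)
  then show ?thesis by (simp add: grad_def vec_eq_iff inner_axis)
qed

section \<open>Translation estimate for smooth functions\<close>

lemma square_integral_le_integral_square:
  fixes a :: "real \<Rightarrow> real"
  assumes "continuous_on {0..1} a"
  shows "(LINT t:{0..1}|lborel. a t)\<^sup>2 \<le> (LINT t:{0..1}|lborel. (a t)\<^sup>2)"
proof -
  let ?I = "LINT t:{0..1}|lborel. a t"
  have int: "set_integrable lborel {0..1} a" "set_integrable lborel {0..1} (\<lambda>t. (a t)\<^sup>2)"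
    "set_integrable lborel {0..1} (\<lambda>t. 2 * ?I * a t)" "set_integrable lborel {0..1::real} (\<lambda>t. ?I\<^sup>2)"
    by (intro borel_integrable_atLeastAtMost' continuous_intros assms)+
  have "0 \<le> (LINT t:{0..1}|lborel. (a t - ?I)\<^sup>2)"
    unfolding set_lebesgue_integral_def by (intro integral_nonneg_AE) (auto intro!: AE_I2)
  also have "(LINT t:{0..1}|lborel. (a t - ?I)\<^sup>2) = (LINT t:{0..1}|lborel. ((a t)\<^sup>2 - 2 * ?I * a t) + ?I\<^sup>2)"
    by (simp add: power2_eq_square algebra_simps)
  also have "\<dots> = (LINT t:{0..1}|lborel. (a t)\<^sup>2) - 2 * ?I * ?I + ?I\<^sup>2"
  proof -
    have "(LINT t:{0..1::real}|lborel. ?I\<^sup>2) = ?I\<^sup>2" by (simp add: set_lebesgue_integral_def)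
    moreover have "(LINT t:{0..1}|lborel. 2 * ?I * a t) = 2 * ?I * ?I" by (rule set_integral_mult_right)
    ultimately show ?thesis
      using set_integral_add(2)[OF set_integral_diff(1)[OF int(2,3)] int(4)] set_integral_diff(2)[OF int(2,3)]
      by simp
  qed
  finally show ?thesis by (simp add: power2_eq_square)
qed

text \<open>The fundamental theorem of calculus along the segment from the zero \<open>x\<close> to
  \<open>x + p\<close>, followed by Cauchy-Schwarz. The form in \<open>ennreal\<close> prepares the
  exchange of integrals.\<close>

lemma shift_pointwise:
  fixes f :: "real^2 \<Rightarrow> real"
  assumes d: "\<And>x. f differentiable (at x)" and c: "continuous_on UNIV (grad f)" and 0: "f x = 0"
  shows "ennreal ((f (x + p))\<^sup>2) \<le>
    ennreal ((norm p)\<^sup>2) * (\<integral>\<^sup>+t. indicator {0..1} t * ennreal ((norm (grad f (x + t *\<^sub>R p)))\<^sup>2) \<partial>lborel)"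
proof -
  let ?a = "\<lambda>t. grad f (x + t *\<^sub>R p) \<bullet> p"
  have cg: "continuous_on S (\<lambda>t. grad f (x + t *\<^sub>R p))" for S
    by (rule continuous_on_compose2[OF c]) (auto intro!: continuous_intros)
  have ca: "continuous_on {0..1} ?a" by (intro continuous_intros cg)
  have "((\<lambda>t. f (x + t *\<^sub>R p)) has_vector_derivative ?a t) (at t within {0..1})" for t
  proof -
    have "((\<lambda>t. x + t *\<^sub>R p) has_derivative (\<lambda>h. h *\<^sub>R p)) (at t within {0..1})"
      by (auto intro!: derivative_eq_intros)
    from has_derivative_compose[OF this has_derivative_grad[OF d]]
    show ?thesis by (simp add: has_vector_derivative_def mult.commute)
  qed
  then have "(LINT t:{0..1}|lborel. ?a t) = f (x + 1 *\<^sub>R p) - f (x + 0 *\<^sub>R p)"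
    unfolding set_lebesgue_integral_def by (intro integral_FTC_atLeastAtMost ca) auto
  then have "(f (x + p))\<^sup>2 \<le> (LINT t:{0..1}|lborel. (?a t)\<^sup>2)"
    using square_integral_le_integral_square[OF ca] 0 by simp
  also have "\<dots> \<le> (LINT t:{0..1}|lborel. (norm p)\<^sup>2 * (norm (grad f (x + t *\<^sub>R p)))\<^sup>2)"
  proof (rule set_integral_mono)
    fix t
    have "\<bar>?a t\<bar> \<le> norm p * norm (grad f (x + t *\<^sub>R p))"
      using Cauchy_Schwarz_ineq2[of "grad f (x + t *\<^sub>R p)" p] by (simp add: mult.commute)
    then have "\<bar>?a t\<bar>\<^sup>2 \<le> (norm p * norm (grad f (x + t *\<^sub>R p)))\<^sup>2" by (rule power_mono) simp
    then show "(?a t)\<^sup>2 \<le> (norm p)\<^sup>2 * (norm (grad f (x + t *\<^sub>R p)))\<^sup>2" by (simp add: power_mult_distrib)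
  qed (intro borel_integrable_atLeastAtMost' continuous_intros cg)+
  finally have 1: "(f (x + p))\<^sup>2 \<le> (norm p)\<^sup>2 * (LINT t:{0..1}|lborel. (norm (grad f (x + t *\<^sub>R p)))\<^sup>2)"
    by simp
  have "ennreal (LINT t:{0..1}|lborel. (norm (grad f (x + t *\<^sub>R p)))\<^sup>2) =
     (\<integral>\<^sup>+t. ennreal (indicator {0..1} t * (norm (grad f (x + t *\<^sub>R p)))\<^sup>2) \<partial>lborel)"
  proof -
    have "continuous_on {0..1} (\<lambda>t. (norm (grad f (x + t *\<^sub>R p)))\<^sup>2)" by (intro continuous_intros cg)
    then have "integrable lborel (\<lambda>t. indicator {0..1} t * (norm (grad f (x + t *\<^sub>R p)))\<^sup>2)"
      using borel_integrable_atLeastAtMost'[of 0 1 "\<lambda>t. (norm (grad f (x + t *\<^sub>R p)))\<^sup>2"]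
      by (simp add: set_integrable_def)
    then show ?thesis unfolding set_lebesgue_integral_def by (subst nn_integral_eq_integral) auto
  qed
  also have "\<dots> = (\<integral>\<^sup>+t. indicator {0..1} t * ennreal ((norm (grad f (x + t *\<^sub>R p)))\<^sup>2) \<partial>lborel)"
    by (intro nn_integral_cong) (auto simp: indicator_def)
  finally have 2: "ennreal (LINT t:{0..1}|lborel. (norm (grad f (x + t *\<^sub>R p)))\<^sup>2) = \<dots>" .
  have "ennreal ((f (x + p))\<^sup>2) \<le> ennreal ((norm p)\<^sup>2 * (LINT t:{0..1}|lborel. (norm (grad f (x + t *\<^sub>R p)))\<^sup>2))"
    using 1 by (rule ennreal_leI)
  also have "\<dots> = ennreal ((norm p)\<^sup>2) * ennreal (LINT t:{0..1}|lborel. (norm (grad f (x + t *\<^sub>R p)))\<^sup>2)"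
    by (rule ennreal_mult'') (auto simp: set_lebesgue_integral_def intro!: integral_nonneg_AE AE_I2)
  finally show ?thesis unfolding 2 .
qed

lemma nn_integral_lborel_shift:
  assumes "g \<in> borel_measurable borel"
  shows "(\<integral>\<^sup>+x. g (x + a) \<partial>lborel) = (\<integral>\<^sup>+x. g x \<partial>(lborel :: (real^2) measure))"
proof -
  have "(\<integral>\<^sup>+x. g x \<partial>lborel) = (\<integral>\<^sup>+x. g x \<partial>distr lborel borel ((+) a))"
    by (simp add: lborel_distr_plus)
  also have "\<dots> = (\<integral>\<^sup>+x. g (a + x) \<partial>lborel)"
    using assms by (intro nn_integral_distr) auto
  finally show ?thesis by (simp add: add.commute)
qed

text \<open>Integrate the pointwise estimate over \<open>B\<close> and exchange the integrals: for
  each fixed \<open>t\<close> the translate of \<open>B\<close> lies in \<open>W\<close>.\<close>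

lemma shift_bound:
  fixes f :: "real^2 \<Rightarrow> real"
  assumes d: "\<And>x. f differentiable (at x)" and c: "continuous_on UNIV (grad f)"
    and B: "B \<in> sets borel" "\<And>x. x \<in> B \<Longrightarrow> f x = 0"
    and W: "W \<in> sets borel" "\<And>x t. x \<in> B \<Longrightarrow> 0 \<le> t \<Longrightarrow> t \<le> 1 \<Longrightarrow> x + t *\<^sub>R p \<in> W"
  shows "(\<integral>\<^sup>+x. indicator B x * ennreal ((f (x + p))\<^sup>2) \<partial>lborel) \<le>
    ennreal ((norm p)\<^sup>2) * (\<integral>\<^sup>+x. indicator W x * ennreal ((norm (grad f x))\<^sup>2) \<partial>lborel)"
proof -
  let ?g = "\<lambda>x. ennreal ((norm (grad f x))\<^sup>2)"
  have cf: "continuous_on UNIV f"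
    using d by (auto intro!: differentiable_imp_continuous_on simp: differentiable_on_def differentiable_at_withinI)
  have [measurable]: "f \<in> borel_measurable borel" "grad f \<in> borel_measurable borel"
    using cf c by (auto intro: borel_measurable_continuous_onI)
  note [measurable] = B(1) W(1)
  have "(\<integral>\<^sup>+x. indicator B x * ennreal ((f (x + p))\<^sup>2) \<partial>lborel) \<le>
    (\<integral>\<^sup>+x. ennreal ((norm p)\<^sup>2) * (\<integral>\<^sup>+t. indicator B x * (indicator {0..1} t * ?g (x + t *\<^sub>R p)) \<partial>lborel) \<partial>lborel)"
  proof (rule nn_integral_mono)
    fix x
    show "indicator B x * ennreal ((f (x + p))\<^sup>2) \<le>
      ennreal ((norm p)\<^sup>2) * (\<integral>\<^sup>+t. indicator B x * (indicator {0..1} t * ?g (x + t *\<^sub>R p)) \<partial>lborel)"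
      using shift_pointwise[OF d c B(2), of x p] by (cases "x \<in> B") auto
  qed
  also have "\<dots> = ennreal ((norm p)\<^sup>2) *
    (\<integral>\<^sup>+x. \<integral>\<^sup>+t. indicator B x * (indicator {0..1} t * ?g (x + t *\<^sub>R p)) \<partial>lborel \<partial>lborel)"
    by (rule nn_integral_cmult) measurable
  also have "(\<integral>\<^sup>+x. \<integral>\<^sup>+t. indicator B x * (indicator {0..1} t * ?g (x + t *\<^sub>R p)) \<partial>lborel \<partial>lborel) =
    (\<integral>\<^sup>+t. \<integral>\<^sup>+x. indicator B x * (indicator {0..1} t * ?g (x + t *\<^sub>R p)) \<partial>lborel \<partial>(lborel :: real measure))"
    by (rule lborel_pair.Fubini') measurable
  also have "\<dots> \<le> (\<integral>\<^sup>+t. indicator {0..1::real} t * (\<integral>\<^sup>+x. indicator W x * ?g x \<partial>lborel) \<partial>lborel)"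
  proof (rule nn_integral_mono)
    fix t :: real
    show "(\<integral>\<^sup>+x. indicator B x * (indicator {0..1} t * ?g (x + t *\<^sub>R p)) \<partial>lborel) \<le>
      indicator {0..1} t * (\<integral>\<^sup>+x. indicator W x * ?g x \<partial>lborel)"
    proof (cases "t \<in> {0..1}")
      case True
      then have "(\<integral>\<^sup>+x. indicator B x * (indicator {0..1} t * ?g (x + t *\<^sub>R p)) \<partial>lborel) \<le>
        (\<integral>\<^sup>+x. indicator W (x + t *\<^sub>R p) * ?g (x + t *\<^sub>R p) \<partial>lborel)"
        using W(2) by (intro nn_integral_mono) (auto simp: indicator_def)
      also have "\<dots> = (\<integral>\<^sup>+x. indicator W x * ?g x \<partial>lborel)"
        by (rule nn_integral_lborel_shift) measurable
      finally show ?thesis using True by simp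
    qed simp
  qed
  also have "\<dots> = (\<integral>\<^sup>+x. indicator W x * ?g x \<partial>lborel)"
    by (subst nn_integral_multc) auto
  finally show ?thesis by (simp add: mult_left_mono)
qed


lemma test_function_regular:
  assumes "f \<in> test_functions U"
  shows "\<And>x. f differentiable (at x)" "continuous_on UNIV (grad f)" "continuous_on UNIV f"
    and "\<And>x. x \<notin> U \<Longrightarrow> f x = 0" "\<And>x. x \<notin> U \<Longrightarrow> grad f x = 0"
proof -
  have C: "Ck (Suc 0) f" and "\<exists>K. compact K \<and> K \<subseteq> U \<and> (\<forall>x. x \<notin> K \<longrightarrow> f x = 0)"
    using assms unfolding test_functions_def by auto
  then obtain K where K: "compact K" "K \<subseteq> U" "\<And>x. x \<notin> K \<Longrightarrow> f x = 0" by blast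
  show d: "f differentiable (at x)" for x using C by simp
  have "continuous_on UNIV (\<lambda>x. \<chi> i. grad f x $ i)" using C by (intro continuous_on_vec_lambda) simp
  then show "continuous_on UNIV (grad f)" by simp
  show "continuous_on UNIV f"
    using d by (auto intro!: differentiable_imp_continuous_on simp: differentiable_on_def differentiable_at_withinI)
  show "f x = 0" if "x \<notin> U" for x using K that by blast
  show "grad f x = 0" if "x \<notin> U" for x
  proof (rule has_derivative_imp_grad)
    have "open (- K)" "x \<in> - K" using K that by (auto simp: compact_imp_closed open_Compl)
    then have "(f has_derivative (\<lambda>h. 0)) (at x)"
      using K(3) by (intro has_derivative_transform_within_open[OF has_derivative_const[of 0]]) auto
    then show "(f has_derivative (\<lambda>h. 0 \<bullet> h)) (at x)" by simp
  qed
qed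

section \<open>From smooth functions to their closure\<close>

lemma integrable_continuous_square:
  fixes h :: "real^2 \<Rightarrow> 'b::euclidean_space"
  assumes "open \<Omega>" "bounded \<Omega>" "continuous_on UNIV h"
  shows "h \<in> L2 \<Omega>"
proof -
  have c: "continuous_on UNIV (\<lambda>x. (norm (h x))\<^sup>2)" using assms(3) by (intro continuous_intros)
  have "bounded ((\<lambda>x. (norm (h x))\<^sup>2) ` closure \<Omega>)"
    using assms(2) by (intro compact_imp_bounded compact_continuous_image continuous_on_subset[OF c]) auto
  then obtain M where M: "\<And>x. x \<in> closure \<Omega> \<Longrightarrow> (norm (h x))\<^sup>2 \<le> M"
    unfolding bounded_iff by (auto simp: abs_le_iff)
  have lm: "\<Omega> \<in> lmeasurable" using assms(1,2) by (rule lmeasurable_open[rotated])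
  interpret finite_measure "lebesgue_on \<Omega>" by (rule finite_measure_lebesgue_on[OF lm])
  have hm: "h \<in> borel_measurable (lebesgue_on \<Omega>)"
    using assms(1,3) by (intro continuous_imp_measurable_on_sets_lebesgue) (auto intro: continuous_on_subset)
  moreover have "integrable (lebesgue_on \<Omega>) (\<lambda>x. (norm (h x))\<^sup>2)"
    using M closure_subset[of \<Omega>] hm by (intro integrable_const_bound[of _ M]) (auto intro!: AE_I2)
  ultimately show ?thesis unfolding L2_def by simp
qed

lemma L2_diff:
  assumes f: "f \<in> L2 \<Omega>" and g: "g \<in> L2 \<Omega>"
  shows "(\<lambda>x. f x - g x) \<in> L2 \<Omega>"
proof -
  have [measurable]: "f \<in> borel_measurable (lebesgue_on \<Omega>)" "g \<in> borel_measurable (lebesgue_on \<Omega>)"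
    using f g unfolding L2_def by auto
  have "integrable (lebesgue_on \<Omega>) (\<lambda>x. 2 * (norm (f x))\<^sup>2 + 2 * (norm (g x))\<^sup>2)"
    using f g unfolding L2_def by auto
  then have "integrable (lebesgue_on \<Omega>) (\<lambda>x. (norm (f x - g x))\<^sup>2)"
    by (rule Bochner_Integration.integrable_bound) (auto simp: norm_diff_square_le intro!: AE_I2)
  then show ?thesis unfolding L2_def by simp
qed

lemma nn_integral_L2:
  assumes "h \<in> L2 \<Omega>"
  shows "(\<integral>\<^sup>+x. ennreal ((norm (h x))\<^sup>2) \<partial>lebesgue_on \<Omega>) = ennreal ((L2norm \<Omega> h)\<^sup>2)"
  using assms unfolding L2_def L2norm_def
  by (subst nn_integral_eq_integral) (auto intro!: integral_nonneg_AE)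

lemma nn_integral_lebesgue_on:
  assumes "open \<Omega>" "A \<subseteq> \<Omega>" "A \<in> sets borel" "h \<in> borel_measurable borel"
  shows "(\<integral>\<^sup>+x. indicator A x * h x \<partial>lebesgue_on \<Omega>) = (\<integral>\<^sup>+x. indicator A x * h x \<partial>lborel)"
proof -
  have "(\<integral>\<^sup>+x. indicator A x * h x \<partial>lebesgue_on \<Omega>) = (\<integral>\<^sup>+x. indicator A x * h x * indicator \<Omega> x \<partial>lebesgue)"
    using assms(1) by (intro nn_integral_restrict_space) auto
  also have "\<dots> = (\<integral>\<^sup>+x. indicator A x * h x \<partial>lebesgue)"
    using assms(2) by (intro nn_integral_cong) (auto simp: indicator_def)
  also have "\<dots> = (\<integral>\<^sup>+x. indicator A x * h x \<partial>lborel)" by (rule nn_integral_completion)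
  finally show ?thesis .
qed

lemma nn_integral_square_triangle:
  fixes f g :: "'a \<Rightarrow> 'b::euclidean_space"
  assumes [measurable]: "f \<in> borel_measurable M" "g \<in> borel_measurable M" and A: "A \<inter> space M \<in> sets M"
  shows "(\<integral>\<^sup>+x. indicator A x * ennreal ((norm (f x))\<^sup>2) \<partial>M) \<le>
    2 * (\<integral>\<^sup>+x. indicator A x * ennreal ((norm (g x))\<^sup>2) \<partial>M) + 2 * (\<integral>\<^sup>+x. ennreal ((norm (g x - f x))\<^sup>2) \<partial>M)"
proof -
  have [measurable]: "(indicator A :: 'a \<Rightarrow> ennreal) \<in> borel_measurable M"
    using A by (subst borel_measurable_indicator_iff)
  have "(\<integral>\<^sup>+x. indicator A x * ennreal ((norm (f x))\<^sup>2) \<partial>M) \<le>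
    (\<integral>\<^sup>+x. 2 * (indicator A x * ennreal ((norm (g x))\<^sup>2)) + 2 * ennreal ((norm (g x - f x))\<^sup>2) \<partial>M)"
  proof (rule nn_integral_mono)
    fix x
    have "ennreal ((norm (f x))\<^sup>2) \<le> ennreal (2 * (norm (g x))\<^sup>2 + 2 * (norm (g x - f x))\<^sup>2)"
      using norm_diff_square_le[of "g x" "g x - f x"] by (intro ennreal_leI) simp
    also have "\<dots> = 2 * ennreal ((norm (g x))\<^sup>2) + 2 * ennreal ((norm (g x - f x))\<^sup>2)"
      by (simp add: ennreal_mult')
    finally show "indicator A x * ennreal ((norm (f x))\<^sup>2) \<le>
      2 * (indicator A x * ennreal ((norm (g x))\<^sup>2)) + 2 * ennreal ((norm (g x - f x))\<^sup>2)"
      by (cases "x \<in> A") auto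
  qed
  also have "\<dots> = 2 * (\<integral>\<^sup>+x. indicator A x * ennreal ((norm (g x))\<^sup>2) \<partial>M) + 2 * (\<integral>\<^sup>+x. ennreal ((norm (g x - f x))\<^sup>2) \<partial>M)"
    by (simp add: nn_integral_add nn_integral_cmult)
  finally show ?thesis .
qed

text \<open>The translation estimate survives the limit. One weak gradient \<open>g\<close> serves
  all \<open>A\<close>, \<open>W\<close> and \<open>p\<close>, because these will be shrunk to a
  point. The 4 comes from using the squared triangle inequality twice.\<close>

lemma H10_shift_bound:
  assumes \<Omega>: "open \<Omega>" "bounded \<Omega>" and u: "u \<in> H10 \<Omega>"
  shows "\<exists>g :: real^2 \<Rightarrow> real^2. g \<in> L2 \<Omega> \<and> (\<forall>A W p. open A \<longrightarrow> A \<subseteq> \<Omega> \<longrightarrow> open W \<longrightarrow>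
    (\<forall>x\<in>A. x - p \<notin> \<Omega>) \<longrightarrow> (\<forall>x\<in>A. \<forall>t. 0 \<le> t \<longrightarrow> t \<le> 1 \<longrightarrow> x - t *\<^sub>R p \<in> W) \<longrightarrow>
    (\<integral>\<^sup>+x. indicator A x * ennreal ((norm (u x))\<^sup>2) \<partial>lebesgue_on \<Omega>) \<le>
    ennreal (4 * (norm p)\<^sup>2) * (\<integral>\<^sup>+x. indicator W x * ennreal ((norm (g x))\<^sup>2) \<partial>lebesgue_on \<Omega>))"
proof -
  obtain g f where uL: "u \<in> L2 \<Omega>" and g: "g \<in> L2 \<Omega>" and f: "\<And>n. f n \<in> test_functions \<Omega>"
    and f1: "(\<lambda>n. L2norm \<Omega> (\<lambda>x. f n x - u x)) \<longlonglongrightarrow> 0"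
    and f2: "(\<lambda>n. L2norm \<Omega> (\<lambda>x. grad (f n) x - g x)) \<longlonglongrightarrow> 0"
    using u unfolding H10_def by blast
  note reg = test_function_regular[OF f]
  have fL: "f n \<in> L2 \<Omega>" "grad (f n) \<in> L2 \<Omega>" for n
    by (rule integrable_continuous_square[OF \<Omega> reg(3)], rule integrable_continuous_square[OF \<Omega> reg(2)])
  have meas: "u \<in> borel_measurable (lebesgue_on \<Omega>)" "g \<in> borel_measurable (lebesgue_on \<Omega>)"
    "f n \<in> borel_measurable (lebesgue_on \<Omega>)" "grad (f n) \<in> borel_measurable (lebesgue_on \<Omega>)" for n
    using uL g fL unfolding L2_def by auto
  have bm: "f n \<in> borel_measurable borel" "grad (f n) \<in> borel_measurable borel" for n
    using reg(2,3) by (auto intro: borel_measurable_continuous_onI)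
  show ?thesis
  proof (intro exI[of _ g] conjI g allI impI)
    fix A W :: "(real^2) set" and p :: "real^2"
    assume A: "open A" "A \<subseteq> \<Omega>" and W: "open W" and "\<forall>x\<in>A. x - p \<notin> \<Omega>"
      and "\<forall>x\<in>A. \<forall>t. 0 \<le> t \<longrightarrow> t \<le> 1 \<longrightarrow> x - t *\<^sub>R p \<in> W"
    then have Ap: "\<And>x. x \<in> A \<Longrightarrow> x - p \<notin> \<Omega>"
      and AW: "\<And>x t. x \<in> A \<Longrightarrow> 0 \<le> t \<Longrightarrow> t \<le> 1 \<Longrightarrow> x - t *\<^sub>R p \<in> W" by blast+
    let ?N = "\<lambda>S h. \<integral>\<^sup>+x. indicator S x * ennreal ((norm (h x))\<^sup>2) \<partial>lebesgue_on \<Omega>"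
    have smooth: "?N A (f n) \<le> ennreal ((norm p)\<^sup>2) * ?N W (grad (f n))" for n
    proof -
      \<comment> \<open>\<open>A\<close> moved back by \<open>p\<close>: there the test functions
        vanish, and the segments in direction \<open>p\<close> end in \<open>A\<close>.\<close>
      let ?B = "(\<lambda>x. x + p) -` A"
      have B: "open ?B" using A(1) by (intro continuous_open_vimage) (auto intro!: continuous_intros)
      have "?N A (f n) = (\<integral>\<^sup>+x. indicator A x * ennreal ((norm (f n x))\<^sup>2) \<partial>lborel)"
        using \<Omega> A bm by (intro nn_integral_lebesgue_on) auto
      also have "\<dots> = (\<integral>\<^sup>+x. indicator A (x + p) * ennreal ((norm (f n (x + p)))\<^sup>2) \<partial>lborel)"
        using A(1) bm(1)[of n] by (intro nn_integral_lborel_shift[symmetric]) auto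
      also have "\<dots> = (\<integral>\<^sup>+x. indicator ?B x * ennreal ((f n (x + p))\<^sup>2) \<partial>lborel)"
        by (intro nn_integral_cong) (auto simp: indicator_def)
      also have "\<dots> \<le> ennreal ((norm p)\<^sup>2) * (\<integral>\<^sup>+x. indicator W x * ennreal ((norm (grad (f n) x))\<^sup>2) \<partial>lborel)"
      proof (rule shift_bound[OF reg(1,2)])
        show "f n x = 0" if "x \<in> ?B" for x using Ap[of "x + p"] that reg(4) by auto
        show "x + t *\<^sub>R p \<in> W" if "x \<in> ?B" "0 \<le> t" "t \<le> 1" for x t
          using AW[of "x + p" "1 - t"] that by (simp add: algebra_simps)
      qed (use B W in auto)
      also have "(\<integral>\<^sup>+x. indicator W x * ennreal ((norm (grad (f n) x))\<^sup>2) \<partial>lborel) =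
        (\<integral>\<^sup>+x. indicator (W \<inter> \<Omega>) x * ennreal ((norm (grad (f n) x))\<^sup>2) \<partial>lborel)"
        using reg(5) by (intro nn_integral_cong) (auto simp: indicator_def)
      also have "\<dots> = (\<integral>\<^sup>+x. indicator (W \<inter> \<Omega>) x * ennreal ((norm (grad (f n) x))\<^sup>2) \<partial>lebesgue_on \<Omega>)"
        using \<Omega> W bm by (intro nn_integral_lebesgue_on[symmetric]) auto
      also have "\<dots> = ?N W (grad (f n))"
        by (intro nn_integral_cong) (auto simp: indicator_def space_restrict_space)
      finally show ?thesis .
    qed
    have ms: "S \<inter> space (lebesgue_on \<Omega>) \<in> sets (lebesgue_on \<Omega>)" if "open S" for S
      using that \<Omega>(1) by (auto simp: sets_restrict_space space_restrict_space)
    define \<epsilon> where "\<epsilon> n = 2 * (L2norm \<Omega> (\<lambda>x. f n x - u x))\<^sup>2 + 4 * (norm p)\<^sup>2 * (L2norm \<Omega> (\<lambda>x. grad (f n) x - g x))\<^sup>2" for n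
    have "\<epsilon> \<longlonglongrightarrow> 2 * 0\<^sup>2 + 4 * (norm p)\<^sup>2 * 0\<^sup>2"
      unfolding \<epsilon>_def by (intro tendsto_intros f1 f2)
    then have \<epsilon>0: "\<epsilon> \<longlonglongrightarrow> 0" by simp
    have bound: "?N A u \<le> ennreal (4 * (norm p)\<^sup>2) * ?N W g + ennreal (\<epsilon> n)" for n
    proof -
      have "?N A u \<le> 2 * ?N A (f n) + 2 * (\<integral>\<^sup>+x. ennreal ((norm (f n x - u x))\<^sup>2) \<partial>lebesgue_on \<Omega>)"
        by (rule nn_integral_square_triangle[OF meas(1,3) ms[OF A(1)]])
      also have "\<dots> = 2 * ?N A (f n) + 2 * ennreal ((L2norm \<Omega> (\<lambda>x. f n x - u x))\<^sup>2)"
        using nn_integral_L2[OF L2_diff[OF fL(1) uL]] by simp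
      also have "?N A (f n) \<le> ennreal ((norm p)\<^sup>2) * ?N W (grad (f n))" by (rule smooth)
      also have "?N W (grad (f n)) \<le> 2 * ?N W g + 2 * (\<integral>\<^sup>+x. ennreal ((norm (g x - grad (f n) x))\<^sup>2) \<partial>lebesgue_on \<Omega>)"
        by (rule nn_integral_square_triangle[OF meas(4,2) ms[OF W]])
      also have "(\<integral>\<^sup>+x. ennreal ((norm (g x - grad (f n) x))\<^sup>2) \<partial>lebesgue_on \<Omega>) = ennreal ((L2norm \<Omega> (\<lambda>x. grad (f n) x - g x))\<^sup>2)"
        using nn_integral_L2[OF L2_diff[OF fL(2) g]] by (simp add: norm_minus_commute)
      finally have "?N A u \<le> 2 * (ennreal ((norm p)\<^sup>2) * (2 * ?N W g + 2 * ennreal ((L2norm \<Omega> (\<lambda>x. grad (f n) x - g x))\<^sup>2))) +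
        2 * ennreal ((L2norm \<Omega> (\<lambda>x. f n x - u x))\<^sup>2)" by (simp add: mult_left_mono add_right_mono)
      also have "\<dots> = ennreal (4 * (norm p)\<^sup>2) * ?N W g + ennreal (\<epsilon> n)"
        unfolding \<epsilon>_def by (simp add: ennreal_mult distrib_left mult.assoc mult.left_commute[of "ennreal ((norm p)\<^sup>2)"] add_ac)
      finally show ?thesis .
    qed
    show "?N A u \<le> ennreal (4 * (norm p)\<^sup>2) * ?N W g"
    proof (rule ennreal_le_epsilon)
      fix e :: real assume "0 < e"
      then obtain n where "\<epsilon> n < e" using order_tendstoD(2)[OF \<epsilon>0] eventually_happens by (metis eventually_sequentially order_refl)
      then show "?N A u \<le> ennreal (4 * (norm p)\<^sup>2) * ?N W g + ennreal e"
        using bound[of n] by (meson add_left_mono ennreal_leI less_imp_le order_trans)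
    qed
  qed
qed

text \<open>An affine function is determined by its vertex values. Hence the coordinates add up to 1
  and reproduce every point, and if they are nonnegative they give a convex combination.\<close>

lemma triangle_barycentric:
  assumes t: "triangle t"
  shows "\<exists>(a :: real^2 \<Rightarrow> real^2) c. (\<forall>v\<in>t. \<forall>w\<in>t. a v \<bullet> w + c v = (if w = v then 1 else 0)) \<and>
    (\<forall>x. x \<in> convex hull t \<longleftrightarrow> (\<forall>v\<in>t. 0 \<le> a v \<bullet> x + c v))"
proof -
  have fin: "finite t" by (rule triangle_finite[OF t])
  have "\<exists>ac. \<forall>w\<in>t. fst ac \<bullet> w + snd ac = (if w = v then 1 else (0::real))" for v
  proof -
    obtain a c where "\<And>w. w \<in> t \<Longrightarrow> a \<bullet> w + c = (if w = v then 1 else (0::real))"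
      using triangle_interpolation[OF t, of "\<lambda>w. if w = v then 1 else 0"] by blast
    then show ?thesis by (intro exI[of _ "(a, c)"]) simp
  qed
  then obtain ac where "\<forall>v. \<forall>w\<in>t. fst (ac v) \<bullet> w + snd (ac v) = (if w = v then 1 else (0::real))" by metis
  then have "\<exists>a c. \<forall>v. \<forall>w\<in>t. a v \<bullet> w + c v = (if w = v then 1 else (0::real))"
    by (intro exI[of _ "\<lambda>v. fst (ac v)"] exI[of _ "\<lambda>v. snd (ac v)"])
  then obtain a c where ac: "\<And>v w. w \<in> t \<Longrightarrow> a v \<bullet> w + c v = (if w = v then 1 else (0::real))" by blast
  have affine: "a' \<bullet> x + c' = b' \<bullet> x + d'" if "\<And>w. w \<in> t \<Longrightarrow> a' \<bullet> w + c' = b' \<bullet> w + d'" for a' b' :: "real^2" and c' d' x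
    using triangle_affine_unique[OF t that] by simp
  have one: "(\<Sum>v\<in>t. a v \<bullet> x + c v) = 1" for x
  proof -
    have "(\<Sum>v\<in>t. a v) \<bullet> x + sum c t = 0 \<bullet> x + 1"
    proof (rule affine)
      fix w assume w: "w \<in> t"
      have "(\<Sum>v\<in>t. a v) \<bullet> w + sum c t = (\<Sum>v\<in>t. a v \<bullet> w + c v)" by (simp add: inner_sum_left sum.distrib)
      also have "\<dots> = 1" using w fin by (simp add: ac)
      finally show "(\<Sum>v\<in>t. a v) \<bullet> w + sum c t = 0 \<bullet> w + 1" by simp
    qed
    then show ?thesis by (simp add: inner_sum_left sum.distrib)
  qed
  have id: "x = (\<Sum>v\<in>t. (a v \<bullet> x + c v) *\<^sub>R v)" for x
  proof (rule vector_eq_ldot[THEN iffD1, rule_format])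
    fix y :: "real^2"
    have e: "y \<bullet> (\<Sum>v\<in>t. (a v \<bullet> z + c v) *\<^sub>R v) = (\<Sum>v\<in>t. (y \<bullet> v) *\<^sub>R a v) \<bullet> z + (\<Sum>v\<in>t. (y \<bullet> v) * c v)" for z
      by (simp add: inner_sum_right inner_sum_left sum.distrib algebra_simps)
    have "y \<bullet> x + 0 = (\<Sum>v\<in>t. (y \<bullet> v) *\<^sub>R a v) \<bullet> x + (\<Sum>v\<in>t. (y \<bullet> v) * c v)"
    proof (rule affine)
      fix w assume w: "w \<in> t"
      have "(\<Sum>v\<in>t. (a v \<bullet> w + c v) *\<^sub>R v) = (\<Sum>v\<in>t. if w = v then v else 0)"
        using w by (intro sum.cong refl) (simp add: ac)
      also have "\<dots> = w" using w fin by simp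
      finally show "y \<bullet> w + 0 = (\<Sum>v\<in>t. (y \<bullet> v) *\<^sub>R a v) \<bullet> w + (\<Sum>v\<in>t. (y \<bullet> v) * c v)"
        unfolding e[symmetric] by simp
    qed
    then show "y \<bullet> x = y \<bullet> (\<Sum>v\<in>t. (a v \<bullet> x + c v) *\<^sub>R v)" unfolding e by simp
  qed
  have hull: "x \<in> convex hull t \<longleftrightarrow> (\<forall>v\<in>t. 0 \<le> a v \<bullet> x + c v)" for x
  proof
    assume x: "x \<in> convex hull t"
    have "0 \<bullet> x + 0 \<le> a v \<bullet> x + c v" for v
      by (rule affine_le_on_hull[OF _ x]) (simp add: ac)
    then show "\<forall>v\<in>t. 0 \<le> a v \<bullet> x + c v" by simp
  next
    assume "\<forall>v\<in>t. 0 \<le> a v \<bullet> x + c v"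
    then show "x \<in> convex hull t"
      unfolding convex_hull_finite[OF fin]
      by (intro CollectI exI[of _ "\<lambda>v. a v \<bullet> x + c v"] conjI one id[symmetric])
  qed
  show ?thesis by (intro exI[of _ a] exI[of _ c] conjI ballI allI ac hull)
qed

text \<open>Near its point \<open>q\<close> a triangle is a cone with apex \<open>q\<close>:
  coordinates positive at \<open>q\<close> stay positive, and those that vanish at \<open>q\<close>
  keep their sign along rays from \<open>q\<close>.\<close>

lemma triangle_locally_conic:
  assumes t: "triangle t"
  obtains \<delta> where "\<delta> > 0" "\<And>z s. z \<in> ball q \<delta> \<Longrightarrow> 0 < s \<Longrightarrow> s \<le> 1 \<Longrightarrow>
      q + s *\<^sub>R (z - q) \<in> convex hull t \<Longrightarrow> z \<in> convex hull t"
proof -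
  obtain a :: "real^2 \<Rightarrow> real^2" and c where ac: "\<And>x. x \<in> convex hull t \<longleftrightarrow> (\<forall>v\<in>t. 0 \<le> a v \<bullet> x + c v)"
    using triangle_barycentric[OF t] by blast
  let ?l = "\<lambda>v x. a v \<bullet> x + c v"
  show ?thesis
  proof (cases "q \<in> convex hull t")
    case False
    have "open (- (convex hull t))" by (intro open_Compl compact_imp_closed triangle_hull_compact t)
    moreover have "q \<in> - (convex hull t)" using False by simp
    ultimately obtain \<delta> where \<delta>: "\<delta> > 0" "ball q \<delta> \<subseteq> - (convex hull t)" by (rule openE)
    show ?thesis
    proof (rule that[OF \<delta>(1)])
      fix z s assume z: "z \<in> ball q \<delta>" "0 < s" "s \<le> (1::real)" "q + s *\<^sub>R (z - q) \<in> convex hull t"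
      have "s * norm (z - q) \<le> 1 * norm (z - q)" using z by (intro mult_right_mono) auto
      then have "q + s *\<^sub>R (z - q) \<in> ball q \<delta>" using z by (simp add: dist_norm norm_minus_commute)
      then show "z \<in> convex hull t" using z \<delta> by blast
    qed
  next
    case True
    have "open (\<Inter>v\<in>{v \<in> t. 0 < ?l v q}. {x. 0 < ?l v x})"
      using triangle_finite[OF t] by (intro open_INT ballI open_Collect_less continuous_intros) auto
    moreover have "q \<in> (\<Inter>v\<in>{v \<in> t. 0 < ?l v q}. {x. 0 < ?l v x})" by auto
    ultimately obtain \<delta> where \<delta>: "\<delta> > 0" "ball q \<delta> \<subseteq> (\<Inter>v\<in>{v \<in> t. 0 < ?l v q}. {x. 0 < ?l v x})" by (rule openE)
    show ?thesis
    proof (rule that[OF \<delta>(1)])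
      fix z s assume z: "z \<in> ball q \<delta>" "0 < s" "s \<le> (1::real)" "q + s *\<^sub>R (z - q) \<in> convex hull t"
      have "0 \<le> ?l v z" if v: "v \<in> t" for v
      proof (cases "0 < ?l v q")
        case True
        then have "0 < ?l v z" using \<delta>(2) z(1) v by blast
        then show ?thesis by simp
      next
        case False
        then have q0: "?l v q = 0" using \<open>q \<in> convex hull t\<close> v unfolding ac by force
        have "0 \<le> ?l v (q + s *\<^sub>R (z - q))" using z(4) v unfolding ac by blast
        also have "\<dots> = (1 - s) * ?l v q + s * ?l v z" by (simp add: inner_add_right inner_diff_right algebra_simps)
        finally show ?thesis using q0 z(2) by (simp add: zero_le_mult_iff)
      qed
      then show "z \<in> convex hull t" unfolding ac by blast
    qed
  qed
qed

section \<open>Cones and boundary values\<close>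

context triangulated
begin

text \<open>Since the domain is the interior of its closure, exterior points lie arbitrarily close
  to \<open>q\<close>. Take one with a ball around it: the triangles are conic near
  \<open>q\<close>, so they cannot meet the contractions of that ball towards
  \<open>q\<close>.\<close>

lemma exterior_cone:
  assumes q: "q \<notin> \<Omega>"
  shows "\<exists>a r. r > 0 \<and> (\<forall>s. 0 < s \<longrightarrow> s \<le> 1 \<longrightarrow> ball (q + s *\<^sub>R (a - q)) (s * r) \<inter> closure \<Omega> = {})"
proof -
  have "\<forall>t\<in>T. \<exists>\<delta>>0. \<forall>z s. z \<in> ball q \<delta> \<longrightarrow> 0 < s \<longrightarrow> s \<le> 1 \<longrightarrow>
      q + s *\<^sub>R (z - q) \<in> convex hull t \<longrightarrow> z \<in> convex hull t"
    using triangle_locally_conic triangle_T by metis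
  then obtain \<delta> where \<delta>: "\<And>t. t \<in> T \<Longrightarrow> \<delta> t > 0" "\<And>t z s. t \<in> T \<Longrightarrow> z \<in> ball q (\<delta> t) \<Longrightarrow> 0 < s \<Longrightarrow> s \<le> 1 \<Longrightarrow>
      q + s *\<^sub>R (z - q) \<in> convex hull t \<Longrightarrow> z \<in> convex hull t" by metis
  define d where "d = Min (insert 1 (\<delta> ` T))"
  have d: "d > 0" "\<And>t. t \<in> T \<Longrightarrow> d \<le> \<delta> t" unfolding d_def using \<delta>(1) finite_T by auto
  have "\<not> ball q d \<subseteq> closure \<Omega>"
  proof
    assume "ball q d \<subseteq> closure \<Omega>"
    then have "ball q d \<subseteq> \<Omega>" using interior_maximal[of "ball q d"] regular_domain by blast
    then show False using q d(1) centre_in_ball by blast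
  qed
  then obtain a where a: "a \<in> ball q d - closure \<Omega>" by blast
  moreover have "open (ball q d - closure \<Omega>)" by (intro open_Diff) auto
  ultimately obtain r where r: "r > 0" "ball a r \<subseteq> ball q d - closure \<Omega>" using openE by metis
  show ?thesis
  proof (intro exI[of _ a] exI[of _ r] conjI r(1) allI impI)
    fix s :: real assume s: "0 < s" "s \<le> 1"
    have "y \<notin> closure \<Omega>" if y: "y \<in> ball (q + s *\<^sub>R (a - q)) (s * r)" for y
    proof
      assume "y \<in> closure \<Omega>"
      then obtain t where t: "t \<in> T" "y \<in> convex hull t" using cover by blast
      define z where "z = q + (1 / s) *\<^sub>R (y - q)"
      have yz: "y = q + s *\<^sub>R (z - q)" using s by (simp add: z_def)
      have "dist (q + s *\<^sub>R (a - q)) y = s * dist a z"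
        unfolding yz using s by (simp add: dist_norm scaleR_diff_right[symmetric])
      then have "z \<in> ball a r" using y s by simp
      then have z: "z \<in> ball q d" "z \<notin> closure \<Omega>" using r by auto
      have "z \<in> convex hull t" using \<delta>(2)[OF t(1) _ s, of z] z(1) d(2)[OF t(1)] t(2) yz by auto
      then show False using z(2) hull_subset_closure[OF t(1)] by blast
    qed
    then show "ball (q + s *\<^sub>R (a - q)) (s * r) \<inter> closure \<Omega> = {}" by blast
  qed
qed

text \<open>Contractions towards a point of a convex set stay in the set.\<close>

lemma interior_cone:
  assumes t: "t \<in> T" "q \<in> convex hull t"
  shows "\<exists>b r. r > 0 \<and> (\<forall>s. 0 < s \<longrightarrow> s \<le> 1 \<longrightarrow> ball (q + s *\<^sub>R (b - q)) (s * r) \<subseteq> interior (convex hull t))"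
proof -
  obtain b where "b \<in> interior (convex hull t)" using triangle_interior_nonempty[OF triangle_T[OF t(1)]] by blast
  then obtain r where r: "r > 0" "ball b r \<subseteq> convex hull t" using mem_interior by blast
  show ?thesis
  proof (intro exI[of _ b] exI[of _ r] conjI r(1) allI impI)
    fix s :: real assume s: "0 < s" "s \<le> 1"
    have "ball (q + s *\<^sub>R (b - q)) (s * r) \<subseteq> convex hull t"
    proof
      fix y assume y: "y \<in> ball (q + s *\<^sub>R (b - q)) (s * r)"
      define z where "z = q + (1 / s) *\<^sub>R (y - q)"
      have yz: "y = (1 - s) *\<^sub>R q + s *\<^sub>R z" using s by (simp add: z_def algebra_simps)
      have "dist (q + s *\<^sub>R (b - q)) y = s * dist b z"
      proof -
        have "q + s *\<^sub>R (b - q) - y = s *\<^sub>R (b - z)" unfolding yz by (simp add: algebra_simps)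
        then show ?thesis using s by (simp add: dist_norm)
      qed
      then have "z \<in> convex hull t" using y s r by auto
      then show "y \<in> convex hull t" unfolding yz
        by (intro convexD[OF convex_convex_hull t(2)]) (use s in auto)
    qed
    then show "ball (q + s *\<^sub>R (b - q)) (s * r) \<subseteq> interior (convex hull t)" by (rule interior_maximal) simp
  qed
qed

text \<open>If \<open>u\<close> were nonzero at a boundary point, the bound of \<open>u\<close> by its weak gradient along
  translations from the exterior to the interior cone would scale like \<open>s\<^sup>2\<close> on both sides, but the
  weak gradient has no mass at a point.\<close>

lemma H10_vanishes_on_boundary:
  assumes u: "u \<in> H10 \<Omega>" and t: "t \<in> T" "q \<in> convex hull t" and cont: "continuous_on (convex hull t) u"
    and q: "q \<notin> \<Omega>"
  shows "u q = 0"
proof (rule ccontr)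
  assume "u q \<noteq> 0"
  obtain g :: "real^2 \<Rightarrow> real^2" where g: "g \<in> L2 \<Omega>" and "\<forall>A W p. open A \<longrightarrow> A \<subseteq> \<Omega> \<longrightarrow> open W \<longrightarrow>
    (\<forall>x\<in>A. x - p \<notin> \<Omega>) \<longrightarrow> (\<forall>x\<in>A. \<forall>t. 0 \<le> t \<longrightarrow> t \<le> 1 \<longrightarrow> x - t *\<^sub>R p \<in> W) \<longrightarrow>
    (\<integral>\<^sup>+x. indicator A x * ennreal ((norm (u x))\<^sup>2) \<partial>lebesgue_on \<Omega>) \<le>
    ennreal (4 * (norm p)\<^sup>2) * (\<integral>\<^sup>+x. indicator W x * ennreal ((norm (g x))\<^sup>2) \<partial>lebesgue_on \<Omega>)"
    using H10_shift_bound[OF open_domain bounded_domain u] by (elim exE conjE)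
  note bound = this(2)[rule_format]
  obtain a ra where a: "ra > 0" "\<And>s. 0 < s \<Longrightarrow> s \<le> 1 \<Longrightarrow> ball (q + s *\<^sub>R (a - q)) (s * ra) \<inter> closure \<Omega> = {}"
    using exterior_cone[OF q] by blast
  obtain b rb where b: "rb > 0" "\<And>s. 0 < s \<Longrightarrow> s \<le> 1 \<Longrightarrow> ball (q + s *\<^sub>R (b - q)) (s * rb) \<subseteq> interior (convex hull t)"
    using interior_cone[OF t] by blast
  \<comment> \<open>With a common radius the translation by \<open>s *\<^sub>R (b - a)\<close>
    carries a ball outside the domain onto the ball \<open>A s\<close> inside.\<close>
  define r where "r = min ra rb"
  have r: "r > 0" "r \<le> ra" "r \<le> rb" using a b by (auto simp: r_def)
  \<comment> \<open>Large enough for \<open>W s\<close> to contain all segments from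
    \<open>A s\<close> back to the exterior ball.\<close>
  define R where "R = norm (a - q) + norm (b - q) + r"
  define A where "A s = ball (q + s *\<^sub>R (b - q)) (s * r)" for s
  define W where "W s = ball q (s * R)" for s
  have R: "R > 0" using r by (simp add: R_def add_nonneg_pos)
  have AI: "A s \<subseteq> interior (convex hull t)" if s: "0 < s" "s \<le> 1" for s
  proof -
    have "A s \<subseteq> ball (q + s *\<^sub>R (b - q)) (s * rb)" unfolding A_def by (rule subset_ball) (use r s in auto)
    then show ?thesis using b(2)[OF s] by blast
  qed
  have AW: "x - l *\<^sub>R (s *\<^sub>R (b - a)) \<in> W s" if s: "0 < s" and x: "x \<in> A s" and l: "0 \<le> l" "l \<le> 1" for s x l
  proof -
    define y where "y = x - (q + s *\<^sub>R (b - q))"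
    have y: "norm y < s * r" using x by (simp add: A_def y_def dist_norm norm_minus_commute)
    have "x - l *\<^sub>R (s *\<^sub>R (b - a)) - q = y + (s * (1 - l)) *\<^sub>R (b - q) + (s * l) *\<^sub>R (a - q)"
      by (simp add: y_def algebra_simps)
    then have "norm (x - l *\<^sub>R (s *\<^sub>R (b - a)) - q) \<le> norm y + s * (1 - l) * norm (b - q) + s * l * norm (a - q)"
      using s l norm_triangle_ineq[of "y + (s * (1 - l)) *\<^sub>R (b - q)" "(s * l) *\<^sub>R (a - q)"]
        norm_triangle_ineq[of y "(s * (1 - l)) *\<^sub>R (b - q)"] by (simp add: abs_mult)
    also have "\<dots> \<le> norm y + s * 1 * norm (b - q) + s * 1 * norm (a - q)"
      using s l by (intro add_mono mult_right_mono mult_left_mono) auto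
    also have "\<dots> < s * R" using y by (simp add: R_def algebra_simps)
    finally show ?thesis by (simp add: W_def dist_norm norm_minus_commute)
  qed
  let ?N = "\<lambda>s. \<integral>\<^sup>+x. indicator (W s) x * ennreal ((norm (g x))\<^sup>2) \<partial>lebesgue_on \<Omega>"
  define \<omega> where "\<omega> = emeasure lebesgue (ball (0::real^2) 1)"
  \<comment> \<open>A lower bound for the integral of the square of \<open>u\<close> over
    \<open>A s\<close>, divided by \<open>s\<^sup>2\<close>, which is how areas scale.\<close>
  define \<kappa> where "\<kappa> = ennreal ((\<bar>u q\<bar> / 2)\<^sup>2) * (ennreal (r\<^sup>2) * \<omega>)"
  have \<kappa>: "\<kappa> \<noteq> 0"
  proof -
    have "measure lborel (ball (0::real^2) 1) > 0" by (rule content_ball_pos) simp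
    then have "\<omega> \<noteq> 0" unfolding \<omega>_def by (auto simp: measure_def)
    then show ?thesis using \<open>u q \<noteq> 0\<close> r(1) by (simp add: \<kappa>_def)
  qed
  obtain \<eta> where \<eta>: "\<eta> > 0" "\<And>x. x \<in> convex hull t \<Longrightarrow> dist x q < \<eta> \<Longrightarrow> dist (u x) (u q) < \<bar>u q\<bar> / 2"
    using cont t(2) \<open>u q \<noteq> 0\<close> unfolding continuous_on_iff by (metis half_gt_zero zero_less_abs_iff)
  \<comment> \<open>The squared length of the translation supplies the same
    \<open>s\<^sup>2\<close>, so it cancels.\<close>
  have key: "\<kappa> \<le> ennreal (4 * (norm (b - a))\<^sup>2) * ?N s" if s: "0 < s" "s \<le> 1" "s * R < \<eta>" for s
  proof -
    have Asub: "A s \<subseteq> \<Omega>" using AI[OF s(1,2)] interior_hull_subset[OF t(1)] by blast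
    have ms: "A s \<in> sets (lebesgue_on \<Omega>)"
      using Asub open_domain by (auto simp: sets_restrict_space A_def intro!: image_eqI[of _ _ "A s"])
    have big: "\<bar>u q\<bar> / 2 \<le> norm (u x)" if x: "x \<in> A s" for x
    proof -
      have "x \<in> W s" using AW[OF s(1) x, of 0] by simp
      then have "dist x q < \<eta>" using s(3) by (simp add: W_def dist_commute)
      then have "dist (u x) (u q) < \<bar>u q\<bar> / 2" using \<eta>(2) AI[OF s(1,2)] interior_subset x by blast
      then show ?thesis using abs_triangle_ineq2_sym[of "u q" "u x"] unfolding dist_real_def real_norm_def by linarith
    qed
    have "ennreal (s\<^sup>2) * \<kappa> = ennreal ((\<bar>u q\<bar> / 2)\<^sup>2) * (ennreal ((s * r)\<^sup>2) * \<omega>)"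
      by (simp add: \<kappa>_def power_mult_distrib ennreal_mult mult_ac)
    also have "ennreal ((s * r)\<^sup>2) * \<omega> = emeasure lebesgue (A s)"
      unfolding A_def \<omega>_def using emeasure_lebesgue_ball_conv_unit_ball[of "s * r" "q + s *\<^sub>R (b - q)"] s r by simp
    also have "\<dots> = emeasure (lebesgue_on \<Omega>) (A s)"
      using open_domain Asub by (intro emeasure_restrict_space[symmetric]) auto
    also have "ennreal ((\<bar>u q\<bar> / 2)\<^sup>2) * emeasure (lebesgue_on \<Omega>) (A s) =
        (\<integral>\<^sup>+x. ennreal ((\<bar>u q\<bar> / 2)\<^sup>2) * indicator (A s) x \<partial>lebesgue_on \<Omega>)"
      using ms by (intro nn_integral_cmult_indicator[symmetric])
    also have "\<dots> \<le> (\<integral>\<^sup>+x. indicator (A s) x * ennreal ((norm (u x))\<^sup>2) \<partial>lebesgue_on \<Omega>)"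
    proof (rule nn_integral_mono)
      fix x
      show "ennreal ((\<bar>u q\<bar> / 2)\<^sup>2) * indicator (A s) x \<le> indicator (A s) x * ennreal ((norm (u x))\<^sup>2)"
      proof (cases "x \<in> A s")
        case True
        have "(\<bar>u q\<bar> / 2)\<^sup>2 \<le> (norm (u x))\<^sup>2" by (intro power_mono big True) simp
        then have "ennreal ((\<bar>u q\<bar> / 2)\<^sup>2) \<le> ennreal ((norm (u x))\<^sup>2)" by (rule ennreal_leI)
        then show ?thesis using True by (simp only: indicator_simps mult_1 mult_1_right)
      qed simp
    qed
    also have "\<dots> \<le> ennreal (4 * (norm (s *\<^sub>R (b - a)))\<^sup>2) * ?N s"
    proof (rule bound)
      show "x - s *\<^sub>R (b - a) \<notin> \<Omega>" if x: "x \<in> A s" for x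
      proof -
        have "dist (q + s *\<^sub>R (a - q)) (x - s *\<^sub>R (b - a)) = norm (x - s *\<^sub>R (b - a) - (q + s *\<^sub>R (a - q)))"
          by (metis dist_commute dist_norm)
        also have "x - s *\<^sub>R (b - a) - (q + s *\<^sub>R (a - q)) = x - (q + s *\<^sub>R (b - q))" by (simp add: algebra_simps)
        also have "norm \<dots> = dist (q + s *\<^sub>R (b - q)) x" by (metis dist_commute dist_norm)
        also have "\<dots> < s * r" using x by (simp add: A_def)
        also have "\<dots> \<le> s * ra" using r s by simp
        finally have "x - s *\<^sub>R (b - a) \<in> ball (q + s *\<^sub>R (a - q)) (s * ra)" by simp
        then show ?thesis using a(2)[OF s(1,2)] closure_subset by blast
      qed
    qed (use Asub AW[OF s(1)] in \<open>auto simp: A_def W_def\<close>)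
    also have "\<dots> = ennreal (s\<^sup>2) * (ennreal (4 * (norm (b - a))\<^sup>2) * ?N s)"
      using s by (simp add: power_mult_distrib ennreal_mult mult_ac)
    finally show ?thesis using s by (subst (asm) ennreal_mult_le_mult_iff) auto
  qed
  define s where "s n = inverse (real (Suc n))" for n
  have s: "0 < s n" "s n \<le> 1" for n by (auto simp: s_def field_simps)
  have s0: "s \<longlonglongrightarrow> 0" unfolding s_def by (rule LIMSEQ_inverse_real_of_nat)
  have [measurable]: "g \<in> borel_measurable (lebesgue_on \<Omega>)" using g unfolding L2_def by auto
  have mW: "(indicator (W n) :: real^2 \<Rightarrow> ennreal) \<in> borel_measurable (lebesgue_on \<Omega>)" for n
    using open_domain by (subst borel_measurable_indicator_iff) (auto simp: sets_restrict_space space_restrict_space W_def)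
  note [measurable] = mW
  have "(\<lambda>n. ?N (s n)) \<longlonglongrightarrow> (\<integral>\<^sup>+x. 0 \<partial>lebesgue_on \<Omega>)"
  proof (rule nn_integral_dominated_convergence[where w = "\<lambda>x. ennreal ((norm (g x))\<^sup>2)"])
    show "(\<integral>\<^sup>+x. ennreal ((norm (g x))\<^sup>2) \<partial>lebesgue_on \<Omega>) < \<infinity>" unfolding nn_integral_L2[OF g] by simp
    show "AE x in lebesgue_on \<Omega>. (\<lambda>n. indicator (W (s n)) x * ennreal ((norm (g x))\<^sup>2)) \<longlonglongrightarrow> 0"
    proof (rule AE_I2)
      fix x assume "x \<in> space (lebesgue_on \<Omega>)"
      then have "x \<in> \<Omega>" by (simp add: space_restrict_space)
      then have "0 < dist q x" using q by auto
      moreover have "(\<lambda>n. s n * R) \<longlonglongrightarrow> 0" using tendsto_mult_right[OF s0, of R] by simp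
      ultimately have "\<forall>\<^sub>F n in sequentially. s n * R < dist q x" by (rule order_tendstoD(2)[rotated])
      then have "\<forall>\<^sub>F n in sequentially. indicator (W (s n)) x * ennreal ((norm (g x))\<^sup>2) = 0"
        by eventually_elim (simp add: W_def)
      then show "(\<lambda>n. indicator (W (s n)) x * ennreal ((norm (g x))\<^sup>2)) \<longlonglongrightarrow> 0" by (rule tendsto_eventually)
    qed
    show "(\<lambda>x. indicator (W (s n)) x * ennreal ((norm (g x))\<^sup>2)) \<in> borel_measurable (lebesgue_on \<Omega>)" for n
      by measurable
    show "AE x in lebesgue_on \<Omega>. indicator (W (s n)) x * ennreal ((norm (g x))\<^sup>2) \<le> ennreal ((norm (g x))\<^sup>2)" for n
      by (rule AE_I2) (simp add: indicator_def)
  qed measurable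
  then have "(\<lambda>n. ennreal (4 * (norm (b - a))\<^sup>2) * ?N (s n)) \<longlonglongrightarrow> ennreal (4 * (norm (b - a))\<^sup>2) * 0"
    by (intro ennreal_tendsto_cmult) auto
  moreover have "\<forall>\<^sub>F n in sequentially. \<kappa> \<le> ennreal (4 * (norm (b - a))\<^sup>2) * ?N (s n)"
  proof -
    have "(\<lambda>n. s n * R) \<longlonglongrightarrow> 0" using tendsto_mult_right[OF s0, of R] by simp
    then have "\<forall>\<^sub>F n in sequentially. s n * R < \<eta>" using \<eta>(1) by (rule order_tendstoD(2))
    then show ?thesis by eventually_elim (rule key[OF s])
  qed
  ultimately have "\<kappa> \<le> ennreal (4 * (norm (b - a))\<^sup>2) * 0"
    by (intro tendsto_lowerbound) auto
  then show False using \<kappa> by simp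
qed

end

section \<open>Norms of curls\<close>

lemma hat_on_imp_nodal_basis:
  assumes T: "triangulated \<Omega> T" and f: "hat_on T p f"
  shows "is_nodal_basis T p f"
proof -
  interpret triangulated \<Omega> T by (rule T)
  have "continuous_on (convex hull t) f" if t: "t \<in> T" for t
  proof -
    obtain a c where "\<And>x. x \<in> convex hull t \<Longrightarrow> f x = a \<bullet> x + c" using hat_onD[OF f t] by metis
    moreover have "continuous_on (convex hull t) (\<lambda>x. a \<bullet> x + c)" by (intro continuous_intros)
    ultimately show ?thesis by (simp cong: continuous_on_cong)
  qed
  then have "continuous_on (\<Union>t\<in>T. convex hull t) f"
    using finite_T triangle_hull_compact triangle_T
    by (intro continuous_on_closed_Union) (auto intro: compact_imp_closed)
  then show ?thesis using f unfolding is_nodal_basis_def pw_linear_def hat_on_def by blast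
qed

lemma grad_affine:
  assumes "x \<in> interior S" "\<And>y. y \<in> S \<Longrightarrow> f y = a \<bullet> y + c"
  shows "grad f x = a"
proof (rule has_derivative_imp_grad)
  have "((\<lambda>y. a \<bullet> y + c) has_derivative (\<lambda>h. a \<bullet> h)) (at x)" by (auto intro!: derivative_eq_intros)
  then show "(f has_derivative (\<lambda>h. a \<bullet> h)) (at x)"
    by (rule has_derivative_transform_within_open[OF _ open_interior assms(1)])
      (use assms(2) interior_subset in force)
qed

lemma norm_curl: "norm (curl f x) = norm (grad f x)"
  by (simp add: curl_def norm_vec_def L2_set_def sum_2 add.commute)

lemma curl_sum:
  assumes "grad f x = (\<Sum>k\<in>I. \<Sum>i\<in>A k. grad (g k i) x)"
  shows "curl f x = (\<Sum>k\<in>I. \<Sum>i\<in>A k. curl (g k i) x)"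
  using assms by (simp add: curl_def vec_eq_iff forall_2 sum_negf)

context triangulated
begin

lemma AE_in_interiors: "AE x in lebesgue_on \<Omega>. \<exists>t\<in>T. x \<in> interior (convex hull t)"
proof -
  let ?N = "\<Union>t\<in>T. frontier (convex hull t)"
  have "negligible ?N" using finite_T
    by (intro negligible_Union) (auto simp: negligible_convex_frontier)
  then have "?N \<in> null_sets lebesgue" by (simp add: negligible_iff_null_sets)
  then have "AE x in lebesgue. x \<notin> ?N" by (rule AE_not_in)
  then have "AE x in lebesgue_on \<Omega>. x \<notin> ?N"
    using open_domain by (subst AE_restrict_space_iff) (auto elim: eventually_mono)
  moreover have "AE x in lebesgue_on \<Omega>. x \<in> \<Omega>" by (rule AE_I2) (simp add: space_restrict_space)
  ultimately show ?thesis
  proof eventually_elim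
    case (elim x)
    then obtain t where t: "t \<in> T" "x \<in> convex hull t" using cover closure_subset by blast
    then have "x \<in> interior (convex hull t)" using elim(1) closure_subset[of "convex hull t"] unfolding frontier_def by blast
    then show ?case using t by blast
  qed
qed

lemma interiors_disjoint:
  assumes "t \<in> T" "t' \<in> T" "t \<noteq> t'"
  shows "interior (convex hull t) \<inter> interior (convex hull t') = {}"
proof -
  have "finite (t \<inter> t')" using triangle_finite[OF triangle_T[OF assms(1)]] by simp
  then have "interior (convex hull (t \<inter> t')) = {}"
    using card_common_vertices[OF assms] by (intro empty_interior_convex_hull) auto
  then show ?thesis using conforming_Int[OF conforming assms(1,2)] by (simp flip: interior_Int)
qed

lemma measure_interior_hull: "t \<in> T \<Longrightarrow> measure lebesgue (interior (convex hull t)) = measure lebesgue (convex hull t)"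
  by (intro measure_interior compact_imp_bounded triangle_hull_compact triangle_T negligible_convex_frontier) auto

lemma
  fixes b :: "(real^2) set \<Rightarrow> real"
  shows integrable_pw_constant: "integrable (lebesgue_on \<Omega>) (\<lambda>x. \<Sum>t\<in>T. indicator (interior (convex hull t)) x * b t)"
    and integral_pw_constant: "(LINT x|lebesgue_on \<Omega>. (\<Sum>t\<in>T. indicator (interior (convex hull t)) x * b t)) =
      (\<Sum>t\<in>T. measure lebesgue (convex hull t) * b t)"
proof -
  let ?I = "\<lambda>t. interior (convex hull t)"
  have Is: "?I t \<in> sets (lebesgue_on \<Omega>)" if "t \<in> T" for t
    using open_domain interior_hull_subset[OF that] by (auto simp: sets_restrict_space intro!: image_eqI[of _ _ "?I t"])
  have fin: "emeasure (lebesgue_on \<Omega>) (?I t) < \<infinity>" if "t \<in> T" for t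
  proof -
    have "emeasure (lebesgue_on \<Omega>) (?I t) = emeasure lebesgue (?I t)"
      using open_domain interior_hull_subset[OF that] by (intro emeasure_restrict_space) auto
    moreover have "?I t \<in> lmeasurable"
      using triangle_hull_compact[OF triangle_T[OF that]] by (intro lmeasurable_open bounded_interior compact_imp_bounded) auto
    ultimately show ?thesis by (simp add: fmeasurable_def)
  qed
  have int: "integrable (lebesgue_on \<Omega>) (\<lambda>x. indicator (?I t) x * b t)" if "t \<in> T" for t
    using Is[OF that] fin[OF that] by (intro integrable_mult_left integrable_real_indicator)
  then show "integrable (lebesgue_on \<Omega>) (\<lambda>x. \<Sum>t\<in>T. indicator (?I t) x * b t)"
    by (rule Bochner_Integration.integrable_sum)
  have "(LINT x|lebesgue_on \<Omega>. (\<Sum>t\<in>T. indicator (?I t) x * b t)) = (\<Sum>t\<in>T. LINT x|lebesgue_on \<Omega>. indicator (?I t) x * b t)"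
    using int by (rule Bochner_Integration.integral_sum)
  also have "\<dots> = (\<Sum>t\<in>T. measure lebesgue (convex hull t) * b t)"
  proof (rule sum.cong[OF refl])
    fix t assume t: "t \<in> T"
    have "measure (lebesgue_on \<Omega>) (?I t) = measure lebesgue (?I t)"
      using open_domain interior_hull_subset[OF t] by (intro measure_restrict_space) auto
    then show "(LINT x|lebesgue_on \<Omega>. indicator (?I t) x * b t) = measure lebesgue (convex hull t) * b t"
      using measure_interior_hull[OF t] Is[OF t] interior_hull_subset[OF t]
      by (simp add: space_restrict_space Int_absorb2)
  qed
  finally show "(LINT x|lebesgue_on \<Omega>. (\<Sum>t\<in>T. indicator (?I t) x * b t)) =
      (\<Sum>t\<in>T. measure lebesgue (convex hull t) * b t)" .
qed

text \<open>Only one summand survives at each point, as the interiors are disjoint; the sum form can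
  be integrated term by term.\<close>

lemma norm_curl_pw_affine:
  assumes f: "\<And>t x. t \<in> T \<Longrightarrow> x \<in> convex hull t \<Longrightarrow> f x = a t \<bullet> x + c t"
    and t: "t \<in> T" "x \<in> interior (convex hull t)"
  shows "(norm (curl f x))\<^sup>2 = (\<Sum>t\<in>T. indicator (interior (convex hull t)) x * (norm (a t))\<^sup>2)"
proof -
  have "(\<Sum>t\<in>T. indicator (interior (convex hull t)) x * (norm (a t))\<^sup>2) =
      (\<Sum>s\<in>{t}. indicator (interior (convex hull s)) x * (norm (a s))\<^sup>2)"
    using finite_T t interiors_disjoint by (intro sum.mono_neutral_right) (auto simp: indicator_def)
  then show ?thesis using grad_affine[OF t(2) f[OF t(1)]] t by (simp add: norm_curl)
qed

lemma L2norm_curl_lower: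
  assumes v: "v \<in> L2 \<Omega>" "ae_eq \<Omega> v (curl f)"
    and f: "\<And>t x. t \<in> T \<Longrightarrow> x \<in> convex hull t \<Longrightarrow> f x = a t \<bullet> x + c t"
  shows "(\<Sum>t\<in>T. measure lebesgue (convex hull t) * (norm (a t))\<^sup>2) \<le> (L2norm \<Omega> v)\<^sup>2"
proof -
  have "(\<Sum>t\<in>T. measure lebesgue (convex hull t) * (norm (a t))\<^sup>2) =
      (LINT x|lebesgue_on \<Omega>. (\<Sum>t\<in>T. indicator (interior (convex hull t)) x * (norm (a t))\<^sup>2))"
    by (rule integral_pw_constant[symmetric])
  also have "\<dots> \<le> (LINT x|lebesgue_on \<Omega>. (norm (v x))\<^sup>2)"
  proof (rule integral_mono_AE)
    show "AE x in lebesgue_on \<Omega>. (\<Sum>t\<in>T. indicator (interior (convex hull t)) x * (norm (a t))\<^sup>2) \<le> (norm (v x))\<^sup>2"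
      using v(2)[unfolded ae_eq_def] AE_in_interiors
      by eventually_elim (use norm_curl_pw_affine[OF f] in force)
    show "integrable (lebesgue_on \<Omega>) (\<lambda>x. (norm (v x))\<^sup>2)" using v(1) unfolding L2_def by simp
  qed (rule integrable_pw_constant)
  also have "\<dots> = (L2norm \<Omega> v)\<^sup>2" unfolding L2norm_def by simp
  finally show ?thesis .
qed

text \<open>Domination by an integrable function; \<open>integral_mono_AE'\<close> also covers the
  default value 0 of an integral that does not exist.\<close>

lemma L2norm_curl_upper:
  assumes f: "\<And>t x. t \<in> T \<Longrightarrow> x \<in> convex hull t \<Longrightarrow> f x = a t \<bullet> x + c t"
  shows "(L2norm \<Omega> (curl f))\<^sup>2 \<le> (\<Sum>t\<in>T. measure lebesgue (convex hull t) * (norm (a t))\<^sup>2)"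
proof -
  have "(L2norm \<Omega> (curl f))\<^sup>2 = (LINT x|lebesgue_on \<Omega>. (norm (curl f x))\<^sup>2)" unfolding L2norm_def by simp
  also have "\<dots> \<le> (LINT x|lebesgue_on \<Omega>. (\<Sum>t\<in>T. indicator (interior (convex hull t)) x * (norm (a t))\<^sup>2))"
  proof (rule integral_mono_AE'[OF integrable_pw_constant])
    show "AE x in lebesgue_on \<Omega>. (norm (curl f x))\<^sup>2 \<le> (\<Sum>t\<in>T. indicator (interior (convex hull t)) x * (norm (a t))\<^sup>2)"
      using AE_in_interiors by eventually_elim (use norm_curl_pw_affine[OF f] in force)
    show "AE x in lebesgue_on \<Omega>. 0 \<le> (\<Sum>t\<in>T. indicator (interior (convex hull t)) x * (norm (a t))\<^sup>2)"
      by (intro AE_I2 sum_nonneg) simp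
  qed
  also have "\<dots> = (\<Sum>t\<in>T. measure lebesgue (convex hull t) * (norm (a t))\<^sup>2)" by (rule integral_pw_constant)
  finally show ?thesis .
qed

end

section \<open>Scaling of areas and gradients\<close>

lemma mesh_measure:
  assumes "triangulated \<Omega> T" "1 \<le> k" "s \<in> mesh T k"
  shows "\<exists>t\<in>T. measure lebesgue (convex hull s) = 4 / 4 ^ k * measure lebesgue (convex hull t)"
proof -
  obtain t z e where t: "t \<in> T" "\<bar>e\<bar> = 2 / 2 ^ k" "s = (\<lambda>x. z + e *\<^sub>R x) ` t"
    using mesh_similar[OF assms] by blast
  have "convex hull s = (\<lambda>x. e *\<^sub>R x + z) ` (convex hull t)"
    unfolding t(3) by (simp only: convex_hull_affinity add.commute)
  then have "measure lebesgue (convex hull s) = \<bar>e\<bar> ^ 2 * measure lebesgue (convex hull t)"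
    using measure_lebesgue_affine[of e z "convex hull t"] by simp
  also have "\<bar>e\<bar> ^ 2 = 4 / 4 ^ k"
    unfolding t(2) by (simp add: power_divide power_mult[symmetric] power2_eq_square flip: power_mult_distrib)
  finally show ?thesis using t(1) by blast
qed

text \<open>On \<open>T1\<close> a gradient is the combination of the barycentric gradients with the
  vertex values as coefficients. Pulling back by the similarity multiplies gradients by
  \<open>e\<close>, which accounts for \<open>2 ^ k\<close>.\<close>

lemma mesh_gradient_bound:
  assumes T: "triangulated \<Omega> T"
  obtains K where "0 \<le> K" "\<And>k s a c. 1 \<le> k \<Longrightarrow> s \<in> mesh T k \<Longrightarrow>
    (\<And>v. v \<in> s \<Longrightarrow> \<bar>a \<bullet> v + c\<bar> \<le> 1) \<Longrightarrow> norm a \<le> K * 2 ^ k"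
proof -
  interpret triangulated \<Omega> T by (rule T)
  have "\<exists>K. \<forall>a c. (\<forall>v\<in>t. \<bar>a \<bullet> v + c\<bar> \<le> 1) \<longrightarrow> norm a \<le> K" if t: "t \<in> T" for t
  proof -
    obtain b :: "real^2 \<Rightarrow> real^2" and d where bd: "\<And>v w. v \<in> t \<Longrightarrow> w \<in> t \<Longrightarrow> b v \<bullet> w + d v = (if w = v then 1 else 0)"
      using triangle_barycentric[OF triangle_T[OF t]] by blast
    have "norm a \<le> (\<Sum>v\<in>t. norm (b v))" if le: "\<forall>v\<in>t. \<bar>a \<bullet> v + c\<bar> \<le> 1" for a c
    proof -
      have "a = (\<Sum>v\<in>t. (a \<bullet> v + c) *\<^sub>R b v)"
      proof (rule triangle_affine_unique(1)[OF triangle_T[OF t], where c = c and c' = "\<Sum>v\<in>t. (a \<bullet> v + c) * d v"])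
        fix x assume x: "x \<in> t"
        have "(\<Sum>v\<in>t. (a \<bullet> v + c) *\<^sub>R b v) \<bullet> x + (\<Sum>v\<in>t. (a \<bullet> v + c) * d v) = (\<Sum>v\<in>t. (a \<bullet> v + c) * (b v \<bullet> x + d v))"
          by (simp add: inner_sum_left sum.distrib distrib_left)
        also have "\<dots> = (\<Sum>v\<in>t. if x = v then a \<bullet> v + c else 0)" using x bd by (intro sum.cong refl) auto
        also have "\<dots> = a \<bullet> x + c" using x finite_t[OF t] by simp
        finally show "a \<bullet> x + c = (\<Sum>v\<in>t. (a \<bullet> v + c) *\<^sub>R b v) \<bullet> x + (\<Sum>v\<in>t. (a \<bullet> v + c) * d v)" by simp
      qed
      then have "norm a \<le> (\<Sum>v\<in>t. norm ((a \<bullet> v + c) *\<^sub>R b v))" using norm_sum by metis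
      also have "\<dots> \<le> (\<Sum>v\<in>t. norm (b v))"
        using le by (intro sum_mono) (auto intro!: mult_left_le_one_le)
      finally show ?thesis .
    qed
    then show ?thesis by blast
  qed
  then obtain K where K: "\<And>t a c. t \<in> T \<Longrightarrow> (\<forall>v\<in>t. \<bar>a \<bullet> v + c\<bar> \<le> 1) \<Longrightarrow> norm a \<le> K t" by metis
  have K0: "0 \<le> K t" if "t \<in> T" for t using K[OF that, of 0 0] by simp
  show ?thesis
  proof (rule that[of "sum K T"])
    show "0 \<le> sum K T" using K0 by (intro sum_nonneg)
    fix k s a c assume k: "1 \<le> k" and s: "s \<in> mesh T k" and le: "\<And>v. v \<in> s \<Longrightarrow> \<bar>a \<bullet> v + c\<bar> \<le> (1::real)"
    obtain t z e where t: "t \<in> T" "\<bar>e\<bar> = 2 / 2 ^ k" "s = (\<lambda>x. z + e *\<^sub>R x) ` t"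
      using mesh_similar[OF T k s] by blast
    have "\<forall>v\<in>t. \<bar>(e *\<^sub>R a) \<bullet> v + (a \<bullet> z + c)\<bar> \<le> 1"
    proof
      fix v assume "v \<in> t"
      then have "\<bar>a \<bullet> (z + e *\<^sub>R v) + c\<bar> \<le> 1" using le unfolding t(3) by blast
      then show "\<bar>(e *\<^sub>R a) \<bullet> v + (a \<bullet> z + c)\<bar> \<le> 1" by (simp add: inner_add_right algebra_simps)
    qed
    then have "\<bar>e\<bar> * norm a \<le> K t" using K[OF t(1)] by fastforce
    also have "\<dots> \<le> sum K T" using t(1) K0 finite_T by (intro member_le_sum) auto
    finally have "2 * norm a \<le> sum K T * 2 ^ k" unfolding t(2) by (simp add: field_simps)
    moreover have "0 \<le> norm a" by simp
    ultimately show "norm a \<le> sum K T * 2 ^ k" by linarith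
  qed
qed

lemma mesh_measure_bounds:
  assumes T: "triangulated \<Omega> T"
  obtains \<alpha> \<beta> where "0 < \<alpha>" "\<And>k s. 1 \<le> k \<Longrightarrow> s \<in> mesh T k \<Longrightarrow> \<alpha> / 4 ^ k \<le> measure lebesgue (convex hull s)"
    "0 \<le> \<beta>" "\<And>k s. 1 \<le> k \<Longrightarrow> s \<in> mesh T k \<Longrightarrow> measure lebesgue (convex hull s) \<le> \<beta> / 4 ^ k"
proof -
  interpret triangulated \<Omega> T by (rule T)
  let ?m = "\<lambda>t. measure lebesgue (convex hull t)"
  have pos: "0 < ?m t" if "t \<in> T" for t
  proof -
    have "\<not> negligible (convex hull t)"
      using triangle_interior_nonempty[OF triangle_T[OF that]] open_not_negligible[OF open_interior]
        negligible_subset[OF _ interior_subset] by blast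
    moreover have "convex hull t \<in> lmeasurable"
      by (intro lmeasurable_compact triangle_hull_compact triangle_T that)
    ultimately show ?thesis using negligible_iff_measure0[of "convex hull t"] by (simp add: zero_less_measure_iff)
  qed
  define \<alpha> where "\<alpha> = 4 * Min (insert 1 (?m ` T))"
  define \<beta> where "\<beta> = 4 * (\<Sum>t\<in>T. ?m t)"
  show ?thesis
  proof (rule that)
    show "0 < \<alpha>" unfolding \<alpha>_def using finite_T pos by simp
    show "0 \<le> \<beta>" unfolding \<beta>_def by (simp add: sum_nonneg)
    fix k :: nat and s assume "1 \<le> k" "s \<in> mesh T k"
    then obtain t where t: "t \<in> T" "?m s = 4 / 4 ^ k * ?m t" using mesh_measure[OF T] by blast
    have "Min (insert 1 (?m ` T)) \<le> ?m t" using finite_T t by simp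
    then have "\<alpha> / 4 ^ k \<le> 4 * ?m t / 4 ^ k" unfolding \<alpha>_def by (intro divide_right_mono) auto
    then show "\<alpha> / 4 ^ k \<le> ?m s" using t(2) by simp
    have "?m t \<le> (\<Sum>t\<in>T. ?m t)" using finite_T t by (intro member_le_sum) auto
    then have "4 * ?m t / 4 ^ k \<le> \<beta> / 4 ^ k" unfolding \<beta>_def by (intro divide_right_mono) auto
    then show "?m s \<le> \<beta> / 4 ^ k" using t(2) by simp
  qed
qed

section \<open>Assembly of the decomposition\<close>

lemma polygon_triangulated:
  assumes "polygon \<Omega>" "triangulation_of \<Omega> T"
  shows "triangulated \<Omega> T"
  using assms unfolding polygon_def triangulation_of_def
  by (unfold_locales) (auto simp: conforming_def)

lemma aff_mesh_mono:
  assumes "\<And>t. t \<in> mesh T k \<Longrightarrow> aff t f" "1 \<le> k" "k \<le> j"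
  shows "\<forall>t\<in>mesh T j. aff t f"
  using assms(3)
proof (induction j rule: dec_induct)
  case base
  then show ?case using assms(1) by blast
next
  case (step j)
  then show ?case using mesh_Suc[of j T] assms(2) aff_divide unfolding refine_def by fastforce
qed

lemma K_space_imp_L2: "v \<in> K_space \<Omega> T \<Longrightarrow> v \<in> L2 \<Omega>"
  unfolding K_space_def V_space_def H0div_def by simp

lemma (in triangulated) S_space_vertex_outside:
  assumes "\<phi> \<in> S_space \<Omega> T" "t \<in> T" "p \<in> t" "p \<notin> \<Omega>"
  shows "\<phi> p = 0"
proof -
  have "continuous_on (\<Union>t\<in>T. convex hull t) \<phi>" "\<phi> \<in> H10 \<Omega>"
    using assms(1) unfolding S_space_def pw_linear_def by auto
  then show ?thesis
    using H10_vanishes_on_boundary[OF _ assms(2) hull_inc[OF assms(3)] _ assms(4)] assms(2)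
    by (meson UN_upper continuous_on_subset)
qed

context multilevel
begin

text \<open>At most \<open>N\<close> triangles carry the hat function, and on each of them the power
  of 4 in the area cancels that in the squared gradient; this exact balance is special to the
  plane.\<close>

lemma node_norm_bound:
  fixes K \<beta> d :: real
  assumes K: "\<And>k s a c. 1 \<le> k \<Longrightarrow> s \<in> M k \<Longrightarrow> (\<And>v. v \<in> s \<Longrightarrow> \<bar>a \<bullet> v + c\<bar> \<le> 1) \<Longrightarrow> norm a \<le> K * 2 ^ k"
    and \<beta>: "0 \<le> \<beta>" "\<And>k s. 1 \<le> k \<Longrightarrow> s \<in> M k \<Longrightarrow> measure lebesgue (convex hull s) \<le> \<beta> / 4 ^ k"
    and k: "1 \<le> k"
  shows "(L2norm \<Omega> (curl (\<lambda>x. d * hat k i x)))\<^sup>2 \<le> real N * K\<^sup>2 * \<beta> * d\<^sup>2"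
proof -
  interpret L: triangulated \<Omega> "M k" by (rule tri[OF k])
  note h = hat_on_hat[OF k, of i]
  have "\<forall>t\<in>M k. \<exists>a c. \<forall>x\<in>convex hull t. hat k i x = a \<bullet> x + c" using h unfolding hat_on_def by blast
  then obtain a c where ac: "\<And>t x. t \<in> M k \<Longrightarrow> x \<in> convex hull t \<Longrightarrow> hat k i x = a t \<bullet> x + c t" by metis
  have vert: "a t \<bullet> v + c t = (if v = i then 1 else 0)" if "t \<in> M k" "v \<in> t" for t v
    using ac[OF that(1) hull_inc[OF that(2)]] hat_on_vertex[OF h that(2,1)] by simp
  have "(L2norm \<Omega> (curl (\<lambda>x. d * hat k i x)))\<^sup>2 \<le> (\<Sum>t\<in>M k. measure lebesgue (convex hull t) * (norm (d *\<^sub>R a t))\<^sup>2)"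
    by (rule L.L2norm_curl_upper[where c = "\<lambda>t. d * c t"]) (simp add: ac distrib_left)
  also have "\<dots> = (\<Sum>t\<in>{t \<in> M k. i \<in> t}. measure lebesgue (convex hull t) * (norm (d *\<^sub>R a t))\<^sup>2)"
  proof (rule sum.mono_neutral_right)
    show "\<forall>t\<in>M k - {t \<in> M k. i \<in> t}. measure lebesgue (convex hull t) * (norm (d *\<^sub>R a t))\<^sup>2 = 0"
    proof
      fix t assume t: "t \<in> M k - {t \<in> M k. i \<in> t}"
      then have "a t = 0"
        using vert by (intro triangle_affine_unique(1)[of t _ "c t" _ 0] L.triangle_T) auto
      then show "measure lebesgue (convex hull t) * (norm (d *\<^sub>R a t))\<^sup>2 = 0" by simp
    qed
  qed (use L.finite_T in auto)
  also have "\<dots> \<le> (\<Sum>t\<in>{t \<in> M k. i \<in> t}. \<beta> * K\<^sup>2 * d\<^sup>2)"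
  proof (rule sum_mono)
    fix t assume t: "t \<in> {t \<in> M k. i \<in> t}"
    have "norm (a t) \<le> K * 2 ^ k" by (rule K[OF k, where c = "c t"]) (use t vert in auto)
    then have "(norm (a t))\<^sup>2 \<le> (K * 2 ^ k)\<^sup>2" by (rule power_mono) simp
    also have "\<dots> = K\<^sup>2 * 4 ^ k"
      by (simp add: power_mult_distrib power_mult[symmetric] mult.commute[of k]) (simp add: power_mult)
    finally have "(norm (d *\<^sub>R a t))\<^sup>2 \<le> d\<^sup>2 * (K\<^sup>2 * 4 ^ k)"
      by (simp add: power_mult_distrib mult_left_mono)
    then have "measure lebesgue (convex hull t) * (norm (d *\<^sub>R a t))\<^sup>2 \<le> \<beta> / 4 ^ k * (d\<^sup>2 * (K\<^sup>2 * 4 ^ k))"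
      using \<beta>(2)[OF k] t \<beta>(1) by (intro mult_mono) auto
    then show "measure lebesgue (convex hull t) * (norm (d *\<^sub>R a t))\<^sup>2 \<le> \<beta> * K\<^sup>2 * d\<^sup>2" by (simp add: mult_ac)
  qed
  also have "\<dots> = card {t \<in> M k. i \<in> t} * (\<beta> * K\<^sup>2 * d\<^sup>2)" by simp
  also have "\<dots> \<le> N * (\<beta> * K\<^sup>2 * d\<^sup>2)"
    using N_level[OF k, of i] \<beta>(1) by (intro mult_right_mono) auto
  finally show ?thesis by (simp add: mult_ac)
qed

text \<open>The top companion coincides with \<phi> on the mesh, so the telescoping sum decomposes
  \<phi>; taking curls in the interiors of the finest triangles covers almost every point. The top
  interpolant is \<phi> as well, so \<open>E J\<close> is its squared gradient norm up to the
  areas.\<close>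

lemma decomposition:
  assumes \<phi>: "\<phi> \<in> S_space \<Omega> (M J)" and u: "\<And>x. x \<in> \<Omega> \<Longrightarrow> u x = \<phi> x"
    and v: "v \<in> L2 \<Omega>" "ae_eq \<Omega> v (curl \<phi>)"
    and \<alpha>: "0 < \<alpha>" "\<And>k s. 1 \<le> k \<Longrightarrow> s \<in> M k \<Longrightarrow> \<alpha> / 4 ^ k \<le> measure lebesgue (convex hull s)"
  shows "ae_eq \<Omega> v (\<lambda>x. \<Sum>k=1..J. \<Sum>i\<in>nodes \<Omega> (M k). curl (\<lambda>x. (F k i - F (k - 1) i) * hat k i x) x)"
    and "E J \<le> (L2norm \<Omega> v)\<^sup>2 / \<alpha>"
proof -
  interpret L: triangulated \<Omega> "M J" by (rule tri[OF J])
  have aff_\<phi>: "aff t \<phi>" if "t \<in> M J" for t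
    using \<phi> that unfolding S_space_def pw_linear_def aff_def by blast
  have u_vertex: "u p = \<phi> p" if "t \<in> M J" "p \<in> t" for t p
    using u u_outside L.S_space_vertex_outside[OF \<phi> that] by (cases "p \<in> \<Omega>") auto
  have F\<phi>: "F J x = \<phi> x" if t: "t \<in> M J" "x \<in> convex hull t" for t x
    by (rule aff_eq[OF aff_F[OF J t(1)] aff_\<phi>[OF t(1)] _ t(2)])
      (use F_vertex[OF J t(1)] U_top[OF t(1)] u_vertex[OF t(1)] in auto)
  let ?g = "\<lambda>k i x. (F k i - F (k - 1) i) * hat k i x"
  \<comment> \<open>Coarser hat functions are affine on the finest triangles too, so near an
    interior point all terms are smooth and gradients add up.\<close>
  have aff_g: "aff t (?g k i)" if "k \<in> {1..J}" "t \<in> M J" for k i t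
    using aff_mesh_mono[of T1 k "?g k i" J] aff_hat aff_cmult that by auto
  show "ae_eq \<Omega> v (\<lambda>x. \<Sum>k=1..J. \<Sum>i\<in>nodes \<Omega> (M k). curl (?g k i) x)"
    unfolding ae_eq_def
    using v(2)[unfolded ae_eq_def] L.AE_in_interiors
  proof eventually_elim
    case (elim x)
    then obtain t where t: "t \<in> M J" "x \<in> interior (convex hull t)" by blast
    have "\<forall>k i. k \<in> {1..J} \<longrightarrow> (\<exists>ac. \<forall>y\<in>convex hull t. ?g k i y = fst ac \<bullet> y + snd ac)"
      using aff_g[OF _ t(1)] unfolding aff_def by fastforce
    then obtain ac where ac: "\<And>k i y. k \<in> {1..J} \<Longrightarrow> y \<in> convex hull t \<Longrightarrow>
        ?g k i y = fst (ac k i) \<bullet> y + snd (ac k i)" by metis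
    have "grad \<phi> x = (\<Sum>k=1..J. \<Sum>i\<in>nodes \<Omega> (M k). fst (ac k i))"
    proof (rule grad_affine[OF t(2)])
      fix y assume y: "y \<in> convex hull t"
      then have "\<phi> y = F J y" using F\<phi> t(1) by simp
      also have "\<dots> = (\<Sum>k=1..J. \<Sum>i\<in>nodes \<Omega> (M k). ?g k i y)"
        using telescoping[of y] L.hull_subset_closure[OF t(1)] y by auto
      also have "\<dots> = (\<Sum>k=1..J. \<Sum>i\<in>nodes \<Omega> (M k). fst (ac k i) \<bullet> y + snd (ac k i))"
        using ac y by (intro sum.cong refl) auto
      finally show "\<phi> y = (\<Sum>k=1..J. \<Sum>i\<in>nodes \<Omega> (M k). fst (ac k i)) \<bullet> y +
          (\<Sum>k=1..J. \<Sum>i\<in>nodes \<Omega> (M k). snd (ac k i))"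
        by (simp add: sum.distrib inner_sum_left)
    qed
    also have "\<dots> = (\<Sum>k=1..J. \<Sum>i\<in>nodes \<Omega> (M k). grad (?g k i) x)"
    proof (intro sum.cong refl)
      fix k i assume "k \<in> {1..J}"
      then show "fst (ac k i) = grad (?g k i) x"
        by (intro grad_affine[OF t(2), symmetric, where c = "snd (ac k i)"] ac)
    qed
    finally have "curl \<phi> x = (\<Sum>k=1..J. \<Sum>i\<in>nodes \<Omega> (M k). curl (?g k i) x)" by (rule curl_sum)
    then show ?case using elim(1) by simp
  qed
  have "\<phi> x = G J t \<bullet> x + snd (SOME gc. is_cr (m J) t gc)" if t: "t \<in> M J" "x \<in> convex hull t" for t x
  proof -
    have "aff t (cr (m J) t)" by (rule affI) (rule cr_def)
    then have "\<phi> x = cr (m J) t x"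
      by (intro aff_eq[OF aff_\<phi>[OF t(1)] _ _ t(2)]) (use cr_top[OF t(1)] u_vertex[OF t(1)] in auto)
    then show ?thesis by (simp add: cr_def)
  qed
  then have "(\<Sum>t\<in>M J. measure lebesgue (convex hull t) * (norm (G J t))\<^sup>2) \<le> (L2norm \<Omega> v)\<^sup>2"
    by (rule L.L2norm_curl_lower[OF v])
  moreover have "\<alpha> * E J = (\<Sum>t\<in>M J. \<alpha> / 4 ^ J * (norm (G J t))\<^sup>2)"
    unfolding E_def by (simp add: sum_distrib_left sum_divide_distrib)
  moreover have "\<dots> \<le> (\<Sum>t\<in>M J. measure lebesgue (convex hull t) * (norm (G J t))\<^sup>2)"
    using \<alpha>(2)[OF J] by (intro sum_mono mult_right_mono) auto
  ultimately have "\<alpha> * E J \<le> (L2norm \<Omega> v)\<^sup>2" by linarith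
  then show "E J \<le> (L2norm \<Omega> v)\<^sup>2 / \<alpha>" using \<alpha>(1) by (simp add: field_simps)
qed

end

theorem theorem6p5:
  fixes \<Omega> :: "(real^2) set" and T1 :: "(real^2) set set" and \<sigma> \<tau> :: real
  assumes "polygon \<Omega>"
    and "triangulation_of \<Omega> T1"
    and "shape_regular \<sigma> T1"
    and "\<And>k. k \<ge> 1 \<Longrightarrow> quasi_uniform \<tau> (mesh T1 k)"
  shows "\<exists>C>0. \<forall>J\<ge>1. (\<forall>k\<in>{1..J}. exact_sequence \<Omega> (mesh T1 k)) \<longrightarrow>
    (\<forall>v \<in> K_space \<Omega> (mesh T1 J).
      \<exists>w :: nat \<Rightarrow> real^2 \<Rightarrow> real^2 \<Rightarrow> real^2.
        (\<forall>k\<in>{1..J}. \<forall>i\<in>nodes \<Omega> (mesh T1 k). w k i \<in> K_node \<Omega> (mesh T1 k) i) \<and>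
        ae_eq \<Omega> v (\<lambda>x. \<Sum>k=1..J. \<Sum>i\<in>nodes \<Omega> (mesh T1 k). w k i x) \<and>
        (\<Sum>k=1..J. \<Sum>i\<in>nodes \<Omega> (mesh T1 k). (L2norm \<Omega> (w k i))\<^sup>2) \<le> C * (L2norm \<Omega> v)\<^sup>2)"
proof -
  have T: "triangulated \<Omega> T1" by (rule polygon_triangulated[OF assms(1,2)])
  interpret T: triangulated \<Omega> T1 by (rule T)
  define H where "H = diameter (closure \<Omega>)"
  have H: "dist x y \<le> H" if "t \<in> T1" "x \<in> convex hull t" "y \<in> convex hull t" for t x y
    unfolding H_def using T.hull_subset_closure[OF that(1)] that(2,3) T.bounded_domain
    by (intro diameter_bounded_bound) (auto simp: bounded_closure)
  obtain K where K: "0 \<le> K" "\<And>k s a c. 1 \<le> k \<Longrightarrow> s \<in> mesh T1 k \<Longrightarrow>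
      (\<And>v. v \<in> s \<Longrightarrow> \<bar>a \<bullet> v + c\<bar> \<le> 1) \<Longrightarrow> norm a \<le> K * 2 ^ k"
    using mesh_gradient_bound[OF T] by blast
  obtain \<alpha> \<beta> where \<alpha>: "0 < \<alpha>" "\<And>k s. 1 \<le> k \<Longrightarrow> s \<in> mesh T1 k \<Longrightarrow> \<alpha> / 4 ^ k \<le> measure lebesgue (convex hull s)"
    and \<beta>: "0 \<le> \<beta>" "\<And>k s. 1 \<le> k \<Longrightarrow> s \<in> mesh T1 k \<Longrightarrow> measure lebesgue (convex hull s) \<le> \<beta> / 4 ^ k"
    using mesh_measure_bounds[OF T] by blast
  \<comment> \<open>The locale constants depend on \<open>T1\<close> and \<open>H\<close> only and
    are available before \<open>u\<close> and \<open>J\<close>. The 1 added to \<open>C\<close>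
    makes it positive.\<close>
  define C0 where "C0 = real (multilevel.N T1) * K\<^sup>2 * \<beta>"
  define C where "C = C0 * (multilevel.bound T1 H / \<alpha>) + 1"
  have C0: "0 \<le> C0" unfolding C0_def using \<beta>(1) by simp
  have main: "\<exists>w :: nat \<Rightarrow> real^2 \<Rightarrow> real^2 \<Rightarrow> real^2.
        (\<forall>k\<in>{1..J}. \<forall>i\<in>nodes \<Omega> (mesh T1 k). w k i \<in> K_node \<Omega> (mesh T1 k) i) \<and>
        ae_eq \<Omega> v (\<lambda>x. \<Sum>k=1..J. \<Sum>i\<in>nodes \<Omega> (mesh T1 k). w k i x) \<and>
        (\<Sum>k=1..J. \<Sum>i\<in>nodes \<Omega> (mesh T1 k). (L2norm \<Omega> (w k i))\<^sup>2) \<le> C * (L2norm \<Omega> v)\<^sup>2"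
    if J: "1 \<le> J" and ex: "exact_sequence \<Omega> (mesh T1 J)" and v: "v \<in> K_space \<Omega> (mesh T1 J)" for J v
  proof -
    have "v \<in> {v. \<exists>\<phi> \<in> S_space \<Omega> (mesh T1 J). ae_eq \<Omega> v (curl \<phi>)}"
      using ex v unfolding exact_sequence_def by simp
    then obtain \<phi> where \<phi>: "\<phi> \<in> S_space \<Omega> (mesh T1 J)" "ae_eq \<Omega> v (curl \<phi>)" by blast
    \<comment> \<open>Values of \<phi> away from the closure of the domain are arbitrary;
      \<open>multilevel\<close> wants the extension by zero.\<close>
    define u where "u x = (if x \<in> \<Omega> then \<phi> x else 0)" for x
    interpret multilevel \<Omega> T1 u J H
      by unfold_locales (use T J H in \<open>auto simp: u_def\<close>)
    have b0: "0 \<le> multilevel.bound T1 H" unfolding bound_def by simp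
    let ?d = "\<lambda>k i. F k i - F (k - 1) i"
    let ?w = "\<lambda>k i. curl (\<lambda>x. ?d k i * hat k i x)"
    note dec = decomposition[OF \<phi>(1) _ K_space_imp_L2[OF v] \<phi>(2) \<alpha>]
    have "?w k i \<in> K_node \<Omega> (mesh T1 k) i" if "k \<in> {1..J}" for k i
    proof -
      have "is_nodal_basis (mesh T1 k) i (hat k i)"
        using hat_on_imp_nodal_basis[OF tri hat_on_hat] that by simp
      then have "(\<lambda>x. ?d k i * hat k i x) \<in> Phi_space (mesh T1 k) i" unfolding Phi_space_def by blast
      then show ?thesis unfolding K_node_def ae_eq_def by auto
    qed
    moreover have "ae_eq \<Omega> v (\<lambda>x. \<Sum>k=1..J. \<Sum>i\<in>nodes \<Omega> (mesh T1 k). ?w k i x)"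
      by (rule dec(1)) (simp add: u_def)
    moreover have "(\<Sum>k=1..J. \<Sum>i\<in>nodes \<Omega> (mesh T1 k). (L2norm \<Omega> (?w k i))\<^sup>2) \<le> C * (L2norm \<Omega> v)\<^sup>2"
    proof -
      have "(\<Sum>k=1..J. \<Sum>i\<in>nodes \<Omega> (mesh T1 k). (L2norm \<Omega> (?w k i))\<^sup>2) \<le>
          (\<Sum>k=1..J. \<Sum>i\<in>nodes \<Omega> (mesh T1 k). C0 * (?d k i)\<^sup>2)"
        unfolding C0_def
      proof (intro sum_mono node_norm_bound)
        fix k s a c assume "1 \<le> k" "s \<in> mesh T1 k" "\<And>v. v \<in> s \<Longrightarrow> \<bar>a \<bullet> v + c\<bar> \<le> (1::real)"
        then show "norm a \<le> K * 2 ^ k" by (rule K(2))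
      qed (use \<beta> in auto)
      also have "\<dots> = C0 * (\<Sum>k=1..J. \<Sum>i\<in>nodes \<Omega> (mesh T1 k). (?d k i)\<^sup>2)"
        by (simp add: sum_distrib_left)
      also have "\<dots> \<le> C0 * (multilevel.bound T1 H * E J)"
        by (intro mult_left_mono coefficient_bound C0)
      also have "\<dots> \<le> C0 * (multilevel.bound T1 H * ((L2norm \<Omega> v)\<^sup>2 / \<alpha>))"
        using dec(2) by (intro mult_left_mono C0 b0) (simp add: u_def)
      also have "\<dots> \<le> C * (L2norm \<Omega> v)\<^sup>2"
        unfolding C_def by (simp add: algebra_simps)
      finally show ?thesis .
    qed
    ultimately show "\<exists>w :: nat \<Rightarrow> real^2 \<Rightarrow> real^2 \<Rightarrow> real^2.
        (\<forall>k\<in>{1..J}. \<forall>i\<in>nodes \<Omega> (mesh T1 k). w k i \<in> K_node \<Omega> (mesh T1 k) i) \<and>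
        ae_eq \<Omega> v (\<lambda>x. \<Sum>k=1..J. \<Sum>i\<in>nodes \<Omega> (mesh T1 k). w k i x) \<and>
        (\<Sum>k=1..J. \<Sum>i\<in>nodes \<Omega> (mesh T1 k). (L2norm \<Omega> (w k i))\<^sup>2) \<le> C * (L2norm \<Omega> v)\<^sup>2"
      by (intro exI[of _ ?w]) blast
  qed
  have "0 < C"
  proof -
    \<comment> \<open>A dummy instance that serves to unfold \<open>bound\<close> and read off its
      sign.\<close>
    interpret multilevel \<Omega> T1 "\<lambda>_. 0" 1 H by unfold_locales (use T H in auto)
    have "0 \<le> multilevel.bound T1 H" unfolding bound_def by simp
    then show ?thesis unfolding C_def using C0 \<alpha>(1) by (simp add: add_nonneg_pos)
  qed
  then show ?thesis using main by (intro exI[of _ C]) auto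
qed

end
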